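(* Let $d>0$ be even and $s\ge2$. For each $S$ let $\nu_S$ be a strictly positive probability measure on $S$ and $\bar\nu_S=\nu_S^{\mathbb{N}}$. Then \[\liminf_{B\to\infty}\frac{\#\{S\in\mathcal{S}^{\mathrm{Mon}}(d,s,B):\bar\nu_S(\mathrm{SurArb}(S))>0\}}{\#\mathcal{S}^{\mathrm{Mon}}(d,s,B)}\ge1-\Big(1-\big(\tfrac12\big)^{d/2}\Big)^s.\]
   Context: $M_d(B)$ is the set of monic degree-$d$ polynomials in $\mathbb{Z}[t]$ all of whose coefficients have absolute value at most $B$; $\mathcal{S}^{\mathrm{Mon}}(d,s,B)$ is the collection of $s$-element subsets $\{c_1,\dots,c_s\}$ of $M_d(B)$, each identified with $S=\{x^2+c_1,\dots,x^2+c_s\}$. Let $K=\mathbb{Q}(t)$ and $\Phi_S=S^{\mathbb{N}}$. For $\gamma=(\theta_n)\in\Phi_S$, $\gamma_n=\theta_1\circ\cdots\circ\theta_n$; $\Phi_S^{\mathrm{sep}}$ is the set of $\gamma$ with every $\gamma_n$ separable. $K_n(\gamma)$ is the splitting field of $\gamma_n$ over $K$, $G_{\gamma,K}=\varprojlim\mathrm{Gal}(K_n(\gamma)/K)$, which acts on the preimage tree $T_\gamma$ (vertices $0$ and all $\alpha\in\overline K$ with $\gamma_m(\alpha)=0$ for some $m\ge1$, edges $\alpha$—$\theta_m(\alpha)$ when $\gamma_m(\alpha)=0$), giving $G_{\gamma,K}\le\mathrm{Aut}(T_\gamma)$. $\mathrm{SurArb}(S)=\{\gamma\in\Phi_S^{\mathrm{sep}}:G_{\gamma,\mathbb{Q}(t)}=\mathrm{Aut}(T_\gamma)\}$.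 A probability measure on $S$ is strictly positive if every element has positive mass. *)

theory Defs
  imports
    "HOL-Algebra.Algebraic_Closure_Type"
    "HOL-Algebra.Generated_Fields"
    "HOL-Computational_Algebra.Fraction_Field"
    "HOL-Probability.Probability"
begin

type_synonym ratfun = "rat poly fract"

definition ratfun_of_int_poly :: "int poly \<Rightarrow> ratfun" where
  "ratfun_of_int_poly c = Fraction_Field.Fract (map_poly rat_of_int c) 1"

definition monic_polys :: "nat \<Rightarrow> nat \<Rightarrow> int poly set" where
  "monic_polys d B =
     {c. Polynomial.degree c = d \<and> Polynomial.lead_coeff c = 1 \<and>
         (\<forall>i. \<bar>Polynomial.coeff c i\<bar> \<le> int B)}"

definition S_Mon :: "nat \<Rightarrow> nat \<Rightarrow> nat \<Rightarrow> int poly set set" where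
  "S_Mon d s B = {C. C \<subseteq> monic_polys d B \<and> card C = s}"

definition quads :: "int poly set \<Rightarrow> ratfun poly set" where
  "quads C = (\<lambda>c. [:ratfun_of_int_poly c, 0, 1:]) ` C"

text \<open>
  A sequence \<open>(\<theta>\<^sub>1, \<theta>\<^sub>2, \<dots>)\<close> is a function \<open>\<theta>\<close> on the natural numbers whose value at \<open>n\<close> is
  \<open>\<theta>\<^sub>n\<^sub>+\<^sub>1\<close>. Thus \<open>iter_comp \<theta> n\<close> is \<open>\<gamma>\<^sub>n = \<theta>\<^sub>1 \<circ> \<dots> \<circ> \<theta>\<^sub>n\<close>, with \<open>\<gamma>\<^sub>0 = x\<close>.
\<close>

definition seqs :: "ratfun poly set \<Rightarrow> (nat \<Rightarrow> ratfun poly) set" where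
  "seqs S = (UNIV \<rightarrow> S)"

fun iter_comp :: "(nat \<Rightarrow> ratfun poly) \<Rightarrow> nat \<Rightarrow> ratfun poly" where
  "iter_comp \<theta> 0 = [:0, 1:]"
| "iter_comp \<theta> (Suc n) = pcompose (iter_comp \<theta> n) (\<theta> n)"

abbreviation poly_ac :: "ratfun poly \<Rightarrow> ratfun alg_closure poly" where
  "poly_ac p \<equiv> map_poly to_ac p"

definition separable :: "ratfun poly \<Rightarrow> bool" where
  "separable p \<longleftrightarrow> rsquarefree (poly_ac p)"

definition seqs_sep :: "ratfun poly set \<Rightarrow> (nat \<Rightarrow> ratfun poly) set" where
  "seqs_sep S = {\<theta> \<in> seqs S. \<forall>n\<ge>1. separable (iter_comp \<theta> n)}"

definition splitting_field :: "ratfun poly \<Rightarrow> ratfun alg_closure set" where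
  "splitting_field p =
     generate_field ring_of_type_algebra (range to_ac \<union> {\<alpha>. poly (poly_ac p) \<alpha> = 0})"

definition subfield_ring :: "ratfun alg_closure set \<Rightarrow> ratfun alg_closure ring" where
  "subfield_ring L = ring_of_type_algebra \<lparr>carrier := L\<rparr>"

text \<open>
  Automorphisms are represented as functions that are \<open>undefined\<close> outside their domain, so that
  equality of functions is equality of automorphisms.
\<close>

definition Gal :: "ratfun alg_closure set \<Rightarrow> (ratfun alg_closure \<Rightarrow> ratfun alg_closure) set" where
  "Gal L = {\<sigma> \<in> ring_iso (subfield_ring L) (subfield_ring L) \<inter> extensional L.
              \<forall>a. \<sigma> (to_ac a) = to_ac a}"

definition K_lev :: "(nat \<Rightarrow> ratfun poly) \<Rightarrow> nat \<Rightarrow> ratfun alg_closure set" where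
  "K_lev \<theta> n = splitting_field (iter_comp \<theta> n)"

text \<open>
  The inverse limit of the groups \<open>Gal(K\<^sub>n/K)\<close> along the restriction maps. Index \<open>0\<close>
  contributes only the trivial group \<open>Gal(K/K)\<close>.
\<close>

definition Gal_lim ::
  "(nat \<Rightarrow> ratfun poly) \<Rightarrow> (nat \<Rightarrow> ratfun alg_closure \<Rightarrow> ratfun alg_closure) set" where
  "Gal_lim \<theta> = {\<sigma>. (\<forall>n. \<sigma> n \<in> Gal (K_lev \<theta> n)) \<and>
                   (\<forall>m n. m \<le> n \<longrightarrow> restrict (\<sigma> n) (K_lev \<theta> m) = \<sigma> m)}"

definition tree_verts :: "(nat \<Rightarrow> ratfun poly) \<Rightarrow> ratfun alg_closure set" where
  "tree_verts \<theta> = {0} \<union> {\<alpha>. \<exists>m\<ge>1. poly (poly_ac (iter_comp \<theta> m)) \<alpha> = 0}"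

definition tree_edges :: "(nat \<Rightarrow> ratfun poly) \<Rightarrow> ratfun alg_closure set set" where
  "tree_edges \<theta> = {{\<alpha>, poly (poly_ac (\<theta> (m - 1))) \<alpha>} | \<alpha> m.
                     m \<ge> 1 \<and> poly (poly_ac (iter_comp \<theta> m)) \<alpha> = 0}"

text \<open>
  Fixing the root \<open>0\<close> need not be required separately: in an infinite binary tree the root is the
  only vertex of degree 2, all others having degree 3.
\<close>

definition Aut_tree ::
  "(nat \<Rightarrow> ratfun poly) \<Rightarrow> (ratfun alg_closure \<Rightarrow> ratfun alg_closure) set" where
  "Aut_tree \<theta> = {f \<in> extensional (tree_verts \<theta>).
     bij_betw f (tree_verts \<theta>) (tree_verts \<theta>) \<and>
     (\<forall>u\<in>tree_verts \<theta>. \<forall>v\<in>tree_verts \<theta>.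
        {f u, f v} \<in> tree_edges \<theta> \<longleftrightarrow> {u, v} \<in> tree_edges \<theta>)}"

text \<open>
  A compatible family \<open>\<sigma>\<close> acts on a vertex \<open>\<alpha>\<close> through any component \<open>\<sigma> n\<close> with \<open>\<alpha> \<in> K\<^sub>n\<close>;
  by compatibility the choice of \<open>n\<close> is irrelevant.
\<close>

definition tree_action ::
  "(nat \<Rightarrow> ratfun poly) \<Rightarrow> (nat \<Rightarrow> ratfun alg_closure \<Rightarrow> ratfun alg_closure)
     \<Rightarrow> (ratfun alg_closure \<Rightarrow> ratfun alg_closure)" where
  "tree_action \<theta> \<sigma> = (\<lambda>\<alpha>\<in>tree_verts \<theta>. \<sigma> (LEAST n. \<alpha> \<in> K_lev \<theta> n) \<alpha>)"

definition SurArb :: "ratfun poly set \<Rightarrow> (nat \<Rightarrow> ratfun poly) set" where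
  "SurArb S = {\<theta> \<in> seqs_sep S. tree_action \<theta> ` Gal_lim \<theta> = Aut_tree \<theta>}"

definition strictly_positive_prob :: "ratfun poly set \<Rightarrow> ratfun poly measure \<Rightarrow> bool" where
  "strictly_positive_prob S M \<longleftrightarrow>
     prob_space M \<and> sets M = Pow S \<and> (\<forall>x\<in>S. measure M {x} > 0)"

definition seq_measure :: "ratfun poly measure \<Rightarrow> (nat \<Rightarrow> ratfun poly) measure" where
  "seq_measure M = Pi\<^sub>M UNIV (\<lambda>_. M)"

end

theory Submission
  imports Defs "HOL-Real_Asymp.Real_Asymp"
begin

text \<open>
  Write \<open>\<gamma>\<^sub>n\<close> for the \<open>n\<close>-th composition. By Kummer theory (Stoll's argument) the arboreal
  representation of a quadratic sequence is surjective exactly if \<open>-\<gamma>\<^sub>1(0), \<gamma>\<^sub>2(0), \<gamma>\<^sub>3(0), \<dots>\<close> are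
  independent modulo squares of \<open>\<rat>(t)\<close>. Suppose the derivative of \<open>c\<^sub>1\<close> is 1 modulo 2. Since
  \<open>\<gamma>\<^sub>n(0) = y\<^sup>2 + c\<^sub>1\<close>, the derivative of \<open>\<gamma>\<^sub>n(0)\<close> is also 1 modulo 2, so this monic polynomial is
  squarefree; its degree \<open>2\<^sup>n\<^sup>-\<^sup>1 d\<close> exceeds the sum of the degrees of its predecessors, which gives
  independence. Hence every sequence starting with \<open>x\<^sup>2 + c\<^sub>1\<close> is surjective, an event of positive
  measure. The condition on \<open>c\<^sub>1\<close> prescribes the parity of \<open>d/2\<close> of its coefficients, so a set of
  \<open>s\<close> polynomials avoids it with probability tending to at most \<open>(1 - 2\<^sup>-\<^sup>d\<^sup>/\<^sup>2)\<^sup>s\<close>.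
\<close>

section \<open>Subfields and adjunction of square roots\<close>

text \<open>Why one element per level decides: the relations modulo squares among the radicands
  \<open>\<alpha> - c n\<close> of one level form a vector space over the field with two elements on
  which a 2-group acts. If it is nonzero it contains a nonzero invariant relation, and transitivity
  on the level leaves only the product over the whole level. Two obstacles shape the rest. The
  vertices of the tree are elements of the algebraic closure, so the graph is a binary tree only if
  no element is a zero of both \<open>\<gamma>\<^sub>m\<close> and \<open>\<gamma>\<^sub>n\<close>
  with m and n different. For monic integral coefficients of positive degree this is proved by a
  congruence modulo 4 in rings of integral elements. Moreover, \<open>SurArb\<close> must be shown
  measurable, which needs an exact description of it: both directions of the independence criterion
  are proved, and for every sequence over S rather than only for those with a good first
  map.\<close>

definition is_subfield :: "'a::field set \<Rightarrow> bool" where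
  "is_subfield L \<longleftrightarrow> 1 \<in> L \<and> (\<forall>x\<in>L. - x \<in> L \<and> inverse x \<in> L) \<and>
     (\<forall>x\<in>L. \<forall>y\<in>L. x + y \<in> L \<and> x * y \<in> L)"

abbreviation fgen :: "'a::field set \<Rightarrow> 'a set" where
  "fgen H \<equiv> generate_field ring_of_type_algebra H"

lemma subfield_closed:
  assumes "is_subfield L"
  shows "0 \<in> L" "1 \<in> L" "x \<in> L \<Longrightarrow> - x \<in> L" "x \<in> L \<Longrightarrow> inverse x \<in> L"
    "x \<in> L \<Longrightarrow> y \<in> L \<Longrightarrow> x + y \<in> L" "x \<in> L \<Longrightarrow> y \<in> L \<Longrightarrow> x - y \<in> L"
    "x \<in> L \<Longrightarrow> y \<in> L \<Longrightarrow> x * y \<in> L" "x \<in> L \<Longrightarrow> y \<in> L \<Longrightarrow> x / y \<in> L"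
    "x \<in> L \<Longrightarrow> x ^ k \<in> L"
proof -
  note a = assms[unfolded is_subfield_def]
  have p: "x + y \<in> L" if "x \<in> L" "y \<in> L" for x y using a that by blast
  have m: "- x \<in> L" if "x \<in> L" for x using a that by blast
  show "0 \<in> L" using p[of 1 "-1"] m[of 1] a by simp
  show "x \<in> L \<Longrightarrow> y \<in> L \<Longrightarrow> x - y \<in> L" using p[of x "- y"] m[of y] by simp
  show "x \<in> L \<Longrightarrow> y \<in> L \<Longrightarrow> x / y \<in> L" using a by (simp add: field_class.field_divide_inverse)
  show "x \<in> L \<Longrightarrow> x ^ k \<in> L" using a by (induction k) auto
qed (use assms in \<open>auto simp: is_subfield_def\<close>)

lemma subfield_prod: "is_subfield L \<Longrightarrow> (\<And>i. i \<in> A \<Longrightarrow> f i \<in> L) \<Longrightarrow> prod f A \<in> L"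
  by (induction A rule: infinite_finite_induct) (auto simp: subfield_closed)

lemma ring_of_type_algebra_simps [simp]:
  "carrier ring_of_type_algebra = UNIV" "monoid.mult ring_of_type_algebra x y = x * y"
  "one ring_of_type_algebra = 1" "ring.zero ring_of_type_algebra = 0"
  "add ring_of_type_algebra x y = x + y"
  by (simp_all add: ring_of_type_algebra_def)

lemma a_inv_type_algebra: "a_inv ring_of_type_algebra x = - (x::'a::field)"
proof -
  interpret r: field "ring_of_type_algebra :: 'a ring" by (rule field_from_type_algebra)
  have "a_inv ring_of_type_algebra x + x = 0"
    using r.l_neg[of x] by simp
  then show ?thesis by (simp add: eq_neg_iff_add_eq_0)
qed

lemma m_inv_type_algebra: "(x::'a::field) \<noteq> 0 \<Longrightarrow> m_inv ring_of_type_algebra x = inverse x"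
proof -
  interpret r: field "ring_of_type_algebra :: 'a ring" by (rule field_from_type_algebra)
  assume x: "x \<noteq> 0"
  then have "x \<in> Units ring_of_type_algebra" using r.field_Units by simp
  then have "m_inv ring_of_type_algebra x * x = 1" using r.Units_l_inv[of x] by simp
  then show ?thesis using x by (simp add: field_simps)
qed

lemma fgen_incl: "H \<subseteq> fgen H"
  by (auto intro: generate_field.incl)

lemma subfield_fgen: "is_subfield (fgen H)"
proof -
  have 1: "1 \<in> fgen H" using generate_field.one[of ring_of_type_algebra H] by simp
  have m: "- x \<in> fgen H" if "x \<in> fgen H" for x
    using generate_field.a_inv[OF that] by (simp add: a_inv_type_algebra)
  have p: "x + y \<in> fgen H" if "x \<in> fgen H" "y \<in> fgen H" for x y
    using generate_field.eng_add[OF that] by simp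
  have t: "x * y \<in> fgen H" if "x \<in> fgen H" "y \<in> fgen H" for x y
    using generate_field.eng_mult[OF that] by simp
  have z: "0 \<in> fgen H" using p[OF 1 m[OF 1]] by simp
  have i: "inverse x \<in> fgen H" if "x \<in> fgen H" for x
    using generate_field.m_inv[OF that] z by (cases "x = 0") (simp_all add: m_inv_type_algebra)
  show ?thesis unfolding is_subfield_def by (intro conjI ballI 1 m p t i)
qed

lemma fgen_least:
  assumes "is_subfield L" "H \<subseteq> L"
  shows "fgen H \<subseteq> L"
proof
  fix x assume "x \<in> fgen H"
  then show "x \<in> L"
    by induction
      (use assms in \<open>auto simp: a_inv_type_algebra m_inv_type_algebra subfield_closed\<close>)
qed

lemma fgen_eq: "is_subfield L \<Longrightarrow> fgen L = L"
  using fgen_incl[of L] fgen_least[of L L] by auto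

lemma fgen_mono: "A \<subseteq> B \<Longrightarrow> fgen A \<subseteq> fgen B"
  by (rule fgen_least[OF subfield_fgen]) (use fgen_incl in blast)

lemma fgen_fgen_Un: "fgen (fgen A \<union> B) = fgen (A \<union> B)"
proof
  have "fgen A \<subseteq> fgen (A \<union> B)" by (intro fgen_mono) auto
  moreover have "B \<subseteq> fgen (A \<union> B)" using fgen_incl by blast
  ultimately show "fgen (fgen A \<union> B) \<subseteq> fgen (A \<union> B)"
    by (intro fgen_least[OF subfield_fgen]) auto
  show "fgen (A \<union> B) \<subseteq> fgen (fgen A \<union> B)"
    by (intro fgen_mono) (use fgen_incl in blast)
qed

section \<open>Quadratic extensions \<open>L(b)\<close> with \<open>b\<^sup>2\<close> in
  \<open>L\<close>\<close>

definition qext :: "'a::field set \<Rightarrow> 'a \<Rightarrow> 'a set" where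
  "qext L b = {x + y * b | x y. x \<in> L \<and> y \<in> L}"

lemma qext_I: "x \<in> L \<Longrightarrow> y \<in> L \<Longrightarrow> x + y * b \<in> qext L b"
  unfolding qext_def by blast

lemma qext_trivial: "is_subfield L \<Longrightarrow> b \<in> L \<Longrightarrow> qext L b = L"
  using qext_I[of _ L 0 b] subfield_closed(1,5,7)[of L] by (fastforce simp: qext_def)

lemma qext_unique:
  assumes "is_subfield L" "b \<notin> L" "x \<in> L" "y \<in> L" "x' \<in> L" "y' \<in> L" "x + y * b = x' + y' * b"
  shows "x = x' \<and> y = y'"
proof (rule ccontr)
  assume n: "\<not> ?thesis"
  then have "y \<noteq> y'" using assms by auto
  then have "b = (x' - x) / (y - y')" using assms(7) by (simp add: field_simps)
  then show False using assms subfield_closed[OF assms(1)] by auto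
qed

lemma subfield_qext:
  assumes L: "is_subfield L" and b: "b\<^sup>2 \<in> L"
  shows "is_subfield (qext L b)"
proof (cases "b \<in> L")
  case True
  then show ?thesis using qext_trivial[OF L] L by simp
next
  case nb: False
  note c = subfield_closed[OF L]
  note I = qext_I[of _ L _ b]
  have 1: "1 \<in> qext L b" using I[of 1 0] c by simp
  have 2: "- z \<in> qext L b" if "z \<in> qext L b" for z
  proof -
    obtain x y where "z = x + y * b" "x \<in> L" "y \<in> L" using \<open>z \<in> _\<close> unfolding qext_def by blast
    then show ?thesis using I[of "-x" "-y"] c by simp
  qed
  have 3: "z + w \<in> qext L b \<and> z * w \<in> qext L b" if "z \<in> qext L b" "w \<in> qext L b" for z w
  proof -
    obtain x y where z: "z = x + y * b" "x \<in> L" "y \<in> L" using \<open>z \<in> _\<close> unfolding qext_def by blast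
    obtain x' y' where w: "w = x' + y' * b" "x' \<in> L" "y' \<in> L" using \<open>w \<in> _\<close> unfolding qext_def by blast
    have "z + w = (x + x') + (y + y') * b" by (simp add: z w algebra_simps)
    moreover have "z * w = (x * x' + y * y' * b\<^sup>2) + (x * y' + y * x') * b"
      by (simp add: z w algebra_simps power2_eq_square)
    ultimately show ?thesis using I c z w b by metis
  qed
  have 4: "inverse z \<in> qext L b" if "z \<in> qext L b" for z
  proof (cases "z = 0")
    case True
    then show ?thesis using I[of 0 0] c by simp
  next
    case False
    obtain x y where z: "z = x + y * b" "x \<in> L" "y \<in> L" using \<open>z \<in> _\<close> unfolding qext_def by blast
    have n: "x - y * b \<noteq> 0"
    proof
      assume "x - y * b = 0"
      then have "x + (- y) * b = 0 + 0 * b" by simp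
      then have "x = 0 \<and> - y = 0"
        by (rule qext_unique[OF L nb, rotated 4]) (use z c in auto)
      then show False using z False by simp
    qed
    \<comment> \<open>The norm of \<open>z\<close>. It lies in \<open>L\<close> and is nonzero
      because the conjugate \<open>x - y * b\<close> is, so the conjugate divided by it inverts
      \<open>z\<close> inside \<open>qext L b\<close>.\<close>
    define N where "N = x\<^sup>2 - y\<^sup>2 * b\<^sup>2"
    have Nz: "N = z * (x - y * b)" by (simp add: N_def z algebra_simps power2_eq_square)
    then have N0: "N \<noteq> 0" using n False by simp
    have NL: "N \<in> L" using z b c by (simp add: N_def)
    have "inverse z = x / N + (- y / N) * b"
    proof (rule inverse_unique)
      have "x / N + (- y / N) * b = (x - y * b) / N" by (simp add: diff_divide_distrib)
      then show "z * (x / N + (- y / N) * b) = 1" using N0 Nz by (metis divide_self times_divide_eq_right)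
    qed
    then show ?thesis using I[of "x / N" "- y / N"] c NL z by simp
  qed
  show ?thesis unfolding is_subfield_def using 1 2 3 4 by blast
qed

lemma fgen_insert_sqrt:
  assumes L: "is_subfield L" and b: "b\<^sup>2 \<in> L"
  shows "fgen (insert b L) = qext L b"
proof
  have "x \<in> qext L b" if "x \<in> L" for x
    using qext_I[OF that subfield_closed(1)[OF L], of b] by simp
  moreover have "b \<in> qext L b"
    using qext_I[OF subfield_closed(1,2)[OF L], of b] by simp
  ultimately show "fgen (insert b L) \<subseteq> qext L b"
    by (intro fgen_least subfield_qext assms) auto
  have "x \<in> fgen (insert b L)" if "x \<in> insert b L" for x
    using fgen_incl[of "insert b L"] that by blast
  then show "qext L b \<subseteq> fgen (insert b L)"
    unfolding qext_def
    by (auto intro!: subfield_closed(5,7)[OF subfield_fgen])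
qed

text \<open>The codomain is the whole type: an extension along a square root is built before
  anything is known about its image. That the fields of the tower are mapped onto themselves is
  \<open>gal_image\<close>.\<close>

definition fhom :: "'a::field set \<Rightarrow> ('a \<Rightarrow> 'a) \<Rightarrow> bool" where
  "fhom L \<sigma> \<longleftrightarrow> \<sigma> 1 = 1 \<and> (\<forall>x\<in>L. \<forall>y\<in>L. \<sigma> (x + y) = \<sigma> x + \<sigma> y \<and> \<sigma> (x * y) = \<sigma> x * \<sigma> y)"

context
  fixes L :: "'a::field set" and \<sigma>
  assumes L: "is_subfield L" and h: "fhom L \<sigma>"
begin

lemma fhom_simps:
  shows "\<sigma> 1 = 1" "x \<in> L \<Longrightarrow> y \<in> L \<Longrightarrow> \<sigma> (x + y) = \<sigma> x + \<sigma> y"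
    "x \<in> L \<Longrightarrow> y \<in> L \<Longrightarrow> \<sigma> (x * y) = \<sigma> x * \<sigma> y"
    "\<sigma> 0 = 0" "x \<in> L \<Longrightarrow> \<sigma> (- x) = - \<sigma> x" "x \<in> L \<Longrightarrow> y \<in> L \<Longrightarrow> \<sigma> (x - y) = \<sigma> x - \<sigma> y"
    "x \<in> L \<Longrightarrow> \<sigma> (inverse x) = inverse (\<sigma> x)" "x \<in> L \<Longrightarrow> \<sigma> (x\<^sup>2) = (\<sigma> x)\<^sup>2"
proof -
  show a: "\<sigma> (x + y) = \<sigma> x + \<sigma> y" and m: "\<sigma> (x * y) = \<sigma> x * \<sigma> y" if "x \<in> L" "y \<in> L" for x y
    using h that unfolding fhom_def by blast+
  show 1: "\<sigma> 1 = 1" using h unfolding fhom_def by blast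
  show z: "\<sigma> 0 = 0" using a[of 0 0] subfield_closed[OF L] add_left_cancel[of "\<sigma> 0" "\<sigma> 0" 0] by (metis add.right_neutral)
  show n: "\<sigma> (- x) = - \<sigma> x" if "x \<in> L" for x
    using a[of x "- x"] subfield_closed[OF L] that z by (simp add: eq_neg_iff_add_eq_0 add.commute)
  show "x \<in> L \<Longrightarrow> y \<in> L \<Longrightarrow> \<sigma> (x - y) = \<sigma> x - \<sigma> y"
    using a[of x "- y"] subfield_closed[OF L] n by simp
  show "\<sigma> (inverse x) = inverse (\<sigma> x)" if "x \<in> L"
  proof (cases "x = 0")
    case False
    then have "\<sigma> x * \<sigma> (inverse x) = 1"
      using m[of x "inverse x"] subfield_closed[OF L] that 1 by simp
    then show ?thesis by (simp add: inverse_unique)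
  qed (simp add: z)
  show "x \<in> L \<Longrightarrow> \<sigma> (x\<^sup>2) = (\<sigma> x)\<^sup>2" by (simp add: power2_eq_square m)
qed

lemma fhom_prod: "(\<And>i. i \<in> A \<Longrightarrow> f i \<in> L) \<Longrightarrow> \<sigma> (prod f A) = (\<Prod>i\<in>A. \<sigma> (f i))"
  by (induction A rule: infinite_finite_induct) (auto simp: fhom_simps subfield_prod[OF L])

lemma fhom_inj: "inj_on \<sigma> L"
proof (rule inj_onI)
  fix x y assume xy: "x \<in> L" "y \<in> L" "\<sigma> x = \<sigma> y"
  show "x = y"
  proof (rule ccontr)
    assume "x \<noteq> y"
    then have "\<sigma> (x - y) * \<sigma> (inverse (x - y)) = 1"
      using xy subfield_closed[OF L] fhom_simps(3)[of "x - y" "inverse (x - y)"] fhom_simps(1) by simp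
    then show False using xy fhom_simps(6)[of x y] by simp
  qed
qed

lemma subfield_fhom_image: "is_subfield (\<sigma> ` L)"
proof -
  note c = subfield_closed[OF L]
  have "1 \<in> \<sigma> ` L" using c(2) fhom_simps(1) by (metis image_eqI)
  moreover have "- \<sigma> x \<in> \<sigma> ` L \<and> inverse (\<sigma> x) \<in> \<sigma> ` L" if "x \<in> L" for x
    using c(3,4) fhom_simps(5,7) that by (metis image_eqI)
  moreover have "\<sigma> x + \<sigma> y \<in> \<sigma> ` L \<and> \<sigma> x * \<sigma> y \<in> \<sigma> ` L" if "x \<in> L" "y \<in> L" for x y
    using c(5,7)[OF that] fhom_simps(2,3)[OF that] by (metis image_eqI)
  ultimately show ?thesis unfolding is_subfield_def by blast
qed

lemma subfield_fhom_preimage: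
  assumes M: "is_subfield M"
  shows "is_subfield {x \<in> L. \<sigma> x \<in> M}"
  unfolding is_subfield_def
  by (intro conjI ballI)
    (simp_all add: subfield_closed(2-5,7)[OF L] subfield_closed(2-5,7)[OF M] fhom_simps)

text \<open>Coordinates with respect to 1 and \<open>b\<close> are unique, so
  \<open>x + y * b\<close> can be sent to \<open>\<sigma> x + \<sigma> y * b'\<close>.
  Multiplicativity uses only the transported equation for \<open>b'\<close>, so either square root
  is admissible.\<close>

lemma fhom_extend_sqrt:
  assumes b: "b\<^sup>2 \<in> L" "b \<notin> L" and b': "b'\<^sup>2 = \<sigma> (b\<^sup>2)"
  obtains \<tau> where "fhom (qext L b) \<tau>" "\<And>x. x \<in> L \<Longrightarrow> \<tau> x = \<sigma> x" "\<tau> b = b'"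
proof -
  define \<tau> where "\<tau> z = (THE w. \<exists>x\<in>L. \<exists>y\<in>L. z = x + y * b \<and> w = \<sigma> x + \<sigma> y * b')" for z
  note c = subfield_closed[OF L]
  have t: "\<tau> (x + y * b) = \<sigma> x + \<sigma> y * b'" if "x \<in> L" "y \<in> L" for x y
    unfolding \<tau>_def
  proof (rule the_equality)
    fix w assume "\<exists>x'\<in>L. \<exists>y'\<in>L. x + y * b = x' + y' * b \<and> w = \<sigma> x' + \<sigma> y' * b'"
    then show "w = \<sigma> x + \<sigma> y * b'" using qext_unique[OF L b(2)] that by metis
  qed (use that in blast)
  have tL: "\<tau> x = \<sigma> x" if "x \<in> L" for x using t[of x 0] that c fhom_simps by simp
  have "\<tau> (z + w) = \<tau> z + \<tau> w \<and> \<tau> (z * w) = \<tau> z * \<tau> w"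
    if "z \<in> qext L b" "w \<in> qext L b" for z w
  proof -
    obtain x y where z: "z = x + y * b" "x \<in> L" "y \<in> L" using \<open>z \<in> _\<close> unfolding qext_def by blast
    obtain x' y' where w: "w = x' + y' * b" "x' \<in> L" "y' \<in> L" using \<open>w \<in> _\<close> unfolding qext_def by blast
    have s: "z + w = (x + x') + (y + y') * b" by (simp add: z w algebra_simps)
    have p: "z * w = (x * x' + y * y' * b\<^sup>2) + (x * y' + y * x') * b"
      by (simp add: z w algebra_simps power2_eq_square)
    have tz: "\<tau> z = \<sigma> x + \<sigma> y * b'" and tw: "\<tau> w = \<sigma> x' + \<sigma> y' * b'"
      using t z w by blast+
    have "\<tau> (z + w) = \<sigma> (x + x') + \<sigma> (y + y') * b'"
      unfolding s by (intro t c(5) z w)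
    then have "\<tau> (z + w) = \<tau> z + \<tau> w"
      unfolding tz tw using z(2,3) w(2,3) by (simp add: fhom_simps(2) algebra_simps)
    moreover have "\<tau> (z * w) = \<sigma> (x * x' + y * y' * b\<^sup>2) + \<sigma> (x * y' + y * x') * b'"
      unfolding p by (intro t c(5,7) z w b)
    then have "\<tau> (z * w) = (\<sigma> x * \<sigma> x' + \<sigma> y * \<sigma> y' * b'\<^sup>2) + (\<sigma> x * \<sigma> y' + \<sigma> y * \<sigma> x') * b'"
      using z(2,3) w(2,3) b c(7) by (simp add: fhom_simps(2,3) b')
    then have "\<tau> (z * w) = \<tau> z * \<tau> w"
      unfolding tz tw by (simp add: algebra_simps power2_eq_square)
    ultimately show ?thesis by simp
  qed
  then have "fhom (qext L b) \<tau>" unfolding fhom_def using tL[OF c(2)] fhom_simps(1) by auto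
  moreover have "\<tau> b = b'" using t[of 0 1] c fhom_simps by simp
  ultimately show ?thesis using that tL by blast
qed

end

text \<open>If \<open>(p + q * b)\<^sup>2\<close> lies in \<open>L\<close> while \<open>b\<close>
  does not, then \<open>p * q = 0\<close>, so removing one adjoined root costs at most one factor
  \<open>b\<^sup>2\<close>. The induction keeps \<open>L\<close> arbitrary in order to pass to
  \<open>qext L b\<close> and come back down. This is Kummer theory in exponent 2.\<close>

lemma kummer_square:
  fixes \<beta> :: "'i \<Rightarrow> 'a::field_char_0"
  assumes "finite A" "is_subfield L" "\<And>i. i \<in> A \<Longrightarrow> (\<beta> i)\<^sup>2 \<in> L" "u \<in> L"
    "x \<in> fgen (L \<union> \<beta> ` A)" "x\<^sup>2 = u"
  shows "\<exists>J\<subseteq>A. \<exists>y\<in>L. y\<^sup>2 = u * (\<Prod>i\<in>J. (\<beta> i)\<^sup>2)"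
  using assms
proof (induction A arbitrary: L rule: finite_induct)
  case empty
  then show ?case by (auto simp: fgen_eq)
next
  case (insert i A)
  define b where "b = \<beta> i"
  note L = insert.prems(1)
  have b: "b\<^sup>2 \<in> L" using insert.prems by (simp add: b_def)
  let ?L' = "qext L b"
  have L': "is_subfield ?L'" using subfield_qext L b by blast
  have LL': "L \<subseteq> ?L'" using qext_I[OF _ subfield_closed(1)[OF L]] by fastforce
  have "fgen (?L' \<union> \<beta> ` A) = fgen (L \<union> \<beta> ` insert i A)"
    unfolding fgen_insert_sqrt[OF L b, symmetric] fgen_fgen_Un
    by (rule arg_cong[of _ _ fgen]) (auto simp: b_def)
  then obtain J y where J: "J \<subseteq> A" "y \<in> ?L'" "y\<^sup>2 = u * (\<Prod>i\<in>J. (\<beta> i)\<^sup>2)"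
    using insert.IH[OF L'] insert.prems LL' by blast
  have fJ: "finite J" "i \<notin> J" using J insert.hyps finite_subset by auto
  let ?P = "u * (\<Prod>i\<in>J. (\<beta> i)\<^sup>2)"
  have P: "?P \<in> L" using J insert.prems by (intro subfield_closed(7)[OF L] subfield_prod[OF L]) auto
  obtain p q where pq: "p \<in> L" "q \<in> L" "y = p + q * b" using J(2) unfolding qext_def by blast
  show ?case
  proof (cases "b \<in> L")
    case True
    then have "y \<in> L" using qext_trivial[OF L] J(2) by simp
    then show ?thesis using J by blast
  next
    case False
    have "(p\<^sup>2 + q\<^sup>2 * b\<^sup>2) + (2 * p * q) * b = ?P + 0 * b"
      using J(3) unfolding pq(3) by (simp add: algebra_simps power2_eq_square)
    then have "p\<^sup>2 + q\<^sup>2 * b\<^sup>2 = ?P \<and> 2 * p * q = 0"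
    proof (rule qext_unique[OF L False, rotated 4])
      have "2 * p * q = p * q + p * q" by simp
      then show "2 * p * q \<in> L" using pq subfield_closed[OF L] by metis
    qed (use pq b P subfield_closed[OF L] in auto)
    then consider "q = 0" | "p = 0" "q\<^sup>2 * b\<^sup>2 = ?P" by auto
    then show ?thesis
    proof cases
      case 1
      then show ?thesis using J pq by (metis add.right_neutral mult_zero_left subset_insertI2)
    next
      case 2
      \<comment> \<open>\<open>q * b\<close> squares to \<open>?P\<close>, so multiplying once more
        by \<open>b\<close> gives an element of \<open>L\<close> that squares to
        \<open>?P * b\<^sup>2\<close>.\<close>
      have "(q * b\<^sup>2)\<^sup>2 = u * (\<Prod>i\<in>insert i J. (\<beta> i)\<^sup>2)"
        using fJ 2 by (simp add: b_def power_mult_distrib power2_eq_square mult_ac)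
      moreover have "q * b\<^sup>2 \<in> L" by (intro subfield_closed(7)[OF L] pq b)
      ultimately show ?thesis using J(1) by (intro exI[of _ "insert i J"]) auto
    qed
  qed
qed

text \<open>Independence modulo squares survives the adjunction of one root, so the roots can be
  adjoined one at a time, each with a free choice of sign for its image.\<close>

lemma fhom_extend_sqrts:
  fixes \<beta> b :: "'i \<Rightarrow> 'a::field_char_0"
  assumes "finite A" "is_subfield L" "\<And>i. i \<in> A \<Longrightarrow> (\<beta> i)\<^sup>2 \<in> L"
    "\<And>J x. J \<subseteq> A \<Longrightarrow> J \<noteq> {} \<Longrightarrow> x \<in> L \<Longrightarrow> x\<^sup>2 \<noteq> (\<Prod>i\<in>J. (\<beta> i)\<^sup>2)"
    "fhom L \<sigma>" "\<And>i. i \<in> A \<Longrightarrow> (b i)\<^sup>2 = \<sigma> ((\<beta> i)\<^sup>2)"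
  shows "\<exists>\<tau>. fhom (fgen (L \<union> \<beta> ` A)) \<tau> \<and> (\<forall>x\<in>L. \<tau> x = \<sigma> x) \<and> (\<forall>i\<in>A. \<tau> (\<beta> i) = b i)"
  using assms
proof (induction A arbitrary: L \<sigma> rule: finite_induct)
  case empty
  then show ?case by (auto simp: fgen_eq)
next
  case (insert i A)
  note L = insert.prems(1)
  have b: "(\<beta> i)\<^sup>2 \<in> L" using insert.prems by simp
  have nb: "\<beta> i \<notin> L" using insert.prems(3)[of "{i}" "\<beta> i"] by auto
  let ?L' = "qext L (\<beta> i)"
  have L': "is_subfield ?L'" using subfield_qext L b by blast
  have LL': "L \<subseteq> ?L'" using qext_I[OF _ subfield_closed(1)[OF L]] by fastforce
  have bL': "\<beta> i \<in> ?L'" using qext_I[OF subfield_closed(1,2)[OF L], of "\<beta> i"] by simp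
  have e: "fgen (?L' \<union> \<beta> ` A) = fgen (L \<union> \<beta> ` insert i A)"
    unfolding fgen_insert_sqrt[OF L b, symmetric] fgen_fgen_Un
    by (rule arg_cong[of _ _ fgen]) auto
  obtain \<rho> where r: "fhom ?L' \<rho>" "\<And>x. x \<in> L \<Longrightarrow> \<rho> x = \<sigma> x" "\<rho> (\<beta> i) = b i"
    using fhom_extend_sqrt[OF L insert.prems(4) b nb] insert.prems(5) by blast
  have "\<exists>\<tau>. fhom (fgen (?L' \<union> \<beta> ` A)) \<tau> \<and> (\<forall>x\<in>?L'. \<tau> x = \<rho> x) \<and> (\<forall>i\<in>A. \<tau> (\<beta> i) = b i)"
  proof (rule insert.IH[OF L'])
    fix J x assume J: "J \<subseteq> A" "J \<noteq> {}" and x: "x \<in> ?L'"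
    show "x\<^sup>2 \<noteq> (\<Prod>i\<in>J. (\<beta> i)\<^sup>2)"
    proof
      assume sq: "x\<^sup>2 = (\<Prod>i\<in>J. (\<beta> i)\<^sup>2)"
      \<comment> \<open>A square root in \<open>?L'\<close> of the product over \<open>J\<close>
        descends to a square root in \<open>L\<close> of the product over \<open>J\<close> or over
        \<open>J\<close> with \<open>i\<close> added; both index sets are nonempty.\<close>
      have "\<exists>I\<subseteq>{i}. \<exists>y\<in>L. y\<^sup>2 = (\<Prod>i\<in>J. (\<beta> i)\<^sup>2) * (\<Prod>i\<in>I. (\<beta> i)\<^sup>2)"
        by (rule kummer_square[of _ _ _ _ x])
          (use L b J insert.prems x sq in \<open>auto simp: fgen_insert_sqrt[OF L b] intro!: subfield_prod\<close>)
      then obtain I y where I: "I \<subseteq> {i}" "y \<in> L"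
        "y\<^sup>2 = (\<Prod>i\<in>J. (\<beta> i)\<^sup>2) * (\<Prod>i\<in>I. (\<beta> i)\<^sup>2)" by blast
      moreover have "J \<inter> I = {}" "finite J" "finite I"
        using I J insert.hyps finite_subset[of J A] finite_subset[of I] by auto
      ultimately have "y\<^sup>2 = (\<Prod>i\<in>J \<union> I. (\<beta> i)\<^sup>2)" by (simp add: prod.union_disjoint)
      then show False using insert.prems(3)[of "J \<union> I" y] I J by blast
    qed
  qed (use insert.prems LL' r in auto)
  then obtain \<tau> where t: "fhom (fgen (?L' \<union> \<beta> ` A)) \<tau>" "\<forall>x\<in>?L'. \<tau> x = \<rho> x" "\<forall>i\<in>A. \<tau> (\<beta> i) = b i" by blast
  then have "\<forall>x\<in>L. \<tau> x = \<sigma> x" "\<tau> (\<beta> i) = b i" using r LL' bL' by auto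
  then show ?case using t unfolding e by blast
qed

section \<open>The tower of splitting fields\<close>

text \<open>
  For \<open>\<theta>\<^sub>i = x\<^sup>2 + c (i - 1)\<close>, the function \<open>gam c n\<close> is \<open>\<gamma>\<^sub>n\<close> and \<open>lev c n\<close> is its set of zeros,
  the \<open>n\<close>-th level of the preimage tree.
\<close>

fun lev :: "(nat \<Rightarrow> 'a::field) \<Rightarrow> nat \<Rightarrow> 'a set" where
  "lev c 0 = {0}"
| "lev c (Suc n) = {\<beta>. \<beta>\<^sup>2 + c n \<in> lev c n}"

fun gam :: "(nat \<Rightarrow> 'a::comm_ring_1) \<Rightarrow> nat \<Rightarrow> 'a \<Rightarrow> 'a" where
  "gam c 0 x = x"
| "gam c (Suc n) x = gam c n (x\<^sup>2 + c n)"

lemma lev_eq_gam: "lev c n = {x. gam c n x = 0}"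
  by (induction n) auto

definition csr :: "'a::alg_closed_field \<Rightarrow> 'a" where
  "csr a = (SOME b. b\<^sup>2 = a)"

lemma csr_square [simp]: "(csr a)\<^sup>2 = a"
  unfolding csr_def by (rule someI_ex) (use nth_root_exists[of 2 a] in auto)

text \<open>\<open>zero_notin_lev\<close> says that
  \<open>\<gamma>\<^sub>n\<^sub>+\<^sub>1(0)\<close> is nonzero; it makes the two square roots below
  every vertex distinct.\<close>

locale quadratic_tower =
  fixes K :: "'a::{alg_closed_field, field_char_0} set" and c :: "nat \<Rightarrow> 'a"
  assumes subfield_K: "is_subfield K" and c_K: "c n \<in> K" and zero_notin_lev: "0 \<notin> lev c (Suc n)"
begin

definition rt :: "nat \<Rightarrow> 'a \<Rightarrow> 'a" where
  "rt n \<alpha> = csr (\<alpha> - c n)"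

definition Kl :: "nat \<Rightarrow> 'a set" where
  "Kl n = fgen (K \<union> lev c n)"

text \<open>Up to sign this is \<open>\<gamma>\<^sub>n\<^sub>+\<^sub>1(0)\<close>; for \<open>n = 0\<close> it is \<open>-\<gamma>\<^sub>1(0)\<close>.\<close>

definition crit_prod :: "nat \<Rightarrow> 'a" where
  "crit_prod n = (\<Prod>\<alpha>\<in>lev c n. \<alpha> - c n)"

text \<open>Linear independence over the field with two elements of the classes of
  \<open>\<alpha> - c n\<close> modulo squares of \<open>Kl n\<close>; equivalently,
  \<open>Kl (Suc n)\<close> has the largest possible degree over \<open>Kl n\<close>.\<close>

definition indep :: "nat \<Rightarrow> bool" where
  "indep n \<longleftrightarrow> (\<forall>J\<subseteq>lev c n. J \<noteq> {} \<longrightarrow> (\<forall>x\<in>Kl n. x\<^sup>2 \<noteq> (\<Prod>\<alpha>\<in>J. \<alpha> - c n)))"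

text \<open>Values outside \<open>Kl n\<close> are unconstrained; \<open>Gal_iff\<close> adds
  extensionality to recover the Galois group.\<close>

definition gal :: "nat \<Rightarrow> ('a \<Rightarrow> 'a) \<Rightarrow> bool" where
  "gal n \<sigma> \<longleftrightarrow> fhom (Kl n) \<sigma> \<and> (\<forall>x\<in>K. \<sigma> x = x)"

lemma rt_square [simp]: "(rt n \<alpha>)\<^sup>2 = \<alpha> - c n"
  by (simp add: rt_def)

lemma lev_Suc_cases: "\<beta> \<in> lev c (Suc n) \<Longrightarrow> \<beta> = rt n (\<beta>\<^sup>2 + c n) \<or> \<beta> = - rt n (\<beta>\<^sup>2 + c n)"
  by (simp add: power2_eq_iff[symmetric])

lemma lev_Suc: "lev c (Suc n) = rt n ` lev c n \<union> (\<lambda>\<alpha>. - rt n \<alpha>) ` lev c n"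
  using lev_Suc_cases by (auto simp: image_iff)

lemma rt_lev: "\<alpha> \<in> lev c n \<Longrightarrow> rt n \<alpha> \<in> lev c (Suc n)" "\<alpha> \<in> lev c n \<Longrightarrow> - rt n \<alpha> \<in> lev c (Suc n)"
  by simp_all

lemma rt_nonzero: "\<alpha> \<in> lev c n \<Longrightarrow> rt n \<alpha> \<noteq> 0"
  using rt_lev(1) zero_notin_lev by metis

lemma diff_nonzero: "\<alpha> \<in> lev c n \<Longrightarrow> \<alpha> - c n \<noteq> 0"
  using rt_nonzero[of \<alpha> n] by (metis rt_square power_eq_0_iff)

lemma rt_inj: "inj (rt n)"
  by (rule injI) (metis rt_square diff_add_cancel)

lemma finite_lev [simp]: "finite (lev c n)"
proof (induction n)
  case (Suc n)
  then show ?case unfolding lev_Suc by blast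
qed simp

lemma lev_nonempty: "lev c n \<noteq> {}"
  by (induction n) (simp, use rt_lev in \<open>blast\<close>)

text \<open>The children of \<alpha> contribute \<open>(x - rt n \<alpha>) * (x + rt n \<alpha>) =
  x\<^sup>2 + c n - \<alpha>\<close>, and no child is counted twice because 0 lies in no level but
  the first. So the zeros of \<open>\<gamma>\<^sub>n\<close> are simple.\<close>

lemma gam_eq_prod: "gam c n x = (\<Prod>\<alpha>\<in>lev c n. x - \<alpha>)"
proof (induction n arbitrary: x)
  case (Suc n)
  have d: "rt n ` lev c n \<inter> (\<lambda>\<alpha>. - rt n \<alpha>) ` lev c n = {}"
  proof -
    have False if "\<alpha> \<in> lev c n" "rt n \<alpha> = - rt n \<beta>" for \<alpha> \<beta>
    proof -
      have "(rt n \<alpha>)\<^sup>2 = (rt n \<beta>)\<^sup>2" using that by simp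
      then have "\<alpha> = \<beta>" unfolding rt_square by simp
      then have "rt n \<alpha> = 0" using that(2) by (simp add: eq_neg_iff_add_eq_0)
      then show False using rt_nonzero[OF that(1)] by blast
    qed
    then show ?thesis by blast
  qed
  have "gam c (Suc n) x = (\<Prod>\<alpha>\<in>lev c n. (x - rt n \<alpha>) * (x - - rt n \<alpha>))"
    unfolding gam.simps Suc by (rule prod.cong) (simp_all add: algebra_simps flip: power2_eq_square)
  also have "\<dots> = (\<Prod>\<beta>\<in>rt n ` lev c n. x - \<beta>) * (\<Prod>\<beta>\<in>(\<lambda>\<alpha>. - rt n \<alpha>) ` lev c n. x - \<beta>)"
    unfolding prod.distrib using rt_inj
    by (subst (1 2) prod.reindex) (auto simp: inj_on_def inj_def)
  also have "\<dots> = (\<Prod>\<beta>\<in>lev c (Suc n). x - \<beta>)"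
    unfolding lev_Suc using d by (intro prod.union_disjoint[symmetric]) auto
  finally show ?case .
qed simp

lemma gam_K: "x \<in> K \<Longrightarrow> gam c n x \<in> K"
  by (induction n arbitrary: x) (use subfield_closed[OF subfield_K] c_K in auto)

lemma crit_prod_eq: "crit_prod n = (- 1) ^ card (lev c n) * gam c (Suc n) 0"
proof -
  have "crit_prod n = (\<Prod>\<alpha>\<in>lev c n. - 1 * (c n - \<alpha>))" by (simp add: crit_prod_def)
  also have "\<dots> = (- 1) ^ card (lev c n) * gam c n (c n)"
    unfolding prod.distrib gam_eq_prod by simp
  finally show ?thesis by simp
qed

lemma crit_prod_K: "crit_prod n \<in> K"
  unfolding crit_prod_eq using subfield_closed[OF subfield_K] gam_K by metis

lemma subfield_Kl: "is_subfield (Kl n)"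
  unfolding Kl_def by (rule subfield_fgen)

lemmas Kl_closed = subfield_closed[OF subfield_Kl]

lemma K_Kl: "K \<subseteq> Kl n" and lev_Kl: "lev c n \<subseteq> Kl n"
  using fgen_incl unfolding Kl_def by blast+

lemma c_Kl: "c k \<in> Kl n"
  using c_K K_Kl by blast

lemma Kl_0: "Kl 0 = K"
proof -
  have "K \<union> {0} = K" using subfield_closed(1)[OF subfield_K] by blast
  then show ?thesis by (simp add: Kl_def fgen_eq[OF subfield_K])
qed

lemma Kl_Suc_le: "Kl n \<subseteq> Kl (Suc n)"
  unfolding Kl_def[of n]
proof (rule fgen_least[OF subfield_Kl])
  have "\<alpha> \<in> Kl (Suc n)" if "\<alpha> \<in> lev c n" for \<alpha>
  proof -
    have "rt n \<alpha> \<in> Kl (Suc n)" using rt_lev[OF that] lev_Kl by blast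
    then have "(rt n \<alpha>)\<^sup>2 + c n \<in> Kl (Suc n)" by (intro Kl_closed c_Kl)
    then show ?thesis by simp
  qed
  then show "K \<union> lev c n \<subseteq> Kl (Suc n)" using K_Kl by blast
qed

lemma Kl_mono: "m \<le> n \<Longrightarrow> Kl m \<subseteq> Kl n"
  using lift_Suc_mono_le[of Kl] Kl_Suc_le by blast

lemma lev_Kl_le: "m \<le> n \<Longrightarrow> lev c m \<subseteq> Kl n"
  using lev_Kl[of m] Kl_mono[of m n] by blast

lemma Kl_Suc: "Kl (Suc n) = fgen (Kl n \<union> rt n ` lev c n)"
proof
  have "K \<subseteq> fgen (Kl n \<union> rt n ` lev c n)" using K_Kl[of n] fgen_incl[of "Kl n \<union> rt n ` lev c n"] by blast
  moreover have r: "rt n \<alpha> \<in> fgen (Kl n \<union> rt n ` lev c n)" if "\<alpha> \<in> lev c n" for \<alpha>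
    using fgen_incl[of "Kl n \<union> rt n ` lev c n"] that by blast
  moreover have "- rt n \<alpha> \<in> fgen (Kl n \<union> rt n ` lev c n)" if "\<alpha> \<in> lev c n" for \<alpha>
    using subfield_closed(3)[OF subfield_fgen r[OF that]] .
  ultimately show "Kl (Suc n) \<subseteq> fgen (Kl n \<union> rt n ` lev c n)"
    unfolding Kl_def[of "Suc n"] lev_Suc by (intro fgen_least[OF subfield_fgen]) auto
  have "rt n ` lev c n \<subseteq> Kl (Suc n)" using rt_lev lev_Kl by blast
  then show "fgen (Kl n \<union> rt n ` lev c n) \<subseteq> Kl (Suc n)"
    by (intro fgen_least[OF subfield_Kl]) (use Kl_Suc_le in auto)
qed

section \<open>Galois action on the levels of the tree\<close>

lemma gal_simps:
  assumes "gal n \<sigma>"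
  shows "x \<in> Kl n \<Longrightarrow> y \<in> Kl n \<Longrightarrow> \<sigma> (x + y) = \<sigma> x + \<sigma> y"
    "x \<in> Kl n \<Longrightarrow> y \<in> Kl n \<Longrightarrow> \<sigma> (x * y) = \<sigma> x * \<sigma> y"
    "x \<in> Kl n \<Longrightarrow> \<sigma> (- x) = - \<sigma> x" "x \<in> Kl n \<Longrightarrow> y \<in> Kl n \<Longrightarrow> \<sigma> (x - y) = \<sigma> x - \<sigma> y"
    "x \<in> Kl n \<Longrightarrow> \<sigma> (x\<^sup>2) = (\<sigma> x)\<^sup>2" "\<sigma> 1 = 1" "\<sigma> 0 = 0"
    "x \<in> K \<Longrightarrow> \<sigma> x = x" "\<sigma> (c k) = c k"
  using assms fhom_simps[OF subfield_Kl, of n \<sigma>] c_K unfolding gal_def by blast+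

lemma gal_inj: "gal n \<sigma> \<Longrightarrow> inj_on \<sigma> (Kl n)"
  using fhom_inj[OF subfield_Kl] unfolding gal_def by blast

lemma gal_lev_mem:
  assumes "gal n \<sigma>"
  shows "k \<le> n \<Longrightarrow> \<alpha> \<in> lev c k \<Longrightarrow> \<sigma> \<alpha> \<in> lev c k"
proof (induction k arbitrary: \<alpha>)
  case (Suc k)
  then have a: "\<alpha> \<in> Kl n" using lev_Kl_le[of "Suc k" n] by blast
  then have "\<sigma> (\<alpha>\<^sup>2 + c k) = (\<sigma> \<alpha>)\<^sup>2 + c k"
    using gal_simps(1)[OF assms, of "\<alpha>\<^sup>2" "c k"] gal_simps(5)[OF assms a] gal_simps(9)[OF assms]
      Kl_closed(9)[OF a, of 2] c_Kl by simp
  moreover have "\<sigma> (\<alpha>\<^sup>2 + c k) \<in> lev c k" using Suc by auto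
  ultimately show ?case by simp
qed (simp add: gal_simps[OF assms])

lemma gal_lev:
  assumes "gal n \<sigma>" "k \<le> n"
  shows "\<sigma> ` lev c k = lev c k"
  using gal_lev_mem[OF assms] inj_on_subset[OF gal_inj[OF assms(1)] lev_Kl_le[OF assms(2)]]
  by (intro endo_inj_surj) auto

text \<open>\<open>\<sigma>\<close> fixes \<open>K\<close> and permutes the other generators
  \<open>lev c n\<close>. Its image and the preimage of \<open>Kl n\<close> are subfields containing
  all generators, which gives the two inclusions.\<close>

lemma gal_image:
  assumes "gal n \<sigma>"
  shows "\<sigma> ` Kl n = Kl n"
proof
  have s: "is_subfield (\<sigma> ` Kl n)"
    using assms subfield_fhom_image[OF subfield_Kl] unfolding gal_def by blast
  have "K \<subseteq> \<sigma> ` Kl n" using gal_simps(8)[OF assms] K_Kl by (metis image_eqI subset_eq)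
  moreover have "lev c n \<subseteq> \<sigma> ` Kl n" using gal_lev[OF assms order_refl] lev_Kl by blast
  ultimately show "Kl n \<subseteq> \<sigma> ` Kl n"
    using fgen_least[OF s, of "K \<union> lev c n"] unfolding Kl_def by blast
  have "is_subfield {x \<in> Kl n. \<sigma> x \<in> Kl n}"
    using assms subfield_fhom_preimage[OF subfield_Kl _ subfield_Kl] unfolding gal_def by blast
  moreover have "K \<union> lev c n \<subseteq> {x \<in> Kl n. \<sigma> x \<in> Kl n}"
  proof
    fix x assume x: "x \<in> K \<union> lev c n"
    then have "\<sigma> x \<in> K \<union> lev c n" using gal_simps(8)[OF assms] gal_lev_mem[OF assms order_refl] by auto
    then show "x \<in> {x \<in> Kl n. \<sigma> x \<in> Kl n}" using x K_Kl[of n] lev_Kl[of n] by blast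
  qed
  ultimately have "fgen (K \<union> lev c n) \<subseteq> {x \<in> Kl n. \<sigma> x \<in> Kl n}" by (rule fgen_least)
  then show "\<sigma> ` Kl n \<subseteq> Kl n" unfolding Kl_def by blast
qed

lemma gal_mem: "gal n \<sigma> \<Longrightarrow> x \<in> Kl n \<Longrightarrow> \<sigma> x \<in> Kl n"
  using gal_image by blast

lemma gal_id: "gal n id"
  by (simp add: gal_def fhom_def)

lemma gal_comp:
  assumes "gal n \<sigma>" "gal n \<tau>"
  shows "gal n (\<sigma> \<circ> \<tau>)"
  unfolding gal_def fhom_def
  using gal_simps[OF assms(1)] gal_simps[OF assms(2)] gal_mem[OF assms(2)] by simp

lemma gal_inverse:
  assumes "gal n \<sigma>"
  obtains \<tau> where "gal n \<tau>" "\<And>x. x \<in> Kl n \<Longrightarrow> \<tau> (\<sigma> x) = x" "\<And>x. x \<in> Kl n \<Longrightarrow> \<sigma> (\<tau> x) = x"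
proof -
  let ?t = "inv_into (Kl n) \<sigma>"
  have l: "?t (\<sigma> x) = x" if "x \<in> Kl n" for x using inv_into_f_f[OF gal_inj[OF assms] that] .
  have r: "\<sigma> (?t x) = x" "?t x \<in> Kl n" if "x \<in> Kl n" for x
    using f_inv_into_f[of x \<sigma> "Kl n"] inv_into_into[of x \<sigma> "Kl n"] gal_image[OF assms] that by auto
  have "?t 1 = 1" using l[of 1] Kl_closed gal_simps(6)[OF assms] by simp
  moreover have "?t (x + y) = ?t x + ?t y" "?t (x * y) = ?t x * ?t y" if "x \<in> Kl n" "y \<in> Kl n" for x y
    using l[of "?t x + ?t y"] l[of "?t x * ?t y"] r that Kl_closed gal_simps[OF assms] by simp_all
  moreover have "?t x = x" if "x \<in> K" for x
    using l[of x] gal_simps(8)[OF assms that] K_Kl that by auto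
  ultimately have "gal n ?t" by (simp add: gal_def fhom_def)
  then show ?thesis using that l r by blast
qed

lemma gal_extend:
  assumes "indep n" "gal n \<sigma>" "\<And>\<alpha>. \<alpha> \<in> lev c n \<Longrightarrow> (b \<alpha>)\<^sup>2 + c n = \<sigma> \<alpha>"
  obtains \<tau> where "gal (Suc n) \<tau>" "\<And>x. x \<in> Kl n \<Longrightarrow> \<tau> x = \<sigma> x" "\<And>\<alpha>. \<alpha> \<in> lev c n \<Longrightarrow> \<tau> (rt n \<alpha>) = b \<alpha>"
proof -
  have d: "\<alpha> - c n \<in> Kl n" if "\<alpha> \<in> lev c n" for \<alpha>
    using that lev_Kl c_Kl by (intro Kl_closed(6)) auto
  have "\<exists>\<tau>. fhom (fgen (Kl n \<union> rt n ` lev c n)) \<tau> \<and> (\<forall>x\<in>Kl n. \<tau> x = \<sigma> x) \<and> (\<forall>i\<in>lev c n. \<tau> (rt n i) = b i)"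
  proof (rule fhom_extend_sqrts)
    show "(b \<alpha>)\<^sup>2 = \<sigma> ((rt n \<alpha>)\<^sup>2)" if "\<alpha> \<in> lev c n" for \<alpha>
    proof -
      have "\<sigma> (\<alpha> - c n) = \<sigma> \<alpha> - c n"
        using gal_simps(4,9)[OF assms(2)] that lev_Kl c_Kl by (metis subsetD)
      then show ?thesis using assms(3)[OF that] by (simp add: algebra_simps flip: assms(3)[OF that])
    qed
  qed (use assms(1,2) subfield_Kl d in \<open>auto simp: indep_def gal_def\<close>)
  then obtain \<tau> where t: "fhom (Kl (Suc n)) \<tau>" "\<forall>x\<in>Kl n. \<tau> x = \<sigma> x" "\<forall>i\<in>lev c n. \<tau> (rt n i) = b i"
    unfolding Kl_Suc[symmetric] by blast
  moreover have "\<forall>x\<in>K. \<tau> x = x" using t(2) K_Kl gal_simps(8)[OF assms(2)] by (metis subsetD)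
  ultimately show ?thesis using that unfolding gal_def by blast
qed

lemma gal_extend_many:
  assumes "\<And>i. i < n \<Longrightarrow> indep i" "gal k \<sigma>" "k \<le> n"
  shows "\<exists>\<tau>. gal n \<tau> \<and> (\<forall>x\<in>Kl k. \<tau> x = \<sigma> x)"
  using assms(3,1)
proof (induction n rule: dec_induct)
  case base
  then show ?case using assms by blast
next
  case (step n)
  then obtain \<tau> where t: "gal n \<tau>" "\<forall>x\<in>Kl k. \<tau> x = \<sigma> x" by auto
  obtain \<rho> where "gal (Suc n) \<rho>" "\<And>x. x \<in> Kl n \<Longrightarrow> \<rho> x = \<tau> x"
    by (rule gal_extend[of n \<tau> "\<lambda>\<alpha>. csr (\<tau> \<alpha> - c n)"]) (use step.prems t in auto)
  then show ?case using t Kl_mono[OF step.hyps(1)] by (metis subsetD)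
qed

lemma gal_transitive:
  assumes "\<And>i. i < n \<Longrightarrow> indep i" "\<alpha> \<in> lev c n" "\<beta> \<in> lev c n"
  shows "\<exists>\<sigma>. gal n \<sigma> \<and> \<sigma> \<alpha> = \<beta>"
  using assms
proof (induction n arbitrary: \<alpha> \<beta>)
  case 0
  then show ?case using gal_id[of 0] by (intro exI[of _ id] conjI) (assumption, simp)
next
  case (Suc n)
  let ?a = "\<alpha>\<^sup>2 + c n" and ?b = "\<beta>\<^sup>2 + c n"
  have ab: "?a \<in> lev c n" "?b \<in> lev c n" using Suc.prems by auto
  then obtain \<sigma> where s: "gal n \<sigma>" "\<sigma> ?a = ?b" using Suc.IH[of ?a ?b] Suc.prems(1) by auto
  \<comment> \<open>Only the root below \<open>?a\<close> matters. If \<alpha> is the other root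
    \<open>- rt n ?a\<close>, then \<open>rt n ?a\<close> has to go to
    \<open>- \<beta>\<close>.\<close>
  let ?f = "\<lambda>x. if x = ?a then (if \<alpha> = rt n ?a then \<beta> else - \<beta>) else csr (\<sigma> x - c n)"
  obtain \<tau> where t: "gal (Suc n) \<tau>" "\<And>x. x \<in> lev c n \<Longrightarrow> \<tau> (rt n x) = ?f x"
    by (rule gal_extend[of n \<sigma> ?f]) (use s Suc.prems(1) in auto)
  have r: "rt n ?a \<in> Kl (Suc n)" using rt_lev(1)[OF ab(1)] lev_Kl by blast
  have "\<tau> \<alpha> = \<beta>"
    using lev_Suc_cases[OF Suc.prems(2)] t(2)[OF ab(1)] gal_simps(3)[OF t(1) r] 
    by (metis minus_minus)
  then show ?case using t by blast
qed

text \<open>On level \<open>k + 1\<close> this is the transposition of the two children of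
  \<open>v\<close>. The lift to level \<open>n\<close> is arbitrary and need not be an involution
  there.\<close>

lemma gal_swap:
  assumes "\<And>i. i < n \<Longrightarrow> indep i" "k < n" "v \<in> lev c k"
  shows "\<exists>\<sigma>. gal n \<sigma> \<and> (\<forall>x\<in>Kl k. \<sigma> x = x) \<and> (\<forall>w\<in>lev c k. \<sigma> (rt k w) = (if w = v then - rt k w else rt k w))"
proof -
  obtain \<tau> where t: "gal (Suc k) \<tau>" "\<And>x. x \<in> Kl k \<Longrightarrow> \<tau> x = id x" 
    "\<And>w. w \<in> lev c k \<Longrightarrow> \<tau> (rt k w) = (if w = v then - rt k w else rt k w)"
    by (rule gal_extend[of k id "\<lambda>w. (if w = v then - rt k w else rt k w)"]) 
      (use assms gal_id in auto)
  obtain \<sigma> where s: "gal n \<sigma>" "\<And>x. x \<in> Kl (Suc k) \<Longrightarrow> \<sigma> x = \<tau> x"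
    using gal_extend_many[of n "Suc k" \<tau>] assms t by auto
  have "rt k w \<in> Kl (Suc k)" if "w \<in> lev c k" for w using rt_lev(1)[OF that] lev_Kl by blast
  then show ?thesis using s t Kl_Suc_le[of k] by (intro exI[of _ \<sigma>]) auto
qed

text \<open>The relations among the classes of \<open>\<alpha> - c n\<close> modulo squares, as a
  subspace of the power set of the level with symmetric difference as addition.
  \<open>indep n\<close> says that it is zero.\<close>

definition sqsets :: "nat \<Rightarrow> 'a set set" where
  "sqsets n = {J. J \<subseteq> lev c n \<and> (\<exists>x\<in>Kl n. x\<^sup>2 = (\<Prod>\<alpha>\<in>J. \<alpha> - c n))}"

lemma diff_Kl: "\<alpha> \<in> lev c n \<Longrightarrow> \<alpha> - c n \<in> Kl n"
  using lev_Kl c_Kl by (intro Kl_closed(6)) auto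

text \<open>Factors indexed by the intersection occur twice, so their product can be divided out of
  \<open>x\<close>.\<close>

lemma square_sym_diff:
  assumes "J \<subseteq> lev c n" "I \<subseteq> lev c n" "x \<in> Kl n" "x\<^sup>2 = (\<Prod>\<alpha>\<in>J. \<alpha> - c n) * (\<Prod>\<alpha>\<in>I. \<alpha> - c n)"
  shows "sym_diff J I \<in> sqsets n"
proof -
  let ?f = "\<lambda>\<alpha>. \<alpha> - c n"
  have fin: "finite J" "finite I" using assms finite_subset finite_lev by blast+
  let ?m = "prod ?f (J \<inter> I)"
  have J: "prod ?f J = prod ?f (J - I) * ?m" and I: "prod ?f I = prod ?f (I - J) * ?m"
    using fin prod.Int_Diff[of J ?f I] prod.Int_Diff[of I ?f J] by (simp_all add: Int_commute mult.commute)
  have s: "prod ?f (sym_diff J I) = prod ?f (J - I) * prod ?f (I - J)"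
    using fin by (intro prod.union_disjoint) auto
  have m: "?m \<noteq> 0" "?m \<in> Kl n"
    using assms fin diff_nonzero diff_Kl by (auto intro!: subfield_prod[OF subfield_Kl])
  then have "(x / ?m)\<^sup>2 = prod ?f (sym_diff J I)"
    unfolding s using assms(4) unfolding J I by (simp add: power2_eq_square field_simps)
  moreover have "x / ?m \<in> Kl n" using m assms(3) by (intro Kl_closed)
  ultimately show ?thesis unfolding sqsets_def using assms by blast
qed

lemma sqsets_sym_diff:
  assumes "J \<in> sqsets n" "I \<in> sqsets n"
  shows "sym_diff J I \<in> sqsets n"
proof -
  obtain x y where "x \<in> Kl n" "y \<in> Kl n" "x\<^sup>2 = (\<Prod>\<alpha>\<in>J. \<alpha> - c n)" "y\<^sup>2 = (\<Prod>\<alpha>\<in>I. \<alpha> - c n)"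
    using assms unfolding sqsets_def by blast
  then have "x * y \<in> Kl n" "(x * y)\<^sup>2 = (\<Prod>\<alpha>\<in>J. \<alpha> - c n) * (\<Prod>\<alpha>\<in>I. \<alpha> - c n)"
    by (auto simp: power_mult_distrib intro: Kl_closed)
  then show ?thesis using square_sym_diff assms unfolding sqsets_def by blast
qed

lemma gal_prod_diff:
  assumes "gal n \<sigma>" "J \<subseteq> lev c n"
  shows "\<sigma> (\<Prod>\<alpha>\<in>J. \<alpha> - c n) = (\<Prod>\<alpha>\<in>\<sigma> ` J. \<alpha> - c n)"
proof -
  have "inj_on \<sigma> J" using gal_inj[OF assms(1)] assms(2) lev_Kl inj_on_subset by blast
  moreover have "\<sigma> (\<alpha> - c n) = \<sigma> \<alpha> - c n" if "\<alpha> \<in> J" for \<alpha>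
    using gal_simps(4,9)[OF assms(1)] assms(2) that lev_Kl c_Kl by (metis subsetD)
  ultimately show ?thesis
    using fhom_prod[OF subfield_Kl, of n \<sigma> J "\<lambda>\<alpha>. \<alpha> - c n"] assms diff_Kl
    by (auto simp: gal_def prod.reindex)
qed

lemma sqsets_gal:
  assumes "gal n \<sigma>" "J \<in> sqsets n"
  shows "\<sigma> ` J \<in> sqsets n"
proof -
  obtain x where x: "J \<subseteq> lev c n" "x \<in> Kl n" "x\<^sup>2 = (\<Prod>\<alpha>\<in>J. \<alpha> - c n)"
    using assms unfolding sqsets_def by blast
  then have "(\<sigma> x)\<^sup>2 = (\<Prod>\<alpha>\<in>\<sigma> ` J. \<alpha> - c n)"
    using gal_prod_diff[OF assms(1) x(1)] gal_simps(5)[OF assms(1)] by metis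
  moreover have "\<sigma> x \<in> Kl n" using gal_mem[OF assms(1)] x by blast
  moreover have "\<sigma> ` J \<subseteq> lev c n" using x gal_lev_mem[OF assms(1) order_refl] by blast
  ultimately show ?thesis unfolding sqsets_def by blast
qed

text \<open>An interpolation between two pointwise stabilizers: for \<open>A = {}\<close> level
  \<open>k + 1\<close> is fixed, for \<open>A = lev c k\<close> only level \<open>k\<close> is.
  Adding a vertex to \<open>A\<close> permits the exchange of its children.\<close>

definition stab :: "nat \<Rightarrow> nat \<Rightarrow> 'a set \<Rightarrow> ('a \<Rightarrow> 'a) set" where
  "stab n k A = {\<sigma>. gal n \<sigma> \<and> (\<forall>\<alpha>\<in>lev c k. \<sigma> \<alpha> = \<alpha>) \<and> (\<forall>w\<in>lev c k - A. \<sigma> (rt k w) = rt k w)}"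

lemma stab_rt_cases:
  assumes "\<sigma> \<in> stab n k A" "k < n" "w \<in> lev c k"
  shows "\<sigma> (rt k w) = rt k w \<or> \<sigma> (rt k w) = - rt k w"
proof -
  have g: "gal n \<sigma>" "\<sigma> w = w" using assms unfolding stab_def by auto
  have r: "rt k w \<in> Kl n" using rt_lev(1)[OF assms(3)] lev_Kl_le[of "Suc k" n] assms(2) by auto
  have w: "w \<in> Kl n" using assms lev_Kl_le[of k n] by auto
  have "(\<sigma> (rt k w))\<^sup>2 = (rt k w)\<^sup>2"
    using gal_simps(5)[OF g(1) r] gal_simps(4)[OF g(1) w c_Kl[of k]] g(2) gal_simps(9)[OF g(1)] by simp
  then show ?thesis unfolding power2_eq_iff .
qed

text \<open>
  When a 2-group acts linearly on a vector space over the field with two elements, every nonzero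
  invariant subspace contains a nonzero fixed vector. Here the fixed vector is built up by
  enlarging the group by one transposition of siblings at a time.
\<close>

lemma invariant_step:
  assumes ind: "\<And>i. i < n \<Longrightarrow> indep i" and k: "k < n" and v: "v \<in> lev c k" "v \<notin> A"
    and J: "J \<in> sqsets n" "J \<noteq> {}" "\<And>\<sigma>. \<sigma> \<in> stab n k A \<Longrightarrow> \<sigma> ` J = J"
  shows "\<exists>J'\<in>sqsets n. J' \<noteq> {} \<and> (\<forall>\<sigma>\<in>stab n k (insert v A). \<sigma> ` J' = J')"
proof -
  obtain s where s: "gal n s" "\<forall>x\<in>Kl k. s x = x"
    "\<forall>w\<in>lev c k. s (rt k w) = (if w = v then - rt k w else rt k w)"
    using gal_swap[OF ind k v(1)] by blast
  obtain t where t: "gal n t" "\<And>x. x \<in> Kl n \<Longrightarrow> t (s x) = x" "\<And>x. x \<in> Kl n \<Longrightarrow> s (t x) = x"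
    using gal_inverse[OF s(1)] by blast
  have rK: "rt k w \<in> Kl n" if "w \<in> lev c k" for w
    using rt_lev(1)[OF that] lev_Kl_le[of "Suc k" n] k by auto
  have wK: "w \<in> Kl n" if "w \<in> lev c k" for w using that lev_Kl_le[of k n] k by auto
  have sl: "s w = w" if "w \<in> lev c k" for w using s(2) lev_Kl that by blast
  have tl: "t w = w" if "w \<in> lev c k" for w using t(2)[OF wK[OF that]] sl[OF that] by simp
  have tA: "t \<in> stab n k {v}" using t tl rK s(3) by (auto simp: stab_def) (metis t(2) rK)
  have tv: "t (rt k v) = - rt k v"
    using t(2)[OF rK[OF v(1)]] s(3) v(1) gal_simps(3)[OF t(1) rK[OF v(1)]] by (metis minus_minus)
  have sneg: "s (- rt k w) = - s (rt k w)" "t (- rt k w) = - t (rt k w)" if "w \<in> lev c k" for w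
    using gal_simps(3)[OF s(1) rK[OF that]] gal_simps(3)[OF t(1) rK[OF that]] .
  have JK: "J \<subseteq> Kl n" and Jl: "J \<subseteq> lev c n" using J lev_Kl[of n] unfolding sqsets_def by auto
  \<comment> \<open>\<open>s\<close> may have order greater than 2 on level \<open>n\<close>, but
    its square fixes level \<open>k + 1\<close> and so falls into the smaller group.\<close>
  have ss: "s \<circ> s \<in> stab n k A"
  proof -
    have "gal n (s \<circ> s)" using gal_comp s by blast
    then show ?thesis using sl s(3) sneg by (auto simp: stab_def)
  qed
  \<comment> \<open>\<open>s\<close> normalizes \<open>stab n k A\<close>, because on level
    \<open>k + 1\<close> it only changes signs. Hence the image of \<open>J\<close> under
    \<open>s\<close> is fixed by the smaller group as well.\<close>
  have conj: "t \<circ> h \<circ> s \<in> stab n k A" if h: "h \<in> stab n k A" for h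
  proof -
    have g: "gal n (t \<circ> h \<circ> s)" using h gal_comp s t by (auto simp: stab_def)
    have "(t \<circ> h \<circ> s) (rt k w) = rt k w" if w: "w \<in> lev c k" "w \<notin> A" for w
    proof -
      have hw: "h (rt k w) = rt k w" using h w by (simp add: stab_def)
      have "gal n h" using h by (simp add: stab_def)
      then have hn: "h (- rt k w) = - rt k w" using gal_simps(3) rK[OF w(1)] hw by metis
      have "h (s (rt k w)) = s (rt k w)" using s(3) w hw hn by auto
      then show ?thesis using t(2)[OF rK[OF w(1)]] by simp
    qed
    then show ?thesis using g sl tl h by (auto simp: stab_def)
  qed
  have hs: "h ` s ` J = s ` J" if h: "h \<in> stab n k A" for h
  proof -
    have g: "gal n h" using h by (simp add: stab_def)
    have "s ` (t \<circ> h \<circ> s) ` J = s ` J" using J(3)[OF conj[OF h]] by simp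
    moreover have "s ` (t \<circ> h \<circ> s) ` J = h ` s ` J"
      unfolding image_image comp_def
      by (rule image_cong) (use t(3) JK gal_mem[OF g] gal_mem[OF s(1)] in auto)
    ultimately show ?thesis by simp
  qed
  have ssJ: "s ` s ` J = J" using J(3)[OF ss] by (simp add: image_comp)
  have tJ: "t ` s ` J = J" using t(2) JK by (force simp: image_image)
  \<comment> \<open>The smaller group has index 2 in the larger one: an element that moves
    \<open>rt k v\<close> lands in \<open>stab n k A\<close> after composition with
    \<open>t\<close>, the inverse of \<open>s\<close>.\<close>
  have main: "\<sigma> ` J' = J'"
    if J': "J' \<subseteq> lev c n" "s ` J' = J'" "\<And>h. h \<in> stab n k A \<Longrightarrow> h ` J' = J'"
      and sg: "\<sigma> \<in> stab n k (insert v A)" for J' \<sigma>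
  proof (cases "\<sigma> (rt k v) = rt k v")
    case True
    then have "\<sigma> \<in> stab n k A" using sg unfolding stab_def by auto
    then show ?thesis using J' by blast
  next
    case False
    then have m: "\<sigma> (rt k v) = - rt k v" using stab_rt_cases[OF sg k v(1)] by blast
    have g: "gal n \<sigma>" using sg by (simp add: stab_def)
    have "t \<circ> \<sigma> \<in> stab n k A"
    proof -
      have "gal n (t \<circ> \<sigma>)" using gal_comp t g by blast
      moreover have "(t \<circ> \<sigma>) w = w" if "w \<in> lev c k" for w using that sg tl by (simp add: stab_def)
      moreover have "(t \<circ> \<sigma>) (rt k w) = rt k w" if "w \<in> lev c k - A" for w
      proof (cases "w = v")
        case True
        then show ?thesis using m tv sneg v(1) by simp
      next
        case False
        then have "\<sigma> (rt k w) = rt k w" using sg that by (simp add: stab_def)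
        moreover have "t (rt k w) = rt k w" using tA that False by (simp add: stab_def)
        ultimately show ?thesis by simp
      qed
      ultimately show ?thesis unfolding stab_def by blast
    qed
    then have "(t \<circ> \<sigma>) ` J' = J'" using J' by blast
    then have "s ` (t \<circ> \<sigma>) ` J' = J'" using J' by simp
    moreover have "s ` (t \<circ> \<sigma>) ` J' = \<sigma> ` J'"
      unfolding image_image comp_def
      by (rule image_cong) (use t(3) J'(1) lev_Kl[of n] gal_mem[OF g] in auto)
    ultimately show ?thesis by simp
  qed
  show ?thesis
  proof (cases "s ` J = J")
    case True
    have "\<forall>\<sigma>\<in>stab n k (insert v A). \<sigma> ` J = J"
      by (intro ballI main[OF Jl True J(3)])
    then show ?thesis using J(1,2) by blast
  next
    case False
    \<comment> \<open>The sum of \<open>J\<close> and its image: nonzero because \<open>s\<close>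
      moves \<open>J\<close>, and fixed by \<open>s\<close> because \<open>s \<circ> s\<close> fixes
      \<open>J\<close>.\<close>
    let ?J = "sym_diff J (s ` J)"
    have sJ: "s ` J \<in> sqsets n" using sqsets_gal s(1) J(1) by blast
    have q: "?J \<in> sqsets n" using sqsets_sym_diff J sJ by blast
    have im: "h ` sym_diff U W = sym_diff (h ` U) (h ` W)" if "gal n h" "U \<subseteq> Kl n" "W \<subseteq> Kl n" for h U W
      using gal_inj[OF that(1)] that(2,3)
      by (simp add: image_Un inj_on_image_set_diff[of h "Kl n"] Diff_subset subset_trans[OF Diff_subset])
    have sJK: "s ` J \<subseteq> Kl n" using sJ lev_Kl[of n] unfolding sqsets_def by auto
    have sJJ: "s ` ?J = ?J" using im[OF s(1) JK sJK] ssJ by auto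
    have hJJ: "h ` ?J = ?J" if "h \<in> stab n k A" for h
      using im[of h J "s ` J"] that JK sJK hs J(3) by (simp add: stab_def)
    have "?J \<subseteq> lev c n" using q unfolding sqsets_def by blast
    then have "\<forall>\<sigma>\<in>stab n k (insert v A). \<sigma> ` ?J = ?J"
      by (intro ballI main[OF _ sJJ hJJ])
    moreover have "?J \<noteq> {}" using False by blast
    ultimately show ?thesis by (intro bexI[OF _ q] conjI)
  qed
qed

text \<open>Descending induction on \<open>k\<close>. At \<open>k = n\<close> the set
  \<open>J\<close> itself serves; each step enlarges \<open>stab n k {}\<close> to
  \<open>stab n k (lev c k)\<close> one vertex at a time. At \<open>k = 0\<close> the condition on
  \<sigma> is vacuous, since level 0 is \<open>{0}\<close>, and the whole Galois group fixes the
  result.\<close>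

lemma invariant_level:
  assumes ind: "\<And>i. i < n \<Longrightarrow> indep i" and J: "J \<in> sqsets n" "J \<noteq> {}" and k: "k \<le> n"
  shows "\<exists>J'\<in>sqsets n. J' \<noteq> {} \<and> (\<forall>\<sigma>. gal n \<sigma> \<longrightarrow> (\<forall>\<alpha>\<in>lev c k. \<sigma> \<alpha> = \<alpha>) \<longrightarrow> \<sigma> ` J' = J')"
  using k
proof (induction k rule: inc_induct)
  case base
  have "\<sigma> ` J = J" if "\<forall>\<alpha>\<in>lev c n. \<sigma> \<alpha> = \<alpha>" for \<sigma>
    using that J(1) unfolding sqsets_def by force
  then show ?case using J by (intro bexI[of _ J]) simp_all
next
  case (step k)
  have "\<exists>J'\<in>sqsets n. J' \<noteq> {} \<and> (\<forall>\<sigma>\<in>stab n k A. \<sigma> ` J' = J')" if "finite A" "A \<subseteq> lev c k" for A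
    using that
  proof (induction A rule: finite_induct)
    case empty
    have fixed: "\<sigma> \<alpha> = \<alpha>" if s: "\<sigma> \<in> stab n k {}" and a: "\<alpha> \<in> lev c (Suc k)" for \<sigma> \<alpha>
    proof -
      let ?w = "\<alpha>\<^sup>2 + c k"
      have w: "?w \<in> lev c k" using a by simp
      have g: "gal n \<sigma>" and r: "\<sigma> (rt k ?w) = rt k ?w" using s w by (auto simp: stab_def)
      have "rt k ?w \<in> Kl n" using rt_lev(1)[OF w] lev_Kl_le[of "Suc k" n] step.hyps by auto
      then show ?thesis using lev_Suc_cases[OF a] r gal_simps(3)[OF g] by metis
    qed
    obtain J' where J': "J' \<in> sqsets n" "J' \<noteq> {}"
      "\<forall>\<sigma>. gal n \<sigma> \<longrightarrow> (\<forall>\<alpha>\<in>lev c (Suc k). \<sigma> \<alpha> = \<alpha>) \<longrightarrow> \<sigma> ` J' = J'"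
      using step.IH by blast
    have inv: "\<forall>\<sigma>\<in>stab n k {}. \<sigma> ` J' = J'"
    proof
      fix \<sigma> assume s: "\<sigma> \<in> stab n k {}"
      have "gal n \<sigma>" using s unfolding stab_def by blast
      moreover have "\<forall>\<alpha>\<in>lev c (Suc k). \<sigma> \<alpha> = \<alpha>" using fixed[OF s] by blast
      ultimately show "\<sigma> ` J' = J'" using J'(3) by blast
    qed
    show ?case by (rule bexI[OF _ J'(1)], rule conjI[OF J'(2) inv])
  next
    case (insert v A)
    then obtain J' where J': "J' \<in> sqsets n" "J' \<noteq> {}" "\<forall>\<sigma>\<in>stab n k A. \<sigma> ` J' = J'" by auto
    show ?case
      by (rule invariant_step[OF ind step.hyps(2) _ _ J'(1,2)]) (use insert.hyps insert.prems J'(3) in auto)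
  qed
  from this[OF finite_lev order_refl] obtain J' where
    J': "J' \<in> sqsets n" "J' \<noteq> {}" "\<forall>\<sigma>\<in>stab n k (lev c k). \<sigma> ` J' = J'" by blast
  have inv: "\<forall>\<sigma>. gal n \<sigma> \<longrightarrow> (\<forall>\<alpha>\<in>lev c k. \<sigma> \<alpha> = \<alpha>) \<longrightarrow> \<sigma> ` J' = J'"
  proof (intro allI impI)
    fix \<sigma> assume "gal n \<sigma>" "\<forall>\<alpha>\<in>lev c k. \<sigma> \<alpha> = \<alpha>"
    then have "\<sigma> \<in> stab n k (lev c k)" unfolding stab_def by simp
    then show "\<sigma> ` J' = J'" using J'(3) by blast
  qed
  show ?case by (rule bexI[OF _ J'(1)], rule conjI[OF J'(2) inv])
qed

lemma invariant_all:
  assumes "\<And>i. i < n \<Longrightarrow> indep i" "J \<subseteq> lev c n" "\<And>\<sigma>. gal n \<sigma> \<Longrightarrow> \<sigma> ` J = J"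
  shows "J = {} \<or> J = lev c n"
proof (cases "J = {}")
  case False
  then obtain \<alpha> where a: "\<alpha> \<in> J" by blast
  have "\<beta> \<in> J" if "\<beta> \<in> lev c n" for \<beta>
    using gal_transitive[OF assms(1) _ that, of \<alpha>] a assms(2,3) by blast
  then show ?thesis using assms(2) by blast
qed simp

text \<open>A relation on level \<open>n\<close> yields a nonempty invariant one, which by
  transitivity is the full level with product \<open>crit_prod n\<close>. One nonsquare condition
  thus replaces the \<open>2 ^ 2 ^ n - 1\<close> conditions in \<open>indep n\<close>.\<close>

lemma indep_step:
  assumes ind: "\<And>i. i < n \<Longrightarrow> indep i" and g: "\<And>x. x \<in> Kl n \<Longrightarrow> x\<^sup>2 \<noteq> crit_prod n"
  shows "indep n"
proof (rule ccontr)
  assume "\<not> indep n"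
  then obtain J where "J \<in> sqsets n" "J \<noteq> {}" unfolding indep_def sqsets_def by blast
  from invariant_level[of n J 0, OF ind this] obtain J where
    J: "J \<in> sqsets n" "J \<noteq> {}" "\<forall>\<sigma>. gal n \<sigma> \<longrightarrow> \<sigma> ` J = J"
    using gal_simps(7) by auto
  then have "J = lev c n" using invariant_all[where J = J, OF ind] unfolding sqsets_def by blast
  then show False using J(1) g unfolding sqsets_def crit_prod_def by blast
qed

text \<open>Going down one level, \<open>kummer_square\<close> supplies a set \<open>J\<close> whose
  product times \<open>u\<close> is a square. As every \<sigma> fixes \<open>u\<close>, the
  difference of \<open>J\<close> and its image is a relation, hence empty; so \<open>J\<close> is
  invariant, and it is empty or the whole level. In the second case the factor
  \<open>crit_prod n\<close> is absorbed into \<open>u\<close>.\<close>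

lemma square_descent:
  assumes "\<And>i. i < n \<Longrightarrow> indep i" "u \<in> K" "x \<in> Kl n" "x\<^sup>2 = u"
  shows "\<exists>I\<subseteq>{..<n}. \<exists>y\<in>K. y\<^sup>2 = u * (\<Prod>i\<in>I. crit_prod i)"
  using assms
proof (induction n arbitrary: u x)
  case 0
  then show ?case by (intro exI[of _ "{}"]) (auto simp: Kl_0)
next
  case (Suc n)
  have ind: "indep n" "\<And>i. i < n \<Longrightarrow> indep i" using Suc.prems(1) by auto
  show ?case
  proof (cases "u = 0")
    case True
    then show ?thesis using subfield_closed(1)[OF subfield_K] by (intro exI[of _ "{}"]) auto
  next
    case False
    have "\<exists>J\<subseteq>lev c n. \<exists>y\<in>Kl n. y\<^sup>2 = u * (\<Prod>\<alpha>\<in>J. (rt n \<alpha>)\<^sup>2)"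
      by (rule kummer_square[where x = x])
        (use Suc.prems K_Kl diff_Kl subfield_Kl in \<open>auto simp: Kl_Suc\<close>)
    then obtain J y where J: "J \<subseteq> lev c n" "y \<in> Kl n" "y\<^sup>2 = u * (\<Prod>\<alpha>\<in>J. \<alpha> - c n)" by auto
    have "\<sigma> ` J = J" if s: "gal n \<sigma>" for \<sigma>
    proof -
      have uK: "u \<in> Kl n" using Suc.prems K_Kl by blast
      have pK: "(\<Prod>\<alpha>\<in>J. \<alpha> - c n) \<in> Kl n"
        by (rule subfield_prod[OF subfield_Kl]) (use J diff_Kl in auto)
      have "(\<sigma> y)\<^sup>2 = u * (\<Prod>\<alpha>\<in>\<sigma> ` J. \<alpha> - c n)"
        using gal_simps(5)[OF s J(2)] gal_simps(2)[OF s uK pK] gal_prod_diff[OF s J(1)]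
          gal_simps(8)[OF s Suc.prems(2)] J(3) by simp
      \<comment> \<open>\<open>y\<close> and \<open>\<sigma> y\<close> each square to
        \<open>u\<close> times a product, so dividing \<open>y * \<sigma> y\<close> by
        \<open>u\<close> leaves only the two products.\<close>
      then have "(y * \<sigma> y / u)\<^sup>2 = (\<Prod>\<alpha>\<in>J. \<alpha> - c n) * (\<Prod>\<alpha>\<in>\<sigma> ` J. \<alpha> - c n)"
        using J(3) False by (simp add: power_mult_distrib power_divide) (simp add: power2_eq_square)
      moreover have "y * \<sigma> y / u \<in> Kl n"
        using J(2) gal_mem[OF s] uK by (intro Kl_closed(7,8)) auto
      moreover have "\<sigma> ` J \<subseteq> lev c n" using J(1) gal_lev_mem[OF s order_refl] by blast
      ultimately have "sym_diff J (\<sigma> ` J) \<in> sqsets n" using square_sym_diff J(1) by blast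
      then have "sym_diff J (\<sigma> ` J) = {}" using ind(1) unfolding indep_def sqsets_def by blast
      then show ?thesis by blast
    qed
    then consider "J = {}" | "J = lev c n" using invariant_all[OF ind(2) J(1)] by blast
    then show ?thesis
    proof cases
      case 1
      then have "\<exists>I\<subseteq>{..<n}. \<exists>y\<in>K. y\<^sup>2 = u * (\<Prod>i\<in>I. crit_prod i)"
        using Suc.IH[OF ind(2) Suc.prems(2) J(2)] J(3) by simp
      then show ?thesis by (meson lessThan_subset_iff order_trans le_SucI order_refl)
    next
      case 2
      obtain I z where I: "I \<subseteq> {..<n}" "z \<in> K" "z\<^sup>2 = u * crit_prod n * (\<Prod>i\<in>I. crit_prod i)"
        using Suc.IH[OF ind(2) _ J(2), of "u * crit_prod n"] J(3) 2 Suc.prems(2) subfield_closed(7)[OF subfield_K] crit_prod_K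
        by (auto simp: crit_prod_def)
      have "n \<notin> I" "finite I" using I(1) finite_subset by auto
      then have "z\<^sup>2 = u * (\<Prod>i\<in>insert n I. crit_prod i)" using I(3) by (simp add: mult.assoc)
      then show ?thesis using I(1,2) by (intro exI[of _ "insert n I"]) auto
    qed
  qed
qed

theorem indep_all:
  assumes "\<And>I y. finite I \<Longrightarrow> I \<noteq> {} \<Longrightarrow> y \<in> K \<Longrightarrow> y\<^sup>2 \<noteq> (\<Prod>i\<in>I. crit_prod i)"
  shows "indep n"
proof (induction n rule: less_induct)
  case (less n)
  show ?case
  proof (rule indep_step)
    fix x assume x: "x \<in> Kl n"
    show "x\<^sup>2 \<noteq> crit_prod n"
    proof
      assume e: "x\<^sup>2 = crit_prod n"
      from square_descent[OF less crit_prod_K x e] obtain I y where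
        I: "I \<subseteq> {..<n}" "y \<in> K" "y\<^sup>2 = crit_prod n * (\<Prod>i\<in>I. crit_prod i)" by blast
      have "n \<notin> I" "finite I" using I(1) finite_subset by auto
      then show False using assms[of "insert n I" y] I by simp
    qed
  qed (use less in blast)
qed

end

section \<open>Automorphisms of the preimage tree\<close>

lemma eq_uminus_iff_zero: "x = - x \<longleftrightarrow> x = (0::'a::field_char_0)"
  by (simp add: eq_neg_iff_add_eq_0 flip: mult_2)

text \<open>Vertices are field elements, so disjointness is what makes the level of a vertex well
  defined and the graph of parents a tree.\<close>

locale quadratic_tree = quadratic_tower +
  assumes lev_disjoint: "m \<noteq> n \<Longrightarrow> lev c m \<inter> lev c n = {}"
begin

text \<open>Tree automorphisms in the recursive form in which Galois elements are constructed.
  Injectivity on the finite levels already makes such a map a bijection of the tree.\<close>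

definition level_map :: "('a \<Rightarrow> 'a) \<Rightarrow> bool" where
  "level_map f \<longleftrightarrow> (\<forall>n. f ` lev c n \<subseteq> lev c n \<and> inj_on f (lev c n) \<and>
     (\<forall>\<beta>\<in>lev c (Suc n). f (\<beta>\<^sup>2 + c n) = (f \<beta>)\<^sup>2 + c n))"

lemma level_map_uminus:
  assumes f: "level_map f" and b: "\<beta> \<in> lev c (Suc n)"
  shows "f (- \<beta>) = - f \<beta>"
proof -
  have nb: "- \<beta> \<in> lev c (Suc n)" using b by simp
  have "f (\<beta>\<^sup>2 + c n) = (f \<beta>)\<^sup>2 + c n" "f ((- \<beta>)\<^sup>2 + c n) = (f (- \<beta>))\<^sup>2 + c n"
    using f b nb unfolding level_map_def by blast+
  then have "(f (- \<beta>))\<^sup>2 = (f \<beta>)\<^sup>2" by simp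
  moreover have "f (- \<beta>) \<noteq> f \<beta>"
  proof
    assume "f (- \<beta>) = f \<beta>"
    moreover have "inj_on f (lev c (Suc n))" using f unfolding level_map_def by blast
    ultimately have "- \<beta> = \<beta>" using b nb by (meson inj_onD)
    then have "\<beta> = 0" by simp
    then show False using b zero_notin_lev by blast
  qed
  ultimately show ?thesis unfolding power2_eq_iff by blast
qed

text \<open>Under independence the image of \<open>rt n \<alpha>\<close> may be either root below
  the image of \<alpha>, so it can be the one that \<open>f\<close> prescribes;
  \<open>level_map_uminus\<close> then settles the opposite root. Dependent choice keeps the lifts
  compatible.\<close>

lemma level_map_realized:
  assumes ind: "\<And>n. indep n" and f: "level_map f"
  obtains \<sigma> where "\<And>n. gal n (\<sigma> n)" "\<And>n \<alpha>. \<alpha> \<in> lev c n \<Longrightarrow> \<sigma> n \<alpha> = f \<alpha>"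
    "\<And>n x. x \<in> Kl n \<Longrightarrow> \<sigma> (Suc n) x = \<sigma> n x"
proof -
  have "\<exists>\<sigma>. \<forall>n. (gal n (\<sigma> n) \<and> (\<forall>\<alpha>\<in>lev c n. \<sigma> n \<alpha> = f \<alpha>)) \<and> (\<forall>x\<in>Kl n. \<sigma> (Suc n) x = \<sigma> n x)"
  proof (rule dependent_nat_choice)
    have "f 0 = 0" using f unfolding level_map_def by (auto dest: spec[of _ 0])
    then show "\<exists>\<sigma>. gal 0 \<sigma> \<and> (\<forall>\<alpha>\<in>lev c 0. \<sigma> \<alpha> = f \<alpha>)"
      using gal_id by (intro exI[of _ id]) (metis id_apply lev.simps(1) singletonD)
  next
    fix \<sigma> n assume s: "gal n \<sigma> \<and> (\<forall>\<alpha>\<in>lev c n. \<sigma> \<alpha> = f \<alpha>)"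
    have sq: "(f (rt n \<alpha>))\<^sup>2 + c n = \<sigma> \<alpha>" if a: "\<alpha> \<in> lev c n" for \<alpha>
    proof -
      have "f ((rt n \<alpha>)\<^sup>2 + c n) = (f (rt n \<alpha>))\<^sup>2 + c n"
        using f rt_lev(1)[OF a] unfolding level_map_def by blast
      then show ?thesis using s a by simp
    qed
    obtain \<tau> where t: "gal (Suc n) \<tau>" "\<And>x. x \<in> Kl n \<Longrightarrow> \<tau> x = \<sigma> x" "\<And>\<alpha>. \<alpha> \<in> lev c n \<Longrightarrow> \<tau> (rt n \<alpha>) = f (rt n \<alpha>)"
      by (rule gal_extend[of n \<sigma> "\<lambda>\<alpha>. f (rt n \<alpha>)"]) (use ind s sq in auto)
    have "\<tau> \<beta> = f \<beta>" if b: "\<beta> \<in> lev c (Suc n)" for \<beta>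
    proof -
      have w: "\<beta>\<^sup>2 + c n \<in> lev c n" using b by simp
      note r = rt_lev(1)[OF w]
      have "\<tau> (- rt n (\<beta>\<^sup>2 + c n)) = f (- rt n (\<beta>\<^sup>2 + c n))"
        using t(3)[OF w] gal_simps(3)[OF t(1)] level_map_uminus[OF f r] r lev_Kl by (metis subsetD)
      then show ?thesis using lev_Suc_cases[OF b] t(3)[OF w] by metis
    qed
    then show "\<exists>\<tau>. (gal (Suc n) \<tau> \<and> (\<forall>\<alpha>\<in>lev c (Suc n). \<tau> \<alpha> = f \<alpha>)) \<and> (\<forall>x\<in>Kl n. \<tau> x = \<sigma> x)"
      using t(1,2) by (intro exI[of _ \<tau>]) simp
  qed
  then show ?thesis using that by blast
qed

text \<open>
  The automorphism exchanging the two subtrees below the vertex \<open>v\<close> of level \<open>n\<close>; it transports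
  the chosen square root below each vertex to the chosen square root below its image.
\<close>

primrec twist :: "nat \<Rightarrow> 'a \<Rightarrow> nat \<Rightarrow> 'a \<Rightarrow> 'a" where
  "twist n v 0 \<beta> = \<beta>"
| "twist n v (Suc m) \<beta> = (if m = n \<and> \<beta>\<^sup>2 + c m = v then - 1 else 1) *
     (if \<beta> = rt m (\<beta>\<^sup>2 + c m) then 1 else - 1) * rt m (twist n v m (\<beta>\<^sup>2 + c m))"

lemma twist_square: "(twist n v (Suc m) \<beta>)\<^sup>2 + c m = twist n v m (\<beta>\<^sup>2 + c m)"
  by (simp add: power_mult_distrib)

lemma twist_lev: "\<beta> \<in> lev c m \<Longrightarrow> twist n v m \<beta> \<in> lev c m"
proof (induction m arbitrary: \<beta>)
  case (Suc m)
  then show ?case using twist_square[of n v m \<beta>] by (simp del: twist.simps)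
qed simp

lemma twist_inj: "inj_on (twist n v m) (lev c m)"
proof (induction m)
  case (Suc m)
  show ?case
  proof (rule inj_onI)
    fix x y assume x: "x \<in> lev c (Suc m)" and y: "y \<in> lev c (Suc m)"
      and e: "twist n v (Suc m) x = twist n v (Suc m) y"
    have "twist n v m (x\<^sup>2 + c m) = twist n v m (y\<^sup>2 + c m)" using e twist_square by metis
    then have s: "x\<^sup>2 + c m = y\<^sup>2 + c m"
      by (rule inj_onD[OF Suc]) (use x y in simp_all)
    let ?w = "x\<^sup>2 + c m"
    have "(x = rt m ?w) = (y = rt m ?w)"
    proof (rule ccontr)
      assume "(x = rt m ?w) \<noteq> (y = rt m ?w)"
      then have "twist n v (Suc m) x = - twist n v (Suc m) y" using s by auto
      then have "twist n v (Suc m) y = 0" unfolding e by (simp only: eq_uminus_iff_zero)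
      then show False using twist_lev[OF y, of n v] zero_notin_lev by metis
    qed
    then show "x = y" using lev_Suc_cases[OF x] lev_Suc_cases[OF y] s by metis
  qed
qed simp

lemma twist_id: "m \<le> n \<Longrightarrow> \<beta> \<in> lev c m \<Longrightarrow> twist n v m \<beta> = \<beta>"
proof (induction m arbitrary: \<beta>)
  case (Suc m)
  have "twist n v m (\<beta>\<^sup>2 + c m) = \<beta>\<^sup>2 + c m" using Suc by simp
  then show ?case using lev_Suc_cases[OF Suc.prems(2)] Suc.prems(1) by auto
qed simp

lemma twist_top:
  assumes a: "\<alpha> \<in> lev c n"
  shows "twist n v (Suc n) (rt n \<alpha>) = (if \<alpha> = v then - rt n \<alpha> else rt n \<alpha>)"
  using twist_id[OF order_refl a, of v] by simp

definition level :: "'a \<Rightarrow> nat" where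
  "level \<beta> = (THE n. \<beta> \<in> lev c n)"

lemma level_eq: "\<beta> \<in> lev c n \<Longrightarrow> level \<beta> = n"
  unfolding level_def using lev_disjoint by (intro the_equality) blast+

lemma level_map_twist: "level_map (\<lambda>\<beta>. twist n v (level \<beta>) \<beta>)"
  unfolding level_map_def
proof (intro allI conjI)
  fix m
  have e: "twist n v (level \<beta>) \<beta> = twist n v m \<beta>" if "\<beta> \<in> lev c m" for \<beta> m
    using level_eq[OF that] by simp
  show "(\<lambda>\<beta>. twist n v (level \<beta>) \<beta>) ` lev c m \<subseteq> lev c m"
    using e twist_lev by auto
  show "inj_on (\<lambda>\<beta>. twist n v (level \<beta>) \<beta>) (lev c m)"
    using twist_inj[of n v m] by (simp add: inj_on_def e)
  show "\<forall>\<beta>\<in>lev c (Suc m). twist n v (level (\<beta>\<^sup>2 + c m)) (\<beta>\<^sup>2 + c m) = (twist n v (level \<beta>) \<beta>)\<^sup>2 + c m"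
  proof
    fix \<beta> assume b: "\<beta> \<in> lev c (Suc m)"
    then have "\<beta>\<^sup>2 + c m \<in> lev c m" by simp
    then show "twist n v (level (\<beta>\<^sup>2 + c m)) (\<beta>\<^sup>2 + c m) = (twist n v (level \<beta>) \<beta>)\<^sup>2 + c m"
      using e[OF b] e[of "\<beta>\<^sup>2 + c m" m] twist_square[of n v m \<beta>] by simp
  qed
qed

text \<open>Twisting a vertex of the highest level \<open>n = Max I\<close> changes the sign of one
  factor of \<open>R n\<close> and fixes \<open>R i\<close> for \<open>i < n\<close>. So it negates
  the product of all \<open>R i\<close> with \<open>i\<close> in \<open>I\<close>; but this product
  squares to \<open>y\<^sup>2\<close>, hence lies in \<open>K\<close> and is fixed.\<close>

lemma crit_prods_independent:
  assumes real: "\<And>f n. level_map f \<Longrightarrow> \<exists>\<sigma>. gal n \<sigma> \<and> (\<forall>k\<le>n. \<forall>\<alpha>\<in>lev c k. \<sigma> \<alpha> = f \<alpha>)"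
    and I: "finite I" "I \<noteq> {}" and y: "y \<in> K"
  shows "y\<^sup>2 \<noteq> (\<Prod>i\<in>I. crit_prod i)"
proof
  assume eq: "y\<^sup>2 = (\<Prod>i\<in>I. crit_prod i)"
  define n where "n = Max I"
  obtain v where v: "v \<in> lev c n" using lev_nonempty by blast
  obtain \<sigma> where s: "gal (Suc n) \<sigma>" "\<forall>k\<le>Suc n. \<forall>\<alpha>\<in>lev c k. \<sigma> \<alpha> = twist n v (level \<alpha>) \<alpha>"
    using real[OF level_map_twist] by blast
  have sr: "\<sigma> (rt i \<alpha>) = (if i = n \<and> \<alpha> = v then - rt i \<alpha> else rt i \<alpha>)"
    if "i \<le> n" "\<alpha> \<in> lev c i" for i \<alpha>
  proof -
    note r = rt_lev(1)[OF that(2)]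
    have e: "\<sigma> (rt i \<alpha>) = twist n v (Suc i) (rt i \<alpha>)"
      using s(2) that(1) r level_eq[OF r] by auto
    show ?thesis
    proof (cases "i = n")
      case True
      then show ?thesis using e twist_top that by simp
    next
      case False
      then show ?thesis using e twist_id[of "Suc i" n "rt i \<alpha>"] r that(1) by simp
    qed
  qed
  define R where "R i = (\<Prod>\<alpha>\<in>lev c i. rt i \<alpha>)" for i
  have rK: "rt i \<alpha> \<in> Kl (Suc n)" if "i \<le> n" "\<alpha> \<in> lev c i" for i \<alpha>
    using rt_lev(1)[OF that(2)] lev_Kl_le[of "Suc i" "Suc n"] that(1) by auto
  have RK: "R i \<in> Kl (Suc n)" if "i \<le> n" for i
    unfolding R_def using rK that by (intro subfield_prod[OF subfield_Kl])
  have fh: "fhom (Kl (Suc n)) \<sigma>" using s(1) unfolding gal_def by blast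
  have sR: "\<sigma> (R i) = (if i = n then - R i else R i)" if "i \<le> n" for i
  proof -
    have "\<sigma> (R i) = (\<Prod>\<alpha>\<in>lev c i. \<sigma> (rt i \<alpha>))"
      unfolding R_def using rK that by (intro fhom_prod[OF subfield_Kl fh]) auto
    also have "\<dots> = (\<Prod>\<alpha>\<in>lev c i. (if i = n \<and> \<alpha> = v then - 1 else 1) * rt i \<alpha>)"
      using sr that by (intro prod.cong) auto
    also have "\<dots> = (\<Prod>\<alpha>\<in>lev c i. (if i = n \<and> \<alpha> = v then - 1 else 1)) * R i"
      by (simp add: prod.distrib R_def)
    also have "(\<Prod>\<alpha>\<in>lev c i. (if i = n \<and> \<alpha> = v then - 1 else 1 :: 'a)) = (if i = n then - 1 else 1)"
      using v by (auto simp: prod.delta)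
    finally show ?thesis by simp
  qed
  have le: "i \<le> n" if "i \<in> I" for i using that I by (simp add: n_def)
  have nI: "n \<in> I" using I by (simp add: n_def)
  let ?P = "\<Prod>i\<in>I. R i"
  have "\<sigma> ?P = (\<Prod>i\<in>I. \<sigma> (R i))"
    using RK le by (intro fhom_prod[OF subfield_Kl fh]) auto
  also have "\<dots> = (\<Prod>i\<in>I. (if i = n then - 1 else 1) * R i)"
    using sR le by (intro prod.cong) auto
  also have "\<dots> = (\<Prod>i\<in>I. if i = n then - 1 else 1) * ?P"
    by (simp add: prod.distrib)
  also have "(\<Prod>i\<in>I. if i = n then - 1 else 1 :: 'a) = - 1"
    using nI I by (simp add: prod.delta)
  finally have neg: "\<sigma> ?P = - ?P" by simp
  have "R i \<noteq> 0" for i unfolding R_def using rt_nonzero by (auto simp: prod_zero_iff)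
  then have P0: "?P \<noteq> 0" using I by (auto simp: prod_zero_iff)
  have "(R i)\<^sup>2 = crit_prod i" for i
    by (simp add: R_def crit_prod_def prod_power_distrib)
  then have "?P\<^sup>2 = y\<^sup>2" unfolding eq by (simp add: prod_power_distrib)
  then have "?P = y \<or> ?P = - y" unfolding power2_eq_iff .
  then have "?P \<in> K" using y subfield_closed(3)[OF subfield_K] by metis
  then have "\<sigma> ?P = ?P" using gal_simps(8)[OF s(1)] by blast
  then have "?P = 0" using neg by (simp add: eq_uminus_iff_zero)
  then show False using P0 by blast
qed

section \<open>Graph automorphisms and level maps\<close>

definition edges :: "'a set set" where
  "edges = {{\<beta>, \<beta>\<^sup>2 + c n} | \<beta> n. \<beta> \<in> lev c (Suc n)}"

lemma edge_cases:
  assumes "{u, v} \<in> edges"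
  obtains n where "u \<in> lev c (Suc n)" "v = u\<^sup>2 + c n" | n where "v \<in> lev c (Suc n)" "u = v\<^sup>2 + c n"
proof -
  obtain b n where "b \<in> lev c (Suc n)" "{u, v} = {b, b\<^sup>2 + c n}"
    using assms unfolding edges_def by blast
  then show ?thesis using that by (metis doubleton_eq_iff)
qed

lemma lev_eqI: "x \<in> lev c m \<Longrightarrow> x \<in> lev c n \<Longrightarrow> m = n"
  using lev_disjoint by blast

lemma zero_neighbour:
  assumes "{0, v} \<in> edges"
  shows "v \<in> {rt 0 0, - rt 0 0}"
  using assms
proof (rule edge_cases)
  fix n assume v: "v \<in> lev c (Suc n)" "0 = v\<^sup>2 + c n"
  then have "n = 0" using lev_eqI[of 0 n 0] by simp
  then show ?thesis using lev_Suc_cases[OF v(1)] v(2) by auto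
qed (use zero_notin_lev in blast)

lemma edge_iff_level_map:
  assumes bij: "bij_betw f (\<Union>n. lev c n) (\<Union>n. lev c n)"
    and edge: "\<And>u v. u \<in> (\<Union>n. lev c n) \<Longrightarrow> v \<in> (\<Union>n. lev c n) \<Longrightarrow> {f u, f v} \<in> edges \<longleftrightarrow> {u, v} \<in> edges"
  shows "level_map f"
proof -
  let ?V = "\<Union>n. lev c n"
  have V: "x \<in> ?V" if "x \<in> lev c n" for x n using that by blast
  have inj: "inj_on f ?V" using bij by (rule bij_betw_imp_inj_on)
  have up: "{\<beta>, \<beta>\<^sup>2 + c n} \<in> edges" if "\<beta> \<in> lev c (Suc n)" for \<beta> n
    using that unfolding edges_def by blast
  have z: "0 \<in> ?V" by (rule V[of 0 0]) simp
  \<comment> \<open>The root has two neighbours, any other vertex has three: its parent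
    \<open>?p\<close> and its children \<open>?a\<close> and \<open>?b\<close>.\<close>
  have f0: "f 0 = 0"
  proof (rule ccontr)
    assume n0: "f 0 \<noteq> 0"
    have "f 0 \<in> ?V" using bij z bij_betwE by blast
    then obtain k where k: "f 0 \<in> lev c k" by blast
    then obtain m where m: "f 0 \<in> lev c (Suc m)" using n0 by (cases k) auto
    let ?w = "f 0" and ?m = "Suc m"
    let ?p = "?w\<^sup>2 + c m" and ?a = "rt ?m ?w" and ?b = "- rt ?m ?w"
    have lv: "?p \<in> lev c m" "?a \<in> lev c (Suc ?m)" "?b \<in> lev c (Suc ?m)"
      using m rt_lev[OF m] by auto
    have ne: "?a \<noteq> ?b" using rt_nonzero[OF m] by simp
    have pa: "?p \<noteq> ?a" "?p \<noteq> ?b" using lv lev_eqI[of ?p m "Suc ?m"] by (metis n_not_Suc_n Suc_n_not_le_n le_SucI order_refl)+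
    have sq: "?a\<^sup>2 + c ?m = ?w" "?b\<^sup>2 + c ?m = ?w" by simp_all
    have adj: "{?w, ?p} \<in> edges" "{?w, ?a} \<in> edges" "{?w, ?b} \<in> edges"
      using up[OF m] up[OF lv(2)] up[OF lv(3)] unfolding sq by (simp_all only: insert_commute)
    have pre: "\<exists>x\<in>{rt 0 0, - rt 0 0}. f x = q" if "q \<in> ?V" "{?w, q} \<in> edges" for q
    proof -
      have "q \<in> f ` ?V" using that(1) bij_betw_imp_surj_on[OF bij] by simp
      then obtain x where x: "q = f x" "x \<in> ?V" by (rule imageE)
      then have "{0, x} \<in> edges" using edge[OF z x(2)] that(2) by simp
      from zero_neighbour[OF this] show ?thesis unfolding x(1) by (rule rev_bexI) (rule refl)
    qed
    obtain x1 x2 x3 where "x1 \<in> {rt 0 0, - rt 0 0}" "x2 \<in> {rt 0 0, - rt 0 0}" "x3 \<in> {rt 0 0, - rt 0 0}"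
      "f x1 = ?p" "f x2 = ?a" "f x3 = ?b"
      using pre[OF V[OF lv(1)] adj(1)] pre[OF V[OF lv(2)] adj(2)] pre[OF V[OF lv(3)] adj(3)] by blast
    then show False using ne pa by auto
  qed
  have main: "(\<forall>\<alpha>\<in>lev c n. f \<alpha> \<in> lev c n) \<and> (\<forall>k<n. \<forall>\<beta>\<in>lev c (Suc k). f (\<beta>\<^sup>2 + c k) = (f \<beta>)\<^sup>2 + c k)" for n
  proof (induction n)
    case 0
    then show ?case using f0 by simp
  next
    case (Suc n)
    have "f \<beta> \<in> lev c (Suc n) \<and> f (\<beta>\<^sup>2 + c n) = (f \<beta>)\<^sup>2 + c n" if b: "\<beta> \<in> lev c (Suc n)" for \<beta>
    proof -
      let ?p = "\<beta>\<^sup>2 + c n"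
      have p: "?p \<in> lev c n" using b by simp
      have fp: "f ?p \<in> lev c n" using Suc p by blast
      have "{f \<beta>, f ?p} \<in> edges" using edge[OF V[OF b] V[OF p]] up[OF b] by blast
      then show ?thesis
      proof (rule edge_cases)
        fix k assume k: "f \<beta> \<in> lev c (Suc k)" "f ?p = (f \<beta>)\<^sup>2 + c k"
        then have "f ?p \<in> lev c k" by simp
        then have "k = n" using lev_eqI fp by blast
        then show ?thesis using k by simp
      next
        \<comment> \<open>Here \<open>f \<beta>\<close> would be the parent of \<open>f ?p\<close>.
          That parent is already the image of the parent of \<open>?p\<close>, which injectivity
          would identify with \<beta>, two levels away.\<close>
        fix k assume k: "f ?p \<in> lev c (Suc k)" "f \<beta> = (f ?p)\<^sup>2 + c k"
        then have n: "n = Suc k" using lev_eqI fp by blast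
        then have p': "?p \<in> lev c (Suc k)" using p by simp
        have "f (?p\<^sup>2 + c k) = f \<beta>" using Suc n p' k(2) by (metis lessI)
        moreover have pp: "?p\<^sup>2 + c k \<in> lev c k" using p' by simp
        ultimately have "?p\<^sup>2 + c k = \<beta>" using inj V[OF pp] V[OF b] by (meson inj_onD)
        then have "k = Suc n" using pp b lev_eqI by metis
        then show ?thesis using n by simp
      qed
    qed
    then show ?case using Suc by (auto simp: less_Suc_eq simp del: lev.simps)
  qed
  show ?thesis
    unfolding level_map_def
  proof (intro allI conjI)
    fix n
    show "f ` lev c n \<subseteq> lev c n" using main[of n] by blast
    show "inj_on f (lev c n)" by (rule inj_on_subset[OF inj]) blast
    show "\<forall>\<beta>\<in>lev c (Suc n). f (\<beta>\<^sup>2 + c n) = (f \<beta>)\<^sup>2 + c n" using main[of "Suc n"] by blast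
  qed
qed

lemma level_map_bij:
  assumes f: "level_map f"
  shows "bij_betw f (\<Union>n. lev c n) (\<Union>n. lev c n)"
proof -
  have l: "f ` lev c n \<subseteq> lev c n" "inj_on f (lev c n)" for n
    using f unfolding level_map_def by blast+
  then have s: "f ` lev c n = lev c n" for n by (intro endo_inj_surj) auto
  have "inj_on f (\<Union>n. lev c n)"
  proof (rule inj_onI)
    fix x y assume "x \<in> (\<Union>n. lev c n)" "y \<in> (\<Union>n. lev c n)" and e: "f x = f y"
    then obtain m n where xy: "x \<in> lev c m" "y \<in> lev c n" by blast
    then have "f x \<in> lev c m" "f x \<in> lev c n" using l(1) e by fastforce+
    then have "m = n" by (rule lev_eqI)
    then show "x = y" using xy e l(2) by (meson inj_onD)
  qed
  moreover have "f ` (\<Union>n. lev c n) = (\<Union>n. lev c n)"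
    using s by (simp add: image_UN)
  ultimately show ?thesis unfolding bij_betw_def by blast
qed

lemma level_map_edge:
  assumes f: "level_map f" and uv: "u \<in> (\<Union>n. lev c n)" "v \<in> (\<Union>n. lev c n)"
  shows "{f u, f v} \<in> edges \<longleftrightarrow> {u, v} \<in> edges"
proof -
  have l: "f x \<in> lev c n" if "x \<in> lev c n" for x n
    using f that unfolding level_map_def by blast
  have p: "f (\<beta>\<^sup>2 + c n) = (f \<beta>)\<^sup>2 + c n" if "\<beta> \<in> lev c (Suc n)" for \<beta> n
    using f that unfolding level_map_def by blast
  have inj: "inj_on f (\<Union>n. lev c n)" using level_map_bij[OF f] by (rule bij_betw_imp_inj_on)
  have up: "{\<beta>, \<beta>\<^sup>2 + c n} \<in> edges" if "\<beta> \<in> lev c (Suc n)" for \<beta> n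
    using that unfolding edges_def by blast
  have fwd: "{f a, f (a\<^sup>2 + c n)} \<in> edges" if "a \<in> lev c (Suc n)" for a n
    using up[OF l[OF that]] p[OF that] by simp
  have bwd: "{a, b} \<in> edges"
    if a: "a \<in> (\<Union>n. lev c n)" and b: "b \<in> (\<Union>n. lev c n)" and fa: "f a \<in> lev c (Suc n)" and fb: "f b = (f a)\<^sup>2 + c n" for a b n
  proof -
    obtain k where k: "a \<in> lev c k" using a by blast
    then have "k = Suc n" using l fa lev_eqI by blast
    then have k: "a \<in> lev c (Suc n)" using k by simp
    then have "f b = f (a\<^sup>2 + c n)" using p fb by simp
    moreover have "a\<^sup>2 + c n \<in> (\<Union>n. lev c n)" using k by auto
    ultimately have "b = a\<^sup>2 + c n" using inj b by (meson inj_onD)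
    then show ?thesis using up k by simp
  qed
  show ?thesis
  proof
    assume "{u, v} \<in> edges"
    then show "{f u, f v} \<in> edges"
      by (rule edge_cases) (use fwd in \<open>auto simp: insert_commute simp del: lev.simps\<close>)
  next
    assume "{f u, f v} \<in> edges"
    then show "{u, v} \<in> edges"
    proof (rule edge_cases)
      show "{u, v} \<in> edges" if "f v \<in> lev c (Suc n)" "f u = (f v)\<^sup>2 + c n" for n
        using bwd[OF uv(2,1) that] by (simp only: insert_commute)
    qed (rule bwd[OF uv])
  qed
qed

end

section \<open>Surjectivity of the arboreal representation\<close>

lemma poly_ac_add: "poly_ac (p + q) = poly_ac p + poly_ac q"
  by (rule poly_eqI) (simp add: coeff_map_poly)

lemma poly_ac_mult: "poly_ac (p * q) = poly_ac p * poly_ac q"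
  by (rule poly_eqI) (simp add: coeff_map_poly coeff_mult to_ac_sum)

lemma poly_ac_pcompose: "poly_ac (pcompose p q) = pcompose (poly_ac p) (poly_ac q)"
  by (induction p) (simp_all add: pcompose_pCons map_poly_pCons poly_ac_add poly_ac_mult)

lemma is_subfield_range_to_ac: "is_subfield (range (to_ac :: ratfun \<Rightarrow> _))"
  unfolding is_subfield_def by (auto simp flip: to_ac_minus to_ac_inverse to_ac_add to_ac_mult to_ac_1)

locale arboreal = quadratic_tree "range (to_ac :: ratfun \<Rightarrow> _)" "\<lambda>n. to_ac (a n)" for a +
  fixes \<theta> :: "nat \<Rightarrow> ratfun poly"
  assumes \<theta>_def: "\<theta> = (\<lambda>n. [:a n, 0, 1:])"
begin

abbreviation "c \<equiv> \<lambda>n. to_ac (a n)"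

lemma poly_theta: "poly (poly_ac (\<theta> n)) x = x\<^sup>2 + c n"
  by (simp add: \<theta>_def map_poly_pCons power2_eq_square)

lemma poly_iter_comp: "poly (poly_ac (iter_comp \<theta> n)) x = gam c n x"
  by (induction n arbitrary: x) (simp_all add: map_poly_pCons poly_ac_pcompose poly_pcompose poly_theta)

lemma separable_iter_comp: "separable (iter_comp \<theta> n)"
proof -
  let ?p = "poly_ac (iter_comp \<theta> n)"
  have p: "?p = (\<Prod>\<alpha>\<in>lev c n. [:- \<alpha>, 1:])"
    by (subst poly_eq_poly_eq_iff[symmetric]) (simp add: fun_eq_iff poly_prod poly_iter_comp gam_eq_prod)
  show ?thesis
    unfolding separable_def rsquarefree_roots
  proof (intro allI notI)
    fix x assume x: "poly ?p x = 0 \<and> poly (pderiv ?p) x = 0"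
    then have l: "x \<in> lev c n" by (simp add: poly_iter_comp lev_eq_gam)
    let ?q = "\<Prod>\<alpha>\<in>lev c n - {x}. [:- \<alpha>, 1:]"
    have "?p = [:- x, 1:] * ?q" unfolding p using l by (intro prod.remove) auto
    then have "poly (pderiv ?p) x = poly ?q x"
      by (simp only:) (simp add: pderiv_mult pderiv_pCons del: mult_pCons_left)
    also have "\<dots> \<noteq> 0" by (auto simp: poly_prod prod_zero_iff)
    finally show False using x by simp
  qed
qed

lemma tree_verts_eq: "tree_verts \<theta> = (\<Union>n. lev c n)"
proof -
  have "{\<alpha>. \<exists>m\<ge>1. poly (poly_ac (iter_comp \<theta> m)) \<alpha> = 0} = (\<Union>m\<in>{1..}. lev c m)"
    by (auto simp: poly_iter_comp lev_eq_gam)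
  then have "tree_verts \<theta> = lev c 0 \<union> (\<Union>m\<in>{1..}. lev c m)" unfolding tree_verts_def by simp
  also have "\<dots> = (\<Union>n\<in>insert 0 {1..}. lev c n)" by blast
  also have "insert 0 {1..} = (UNIV :: nat set)" by auto
  finally show ?thesis .
qed

lemma tree_edges_eq: "tree_edges \<theta> = edges"
proof -
  have "tree_edges \<theta> = {{\<alpha>, \<alpha>\<^sup>2 + c (m - 1)} | \<alpha> m. m \<ge> 1 \<and> \<alpha> \<in> lev c m}"
    unfolding tree_edges_def poly_theta poly_iter_comp lev_eq_gam by simp
  also have "\<dots> = edges"
    unfolding edges_def
  proof (intro Set.set_eqI iffI)
    fix e assume "e \<in> {{\<alpha>, \<alpha>\<^sup>2 + c (m - 1)} | \<alpha> m. m \<ge> 1 \<and> \<alpha> \<in> lev c m}"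
    then obtain \<alpha> m where *: "e = {\<alpha>, \<alpha>\<^sup>2 + c (m - 1)}" "m \<ge> 1" "\<alpha> \<in> lev c m" by blast
    then obtain n where "m = Suc n" by (cases m) auto
    then show "e \<in> {{\<beta>, \<beta>\<^sup>2 + c n} | \<beta> n. \<beta> \<in> lev c (Suc n)}" using * by auto
  next
    fix e assume "e \<in> {{\<beta>, \<beta>\<^sup>2 + c n} | \<beta> n. \<beta> \<in> lev c (Suc n)}"
    then obtain \<beta> n where "e = {\<beta>, \<beta>\<^sup>2 + c (Suc n - 1)}" "\<beta> \<in> lev c (Suc n)" by auto
    then show "e \<in> {{\<alpha>, \<alpha>\<^sup>2 + c (m - 1)} | \<alpha> m. m \<ge> 1 \<and> \<alpha> \<in> lev c m}"
      by (metis (mono_tags, lifting) One_nat_def Suc_le_mono le0 mem_Collect_eq)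
  qed
  finally show ?thesis .
qed

lemma K_lev_eq: "K_lev \<theta> n = Kl n"
  unfolding K_lev_def splitting_field_def Kl_def poly_iter_comp lev_eq_gam ..

lemma Gal_iff: "\<sigma> \<in> Gal (Kl n) \<longleftrightarrow> gal n \<sigma> \<and> \<sigma> \<in> extensional (Kl n)"
proof
  assume s: "\<sigma> \<in> Gal (Kl n)"
  then have "\<sigma> \<in> ring_hom (subfield_ring (Kl n)) (subfield_ring (Kl n))"
    unfolding Gal_def ring_iso_def by blast
  then have "fhom (Kl n) \<sigma>"
    unfolding fhom_def ring_hom_def subfield_ring_def by auto
  then show "gal n \<sigma> \<and> \<sigma> \<in> extensional (Kl n)"
    using s unfolding gal_def Gal_def by auto
next
  assume s: "gal n \<sigma> \<and> \<sigma> \<in> extensional (Kl n)"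
  then have f: "fhom (Kl n) \<sigma>" and im: "\<sigma> ` Kl n = Kl n" and i: "inj_on \<sigma> (Kl n)"
    using gal_image gal_inj unfolding gal_def by blast+
  have "\<sigma> \<in> ring_hom (subfield_ring (Kl n)) (subfield_ring (Kl n))"
    using f im unfolding fhom_def ring_hom_def subfield_ring_def by auto
  moreover have "bij_betw \<sigma> (Kl n) (Kl n)" using im i unfolding bij_betw_def by blast
  ultimately show "\<sigma> \<in> Gal (Kl n)"
    using s unfolding Gal_def ring_iso_def gal_def by (auto simp: subfield_ring_def)
qed

lemma Aut_tree_iff: "f \<in> Aut_tree \<theta> \<longleftrightarrow> f \<in> extensional (\<Union>n. lev c n) \<and> level_map f"
  unfolding Aut_tree_def tree_verts_eq tree_edges_eq mem_Collect_eq
  using edge_iff_level_map[of f] level_map_bij[of f] level_map_edge[of f] by blast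

lemma Gal_limD:
  assumes "\<sigma> \<in> Gal_lim \<theta>"
  shows "gal n (\<sigma> n)" "m \<le> n \<Longrightarrow> x \<in> Kl m \<Longrightarrow> \<sigma> n x = \<sigma> m x"
proof -
  show "gal n (\<sigma> n)" using assms Gal_iff unfolding Gal_lim_def K_lev_eq by blast
  assume "m \<le> n" "x \<in> Kl m"
  moreover have "restrict (\<sigma> n) (Kl m) = \<sigma> m" if "m \<le> n"
    using assms that unfolding Gal_lim_def K_lev_eq by blast
  ultimately show "\<sigma> n x = \<sigma> m x" by (metis restrict_apply')
qed

lemma tree_action_eq:
  assumes s: "\<sigma> \<in> Gal_lim \<theta>" and a: "\<alpha> \<in> lev c n"
  shows "tree_action \<theta> \<sigma> \<alpha> = \<sigma> n \<alpha>"
proof -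
  let ?m = "LEAST m. \<alpha> \<in> Kl m"
  have n: "\<alpha> \<in> Kl n" using a lev_Kl by blast
  have "?m \<le> n" "\<alpha> \<in> Kl ?m" using n by (rule Least_le, rule LeastI)
  then have "\<sigma> n \<alpha> = \<sigma> ?m \<alpha>" by (rule Gal_limD(2)[OF s])
  moreover have "\<alpha> \<in> tree_verts \<theta>" using a unfolding tree_verts_eq by blast
  ultimately show ?thesis unfolding tree_action_def K_lev_eq by simp
qed

lemma tree_action_Aut:
  assumes s: "\<sigma> \<in> Gal_lim \<theta>"
  shows "tree_action \<theta> \<sigma> \<in> Aut_tree \<theta>"
  unfolding Aut_tree_iff
proof
  show "tree_action \<theta> \<sigma> \<in> extensional (\<Union>n. lev c n)"
    unfolding tree_action_def tree_verts_eq by simp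
  show "level_map (tree_action \<theta> \<sigma>)"
    unfolding level_map_def
  proof (intro allI conjI)
    fix n
    note g = Gal_limD(1)[OF s]
    note e = tree_action_eq[OF s]
    show "tree_action \<theta> \<sigma> ` lev c n \<subseteq> lev c n"
      using gal_lev_mem[OF g order_refl] e by (auto simp del: lev.simps)
    have "inj_on (\<sigma> n) (lev c n)" using gal_inj[OF g] lev_Kl by (rule inj_on_subset)
    then show "inj_on (tree_action \<theta> \<sigma>) (lev c n)"
      using inj_on_cong[of "lev c n" "tree_action \<theta> \<sigma>" "\<sigma> n"] e by blast
    show "\<forall>\<beta>\<in>lev c (Suc n). tree_action \<theta> \<sigma> (\<beta>\<^sup>2 + c n) = (tree_action \<theta> \<sigma> \<beta>)\<^sup>2 + c n"
    proof
      fix \<beta> assume b: "\<beta> \<in> lev c (Suc n)"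
      then have p: "\<beta>\<^sup>2 + c n \<in> lev c n" by simp
      have bK: "\<beta> \<in> Kl (Suc n)" using b lev_Kl by blast
      have "tree_action \<theta> \<sigma> (\<beta>\<^sup>2 + c n) = \<sigma> (Suc n) (\<beta>\<^sup>2 + c n)"
        using e[OF p] Gal_limD(2)[OF s, of n "Suc n" "\<beta>\<^sup>2 + c n"] p lev_Kl[of n] by auto
      also have "\<dots> = (\<sigma> (Suc n) \<beta>)\<^sup>2 + c n"
        using gal_simps(1)[OF g Kl_closed(9)[OF bK] c_Kl] gal_simps(5)[OF g bK] gal_simps(9)[OF g] by simp
      finally show "tree_action \<theta> \<sigma> (\<beta>\<^sup>2 + c n) = (tree_action \<theta> \<sigma> \<beta>)\<^sup>2 + c n"
        unfolding e[OF b] .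
    qed
  qed
qed

lemma level_map_cong:
  assumes "\<And>\<alpha> n. \<alpha> \<in> lev c n \<Longrightarrow> f \<alpha> = g \<alpha>" and f: "level_map f"
  shows "level_map g"
  unfolding level_map_def
proof (intro allI conjI)
  fix n
  show "g ` lev c n \<subseteq> lev c n" using f assms(1) unfolding level_map_def by (metis image_cong)
  have "inj_on f (lev c n)" using f unfolding level_map_def by blast
  then show "inj_on g (lev c n)" using inj_on_cong[of "lev c n" f g] assms(1) by blast
  show "\<forall>\<beta>\<in>lev c (Suc n). g (\<beta>\<^sup>2 + c n) = (g \<beta>)\<^sup>2 + c n"
  proof
    fix \<beta> assume b: "\<beta> \<in> lev c (Suc n)"
    then have p: "\<beta>\<^sup>2 + c n \<in> lev c n" by simp
    have "f (\<beta>\<^sup>2 + c n) = (f \<beta>)\<^sup>2 + c n" using f b unfolding level_map_def by blast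
    then show "g (\<beta>\<^sup>2 + c n) = (g \<beta>)\<^sup>2 + c n" using assms(1)[OF b] assms(1)[OF p] by simp
  qed
qed

text \<open>The implication from right to left yields surjectivity for good first maps; the converse
  serves to describe \<open>SurArb\<close> exactly and so to prove it measurable.\<close>

lemma arboreal_surjective_iff:
  "tree_action \<theta> ` Gal_lim \<theta> = Aut_tree \<theta> \<longleftrightarrow>
     (\<forall>I y. finite I \<longrightarrow> I \<noteq> {} \<longrightarrow> y \<in> range to_ac \<longrightarrow> y\<^sup>2 \<noteq> (\<Prod>i\<in>I. crit_prod i))"
proof
  assume eq: "tree_action \<theta> ` Gal_lim \<theta> = Aut_tree \<theta>"
  have "\<exists>\<sigma>. gal n \<sigma> \<and> (\<forall>k\<le>n. \<forall>\<alpha>\<in>lev c k. \<sigma> \<alpha> = f \<alpha>)" if f: "level_map f" for f n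
  proof -
    \<comment> \<open>\<open>Aut_tree\<close> consists of extensional functions, whereas a level map
      is arbitrary off the tree.\<close>
    let ?g = "restrict f (\<Union>n. lev c n)"
    have r: "?g \<alpha> = f \<alpha>" if "\<alpha> \<in> lev c n" for \<alpha> n using that by auto
    then have "level_map ?g" using level_map_cong[of f ?g] f by metis
    then have "?g \<in> Aut_tree \<theta>" unfolding Aut_tree_iff by simp
    then obtain \<sigma> where s: "\<sigma> \<in> Gal_lim \<theta>" "?g = tree_action \<theta> \<sigma>" unfolding eq[symmetric] by blast
    have "\<sigma> n \<alpha> = f \<alpha>" if "k \<le> n" "\<alpha> \<in> lev c k" for k \<alpha>
      using Gal_limD(2)[OF s(1) that(1), of \<alpha>] tree_action_eq[OF s(1) that(2)] s(2) r[OF that(2)]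
        that(2) lev_Kl[of k] by auto
    then show ?thesis using Gal_limD(1)[OF s(1)] by blast
  qed
  from crit_prods_independent[OF this]
  show "\<forall>I y. finite I \<longrightarrow> I \<noteq> {} \<longrightarrow> y \<in> range to_ac \<longrightarrow> y\<^sup>2 \<noteq> (\<Prod>i\<in>I. crit_prod i)"
    by blast
next
  assume "\<forall>I y. finite I \<longrightarrow> I \<noteq> {} \<longrightarrow> y \<in> range to_ac \<longrightarrow> y\<^sup>2 \<noteq> (\<Prod>i\<in>I. crit_prod i)"
  then have ind: "indep n" for n by (intro indep_all) blast
  show "tree_action \<theta> ` Gal_lim \<theta> = Aut_tree \<theta>"
  proof
    show "tree_action \<theta> ` Gal_lim \<theta> \<subseteq> Aut_tree \<theta>" using tree_action_Aut by blast
    show "Aut_tree \<theta> \<subseteq> tree_action \<theta> ` Gal_lim \<theta>"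
    proof
      fix f assume "f \<in> Aut_tree \<theta>"
      then have f: "f \<in> extensional (\<Union>n. lev c n)" "level_map f" unfolding Aut_tree_iff by auto
      obtain \<sigma> where s: "\<And>n. gal n (\<sigma> n)" "\<And>n \<alpha>. \<alpha> \<in> lev c n \<Longrightarrow> \<sigma> n \<alpha> = f \<alpha>"
        "\<And>n x. x \<in> Kl n \<Longrightarrow> \<sigma> (Suc n) x = \<sigma> n x"
        using level_map_realized[OF ind f(2)] by blast
      have mono: "\<sigma> n x = \<sigma> m x" if "m \<le> n" "x \<in> Kl m" for m n x
        using that(1)
      proof (induction n rule: dec_induct)
        case (step n)
        then show ?case using s(3)[of x n] Kl_mono[of m n] that(2) by auto
      qed simp
      define \<tau> where "\<tau> n = restrict (\<sigma> n) (Kl n)" for n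
      have "gal n (\<tau> n)" for n
        using s(1)[of n] Kl_closed(2,5,7) subsetD[OF K_Kl, of _ n] unfolding gal_def fhom_def \<tau>_def by simp
      then have "\<tau> n \<in> Gal (Kl n)" for n unfolding Gal_iff by (simp add: \<tau>_def)
      moreover have "restrict (\<tau> n) (Kl m) = \<tau> m" if "m \<le> n" for m n
        using mono[OF that] subsetD[OF Kl_mono[OF that]] by (simp add: \<tau>_def restrict_def fun_eq_iff)
      ultimately have t: "\<tau> \<in> Gal_lim \<theta>" unfolding Gal_lim_def K_lev_eq by blast
      have "tree_action \<theta> \<tau> \<alpha> = f \<alpha>" if "\<alpha> \<in> lev c n" for \<alpha> n
        using tree_action_eq[OF t that] s(2)[OF that] that lev_Kl[of n] by (auto simp: \<tau>_def)
      then have "tree_action \<theta> \<tau> \<alpha> = f \<alpha>" if "\<alpha> \<in> (\<Union>n. lev c n)" for \<alpha> using that by blast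
      moreover have "tree_action \<theta> \<tau> \<in> extensional (\<Union>n. lev c n)"
        using tree_action_Aut[OF t] unfolding Aut_tree_iff by blast
      ultimately have "tree_action \<theta> \<tau> = f" using f(1) by (intro extensionalityI)
      then show "f \<in> tree_action \<theta> ` Gal_lim \<theta>" using t by blast
    qed
  qed
qed

end

section \<open>Integral elements and the prime 2\<close>

abbreviation ratf :: "int poly \<Rightarrow> ratfun" where
  "ratf \<equiv> ratfun_of_int_poly"

definition ac :: "int poly \<Rightarrow> ratfun alg_closure" where
  "ac p = to_ac (ratf p)"

lemma map_poly_of_int_add: "map_poly rat_of_int (p + q) = map_poly rat_of_int p + map_poly rat_of_int q"
  by (rule poly_eqI) (simp add: coeff_map_poly)

lemma map_poly_of_int_mult: "map_poly rat_of_int (p * q) = map_poly rat_of_int p * map_poly rat_of_int q"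
  by (rule poly_eqI) (simp add: coeff_map_poly coeff_mult)

lemma ratf_add: "ratf (p + q) = ratf p + ratf q"
  by (simp add: ratfun_of_int_poly_def map_poly_of_int_add)

lemma ratf_mult: "ratf (p * q) = ratf p * ratf q"
  by (simp add: ratfun_of_int_poly_def map_poly_of_int_mult)

lemma ratf_1: "ratf 1 = 1"
  by (simp add: ratfun_of_int_poly_def One_fract_def map_poly_1 one_pCons[symmetric])

lemma ratf_0: "ratf 0 = 0"
  by (simp add: ratfun_of_int_poly_def Zero_fract_def)

lemma ratf_eq_0_iff: "ratf p = 0 \<longleftrightarrow> p = 0"
  by (auto simp: ratfun_of_int_poly_def Zero_fract_def eq_fract map_poly_eq_0_iff)

lemma ratf_minus: "ratf (- p) = - ratf p"
  using ratf_add[of p "- p"] by (simp add: ratf_0 eq_neg_iff_add_eq_0 add.commute)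

lemma ratf_eq_iff: "ratf p = ratf q \<longleftrightarrow> p = q"
  using ratf_eq_0_iff[of "p - q"] ratf_add[of p "- q"] by (simp add: ratf_minus)

lemma ratf_prod: "ratf (prod f A) = (\<Prod>i\<in>A. ratf (f i))"
  by (induction A rule: infinite_finite_induct) (auto simp: ratf_1 ratf_mult)

lemma ratf_power: "ratf (p ^ n) = ratf p ^ n"
  by (induction n) (auto simp: ratf_1 ratf_mult)

lemma ratf_2: "ratf 2 = 2"
  using ratf_add[of 1 1] by (simp add: ratf_1)

lemmas ratf_simps = ratf_add ratf_mult ratf_1 ratf_0 ratf_minus ratf_power ratf_2

lemma ac_simps:
  "ac (p + q) = ac p + ac q" "ac (p * q) = ac p * ac q" "ac 1 = 1" "ac 0 = 0" "ac (- p) = - ac p"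
  "ac (p ^ n) = ac p ^ n" "ac 2 = 2"
  by (simp_all add: ac_def ratf_simps)

lemma ac_eq_0_iff: "ac p = 0 \<longleftrightarrow> p = 0"
  by (simp add: ac_def ratf_eq_0_iff)

lemma clear_denominators_rat_poly:
  "\<exists>D z. D \<noteq> 0 \<and> Polynomial.smult (rat_of_int D) p = map_poly rat_of_int z"
proof (induction p)
  case 0
  show ?case by (rule exI[of _ 1], rule exI[of _ 0]) simp
next
  case (pCons a p)
  then obtain D z where D: "D \<noteq> 0" "Polynomial.smult (rat_of_int D) p = map_poly rat_of_int z" by blast
  obtain u v where uv: "quotient_of a = (u, v)" by (cases "quotient_of a")
  then have v: "v > 0" "a = of_int u / of_int v"
    using quotient_of_denom_pos quotient_of_div by blast+
  have "Polynomial.smult (rat_of_int (D * v)) (pCons a p) = map_poly rat_of_int (pCons (D * u) (Polynomial.smult v z))"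
  proof -
    have "Polynomial.smult (rat_of_int (D * v)) p = Polynomial.smult (rat_of_int v) (map_poly rat_of_int z)"
      unfolding D(2)[symmetric] by (simp add: mult.commute)
    also have "\<dots> = map_poly rat_of_int (Polynomial.smult v z)"
      by (rule poly_eqI) (simp add: coeff_map_poly)
    finally show ?thesis using v by (simp add: map_poly_pCons)
  qed
  moreover have "D * v \<noteq> 0" using D v by simp
  ultimately show ?case by blast
qed

lemma clear_denominators: "\<exists>b z. b \<noteq> 0 \<and> ratf b * u = ratf z"
proof -
  obtain p q where u: "u = Fraction_Field.Fract p q" "q \<noteq> 0" by (cases u) auto
  obtain D z where D: "D \<noteq> 0" "Polynomial.smult (rat_of_int D) p = map_poly rat_of_int z"
    using clear_denominators_rat_poly by blast
  obtain E w where E: "E \<noteq> 0" "Polynomial.smult (rat_of_int E) q = map_poly rat_of_int w"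
    using clear_denominators_rat_poly by blast
  have sm: "map_poly rat_of_int (Polynomial.smult k x) = Polynomial.smult (rat_of_int k) (map_poly rat_of_int x)" for k x
    by (rule poly_eqI) (simp add: coeff_map_poly)
  let ?b = "Polynomial.smult D w" and ?z = "Polynomial.smult E z"
  have "map_poly rat_of_int w \<noteq> 0" using E u(2) by (metis of_int_eq_0_iff smult_eq_0_iff)
  then have "?b \<noteq> 0" using D by auto
  moreover have "ratf ?b * u = ratf ?z"
    unfolding ratfun_of_int_poly_def u(1) sm D(2)[symmetric] E(2)[symmetric]
    using u(2) by (simp add: eq_fract mult.commute[of p q] mult.commute[of "rat_of_int D"])
  ultimately show ?thesis by blast
qed

definition flin :: "(ratfun alg_closure \<Rightarrow> ratfun) \<Rightarrow> bool" where
  "flin l \<longleftrightarrow> (\<forall>x y. l (x + y) = l x + l y) \<and> (\<forall>a x. l (to_ac a * x) = a * l x)"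

lemma flin_mult: "flin l \<Longrightarrow> flin (\<lambda>x. l (y * x))"
  unfolding flin_def by (metis distrib_left mult.left_commute)

text \<open>A linear retraction of the algebraic closure onto \<open>\<rat>(t)\<close>, obtained by
  extending from the independent set \<open>{1}\<close>. It turns equations in the closure into
  equations between rational functions.\<close>

lemma flin_exists: "\<exists>l. flin l \<and> l 1 = 1"
proof -
  interpret vs1: vector_space "\<lambda>a x. to_ac (a::ratfun) * x"
    by unfold_locales (simp_all add: algebra_simps)
  interpret vs2: vector_space "(*) :: ratfun \<Rightarrow> ratfun \<Rightarrow> ratfun"
    by unfold_locales (simp_all add: algebra_simps)
  interpret vp: vector_space_pair "\<lambda>a x. to_ac (a::ratfun) * x" "(*) :: ratfun \<Rightarrow> ratfun \<Rightarrow> ratfun"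
    by unfold_locales
  have "vs1.independent {1}" by (simp add: vs1.dependent_single)
  then obtain g where g: "Vector_Spaces.linear (\<lambda>a x. to_ac (a::ratfun) * x) (*) g" "g 1 = (1::ratfun)"
    using vp.linear_independent_extend[of "{1}" "\<lambda>_. 1"] by auto
  then have "flin g" unfolding flin_def
    using Vector_Spaces.linear.axioms(3)[OF g(1)] by (simp add: module_hom_def module_hom_axioms_def)
  then show ?thesis using g(2) by blast
qed

text \<open>
  A substitute for rings that are finite over \<open>\<int>[t]\<close>: under every linear functional to \<open>\<rat>(t)\<close> the
  denominators are bounded. It yields \<open>integrality_2\<close> without any theory of integral closure.
\<close>

definition fin_ring :: "ratfun alg_closure set \<Rightarrow> bool" where
  "fin_ring M \<longleftrightarrow> range ac \<subseteq> M \<and> (\<forall>x\<in>M. \<forall>y\<in>M. x + y \<in> M \<and> x * y \<in> M) \<and>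
     (\<forall>l. flin l \<longrightarrow> (\<exists>b. b \<noteq> 0 \<and> (\<forall>x\<in>M. ratf b * l x \<in> range ratf)))"

lemma fin_ring_closed:
  assumes "fin_ring M"
  shows "ac p \<in> M" "x \<in> M \<Longrightarrow> y \<in> M \<Longrightarrow> x + y \<in> M" "x \<in> M \<Longrightarrow> y \<in> M \<Longrightarrow> x * y \<in> M"
    "x \<in> M \<Longrightarrow> - x \<in> M" "x \<in> M \<Longrightarrow> y \<in> M \<Longrightarrow> x - y \<in> M" "x \<in> M \<Longrightarrow> x ^ k \<in> M"
    "2 \<in> M" "1 \<in> M" "0 \<in> M"
proof -
  show a: "ac p \<in> M" for p using assms unfolding fin_ring_def by blast
  show p: "x \<in> M \<Longrightarrow> y \<in> M \<Longrightarrow> x + y \<in> M" for x y using assms unfolding fin_ring_def by blast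
  show m: "x \<in> M \<Longrightarrow> y \<in> M \<Longrightarrow> x * y \<in> M" for x y using assms unfolding fin_ring_def by blast
  show n: "x \<in> M \<Longrightarrow> - x \<in> M" for x using m[OF a[of "- 1"], of x] by (simp add: ac_simps)
  show "x \<in> M \<Longrightarrow> y \<in> M \<Longrightarrow> x - y \<in> M" using p[of x "- y"] n by simp
  show "1 \<in> M" "2 \<in> M" "0 \<in> M" using a[of 1] a[of 2] a[of 0] by (simp_all add: ac_simps)
  then show "x \<in> M \<Longrightarrow> x ^ k \<in> M" using m by (induction k) auto
qed

lemma fin_ring_base: "fin_ring (range ac)"
  unfolding fin_ring_def
proof (intro conjI ballI allI impI)
  fix l assume l: "flin l"
  obtain b z where b: "b \<noteq> 0" "ratf b * l 1 = ratf z" using clear_denominators by blast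
  have "ratf b * l (ac p) = ratf (p * z)" for p
  proof -
    have "l (ac p) = ratf p * l 1" using l unfolding flin_def ac_def by (metis mult.right_neutral)
    then show ?thesis using b(2) by (simp add: ratf_mult algebra_simps)
  qed
  then show "\<exists>b. b \<noteq> 0 \<and> (\<forall>x\<in>range ac. ratf b * l x \<in> range ratf)" using b(1) by auto
qed (auto simp flip: ac_simps)

lemma fin_ring_adjoin_sqrt:
  assumes M: "fin_ring M" and a: "\<alpha>\<^sup>2 \<in> M"
  shows "\<exists>M'. fin_ring M' \<and> \<alpha> \<in> M'"
proof -
  note c = fin_ring_closed[OF M]
  let ?M' = "{x + \<alpha> * y | x y. x \<in> M \<and> y \<in> M}"
  have I: "x + \<alpha> * y \<in> ?M'" if "x \<in> M" "y \<in> M" for x y using that by blast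
  have "fin_ring ?M'"
    unfolding fin_ring_def
  proof (intro conjI ballI allI impI)
    show "range ac \<subseteq> ?M'" using I[OF c(1) c(9)] by auto
  next
    fix u v assume "u \<in> ?M'" "v \<in> ?M'"
    then obtain x y x' y' where u: "u = x + \<alpha> * y" "x \<in> M" "y \<in> M" and v: "v = x' + \<alpha> * y'" "x' \<in> M" "y' \<in> M"
      by blast
    have "u + v = (x + x') + \<alpha> * (y + y')" by (simp add: u v algebra_simps)
    moreover have "\<dots> \<in> ?M'" using u v by (intro I c(2))
    ultimately show "u + v \<in> ?M'" by simp
    have "u * v = (x * x' + \<alpha>\<^sup>2 * (y * y')) + \<alpha> * (x * y' + y * x')"
      by (simp add: u v algebra_simps power2_eq_square)
    moreover have "\<dots> \<in> ?M'" using u v by (intro I c(2,3) a)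
    ultimately show "u * v \<in> ?M'" by simp
  next
    fix l assume l: "flin l"
    obtain b where b: "b \<noteq> 0" "\<forall>x\<in>M. ratf b * l x \<in> range ratf"
      using M l unfolding fin_ring_def by blast
    \<comment> \<open>This is why \<open>fin_ring\<close> quantifies over all functionals: it is
      applied here to multiplication by \<alpha> followed by \<open>l\<close>.\<close>
    obtain b' where b': "b' \<noteq> 0" "\<forall>x\<in>M. ratf b' * l (\<alpha> * x) \<in> range ratf"
      using M flin_mult[OF l, of \<alpha>] unfolding fin_ring_def by blast
    have "ratf (b * b') * l z \<in> range ratf" if "z \<in> ?M'" for z
    proof -
      obtain x y where z: "z = x + \<alpha> * y" "x \<in> M" "y \<in> M" using \<open>z \<in> ?M'\<close> by blast
      obtain p q where "ratf b * l x = ratf p" "ratf b' * l (\<alpha> * y) = ratf q"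
        using b(2) b'(2) z by blast
      moreover have "l z = l x + l (\<alpha> * y)" using l z(1) unfolding flin_def by blast
      ultimately have "ratf (b * b') * l z = ratf (b' * p + b * q)"
        by (simp add: ratf_simps algebra_simps)
      then show ?thesis by blast
    qed
    moreover have "b * b' \<noteq> 0" using b b' by simp
    ultimately show "\<exists>b. b \<noteq> 0 \<and> (\<forall>x\<in>?M'. ratf b * l x \<in> range ratf)" by blast
  qed
  moreover have "\<alpha> \<in> ?M'" using I[OF c(9,8)] by simp
  ultimately show ?thesis by blast
qed

lemma fin_ring_lev: "\<alpha> \<in> lev (\<lambda>n. ac (e n)) m \<Longrightarrow> \<exists>M. fin_ring M \<and> \<alpha> \<in> M"
proof (induction m arbitrary: \<alpha>)
  case 0
  then show ?case using fin_ring_base fin_ring_closed(9) by auto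
next
  case (Suc m)
  then obtain M where M: "fin_ring M" "\<alpha>\<^sup>2 + ac (e m) \<in> M" by auto
  then have "(\<alpha>\<^sup>2 + ac (e m)) - ac (e m) \<in> M" by (intro fin_ring_closed(1,5))
  then show ?case using fin_ring_adjoin_sqrt[OF M(1)] by simp
qed

section \<open>Integrality at the prime 2\<close>

lemma two_eq_const: "(2 :: int poly) = [:2:]"
  by (simp add: numeral_poly)

lemma prime_elem_2: "prime_elem (2 :: int poly)"
  unfolding two_eq_const prime_elem_const_poly_iff by simp

lemma two_power_dvd_imp_0:
  assumes "\<And>j. (2 :: int poly) ^ j dvd b"
  shows "b = 0"
proof (rule ccontr)
  assume "b \<noteq> 0"
  then have "finite {j. (2::int poly) ^ j dvd b}"
    by (rule finite_divisor_powers) (simp add: two_eq_const is_unit_const_poly_iff)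
  moreover have "{j. (2::int poly) ^ j dvd b} = UNIV" using assms by auto
  ultimately show False by simp
qed

text \<open>All powers of \<open>q / 2\<close> lie in \<open>M\<close>, so one nonzero
  \<open>B\<close> makes \<open>2 ^ j\<close> divide \<open>B * q ^ j\<close> for every
  \<open>j\<close>. If the prime 2 did not divide \<open>q\<close>, every power of 2 would divide
  \<open>B\<close>.\<close>

lemma integrality_2:
  assumes M: "fin_ring M" and b: "b \<in> M" and q: "ac q = 2 * b"
  shows "2 dvd q"
proof (rule ccontr)
  assume n2: "\<not> 2 dvd q"
  obtain l where l: "flin l" "l 1 = 1" using flin_exists by blast
  obtain B where B: "B \<noteq> 0" "\<forall>x\<in>M. ratf B * l x \<in> range ratf"
    using M l(1) unfolding fin_ring_def by blast
  have la: "l (ac p * x) = ratf p * l x" for p x using l(1) unfolding flin_def ac_def by blast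
  have "2 ^ j dvd B" for j
  proof -
    have "b ^ j \<in> M" using b by (intro fin_ring_closed[OF M])
    then obtain z where z: "ratf B * l (b ^ j) = ratf z" using B(2) by blast
    have "ac (q ^ j) * 1 = ac (2 ^ j) * b ^ j" by (simp add: ac_simps q power_mult_distrib)
    then have "ratf (q ^ j) = ratf (2 ^ j) * l (b ^ j)" using la l(2) by (metis mult.right_neutral)
    then have "ratf (B * q ^ j) = ratf (2 ^ j * z)" using z by (simp add: ratf_mult)
    then have "2 ^ j dvd B * q ^ j" unfolding ratf_eq_iff by simp
    moreover have "coprime (2 ^ j) (q ^ j)"
      using prime_elem_imp_coprime[OF prime_elem_2 n2] by simp
    ultimately show ?thesis by (simp add: coprime_dvd_mult_left_iff)
  qed
  then show False using two_power_dvd_imp_0 B(1) by blast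
qed

lemma gam_add: "gam e (k + m) x = gam e k (gam (\<lambda>i. e (k + i)) m x)"
  by (induction m arbitrary: x) simp_all

lemma gam_Suc_left: "gam e (Suc m) x = (gam (\<lambda>i. e (Suc i)) m x)\<^sup>2 + e 0"
  using gam_add[of e 1 m x] by simp

lemma gam_ac: "gam (\<lambda>n. ac (e n)) n (ac x) = ac (gam e n x)"
  by (induction n arbitrary: x) (simp_all flip: ac_simps)

text \<open>With coefficients 0 and 1 the representative of a residue class is either 0 or monic, so
  degree arguments apply to it.\<close>

definition mod_two :: "int poly \<Rightarrow> int poly" where
  "mod_two v = map_poly (\<lambda>a. a mod 2) v"

lemma mod_two:
  obtains w where "v = mod_two v + 2 * w"
proof -
  have "v = mod_two v + 2 * map_poly (\<lambda>a. a div 2) v"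
    by (rule poly_eqI) (simp add: mod_two_def coeff_map_poly two_eq_const)
  then show ?thesis using that by blast
qed

lemma lead_coeff_mod_two: "mod_two v \<noteq> 0 \<Longrightarrow> Polynomial.lead_coeff (mod_two v) = 1"
proof -
  assume "mod_two v \<noteq> 0"
  then have "Polynomial.lead_coeff (mod_two v) \<noteq> 0" by simp
  moreover have "Polynomial.lead_coeff (mod_two v) \<in> {0, 1}"
    by (simp add: mod_two_def coeff_map_poly) presburger
  ultimately show ?thesis by auto
qed

lemma two_dvd_coeff: "(2::int poly) dvd p \<Longrightarrow> 2 dvd Polynomial.coeff p i"
  unfolding two_eq_const by (simp add: const_poly_dvd_iff)

text \<open>Modulo 4 the square of \<open>y\<close> depends only on \<open>y\<close> modulo 2, so
  \<open>y\<close> can be replaced by \<open>z\<close>, which is 0 or monic. Then the leading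
  coefficient of \<open>z\<^sup>2 + e\<close> is 1, or 2 if the degrees agree, and never divisible
  by 4.\<close>

lemma four_not_dvd:
  assumes e: "Polynomial.lead_coeff (e :: int poly) = 1" "Polynomial.degree e > 0"
  shows "\<not> 4 dvd y\<^sup>2 + e"
proof
  assume "4 dvd y\<^sup>2 + e"
  define z where "z = mod_two y"
  obtain w where w: "y = z + 2 * w" unfolding z_def using mod_two by blast
  have "y\<^sup>2 + e = (z\<^sup>2 + e) + 4 * (z * w + w\<^sup>2)" by (simp add: w algebra_simps power2_eq_square)
  then have "4 dvd z\<^sup>2 + e" using \<open>4 dvd y\<^sup>2 + e\<close> by (metis dvd_add_left_iff dvd_triv_left)
  then have d: "[:4:] dvd z\<^sup>2 + e" by (simp add: numeral_poly)
  then have c: "4 dvd Polynomial.coeff (z\<^sup>2 + e) i" for i by (simp add: const_poly_dvd_iff)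
  show False
  proof (cases "z = 0")
    case True
    then show False using c[of "Polynomial.degree e"] e by simp
  next
    case False
    then have l: "Polynomial.lead_coeff (z\<^sup>2) = 1"
      using lead_coeff_mod_two[of y] by (simp add: z_def Polynomial.lead_coeff_power)
    consider "Polynomial.degree (z\<^sup>2) < Polynomial.degree e" | "Polynomial.degree (z\<^sup>2) = Polynomial.degree e"
      | "Polynomial.degree (z\<^sup>2) > Polynomial.degree e" by linarith
    then show False
    proof cases
      case 1
      then show False using c[of "Polynomial.degree e"] e by (simp add: coeff_eq_0)
    next
      case 2
      then show False using c[of "Polynomial.degree e"] e l by simp
    next
      case 3
      then show False using c[of "Polynomial.degree (z\<^sup>2)"] e l by (simp add: coeff_eq_0)
    qed
  qed
qed

section \<open>Congruences modulo 2 and 4 for compositions\<close>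

context
  fixes M assumes M: "fin_ring M"
begin

lemma freshman:
  assumes "x \<in> M" "y \<in> M"
  shows "\<exists>b\<in>M. (x + y) ^ 2 ^ m = x ^ 2 ^ m + y ^ 2 ^ m + 2 * b"
proof (induction m)
  case 0
  then show ?case using fin_ring_closed(9)[OF M] by (intro bexI[of _ 0]) simp_all
next
  case (Suc m)
  then obtain b where b: "b \<in> M" "(x + y) ^ 2 ^ m = x ^ 2 ^ m + y ^ 2 ^ m + 2 * b" by blast
  define u where "u = x ^ 2 ^ m"
  define v where "v = y ^ 2 ^ m"
  have uv: "u \<in> M" "v \<in> M" unfolding u_def v_def using assms by (simp_all add: fin_ring_closed[OF M])
  have "(x + y) ^ 2 ^ Suc m = ((x + y) ^ 2 ^ m)\<^sup>2" by (simp add: power_mult[symmetric] mult.commute)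
  also have "\<dots> = (u + v + 2 * b)\<^sup>2" unfolding b(2) u_def v_def ..
  also have "\<dots> = u\<^sup>2 + v\<^sup>2 + 2 * (u * v + 2 * (b * b) + 2 * (b * (u + v)))"
    by (simp add: algebra_simps power2_eq_square)
  also have "u\<^sup>2 = x ^ 2 ^ Suc m" by (simp add: u_def power_mult[symmetric] mult.commute)
  also have "v\<^sup>2 = y ^ 2 ^ Suc m" by (simp add: v_def power_mult[symmetric] mult.commute)
  finally show ?case using uv b(1) by (intro bexI) (assumption, intro fin_ring_closed(2,3,7)[OF M])
qed

text \<open>Squaring is additive modulo 2, so each map acts as Frobenius followed by a translation.
  Only the constant \<open>z\<close> depends on \<open>e\<close>, which makes two compositions of
  the same length comparable.\<close>

lemma gam_mod_2:
  assumes "x \<in> M"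
  shows "\<exists>z. \<exists>b\<in>M. gam (\<lambda>n. ac (e n)) m x = x ^ 2 ^ m + ac z + 2 * b"
  using assms
proof (induction m arbitrary: x)
  case 0
  then show ?case
    using fin_ring_closed(9)[OF M] by (intro exI[of _ 0] bexI[of _ 0]) (simp_all add: ac_simps)
next
  case (Suc m)
  note cl = fin_ring_closed[OF M]
  have x2: "x\<^sup>2 \<in> M" "x\<^sup>2 + ac (e m) \<in> M" using Suc.prems by (simp_all add: cl)
  obtain z b where zb: "b \<in> M" "gam (\<lambda>n. ac (e n)) (Suc m) x = (x\<^sup>2 + ac (e m)) ^ 2 ^ m + ac z + 2 * b"
    using Suc.IH[OF x2(2)] by auto
  obtain b' where b': "b' \<in> M" "(x\<^sup>2 + ac (e m)) ^ 2 ^ m = (x\<^sup>2) ^ 2 ^ m + ac (e m) ^ 2 ^ m + 2 * b'"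
    using freshman[OF x2(1) cl(1)] by blast
  have "gam (\<lambda>n. ac (e n)) (Suc m) x = x ^ 2 ^ Suc m + ac (e m ^ 2 ^ m + z) + 2 * (b + b')"
    unfolding zb b' by (simp add: ac_simps power_mult[symmetric] algebra_simps)
  then show ?case using zb(1) b'(1) cl(2) by blast
qed

lemma gam_cong_4:
  assumes "x \<in> M" "b \<in> M"
  shows "\<exists>b'\<in>M. gam (\<lambda>n. ac (e n)) k (x + 4 * b) = gam (\<lambda>n. ac (e n)) k x + 4 * b'"
  using assms
proof (induction k arbitrary: x b)
  case (Suc k)
  note cl = fin_ring_closed[OF M]
  have two: "2 * (2 * y) = 4 * y" for y :: "ratfun alg_closure" by simp
  have 4: "4 * y \<in> M" if "y \<in> M" for y using cl(3)[OF cl(7) cl(3)[OF cl(7) that]] unfolding two .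
  have e: "(x + 4 * b)\<^sup>2 + ac (e k) = (x\<^sup>2 + ac (e k)) + 4 * (2 * (x * b) + 4 * (b * b))"
    by (simp add: algebra_simps power2_eq_square)
  have m: "x\<^sup>2 + ac (e k) \<in> M" "2 * (x * b) + 4 * (b * b) \<in> M"
    using Suc.prems by (simp_all add: cl 4)
  show ?case unfolding gam.simps e by (rule Suc.IH[OF m])
qed auto

end

section \<open>Towers with monic coefficients in \<open>\<int>[t]\<close>\<close>

locale int_tower =
  fixes e :: "nat \<Rightarrow> int poly" and d :: nat
  assumes d: "d > 0" and degree_e: "Polynomial.degree (e n) = d" and lead_e: "Polynomial.lead_coeff (e n) = 1"
begin

abbreviation "cs \<equiv> \<lambda>n. to_ac (ratf (e n))"

lemma cs_eq: "cs = (\<lambda>n. ac (e n))"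
  by (simp add: ac_def)

text \<open>The degree bound makes \<open>x\<^sup>2\<close> dominate \<open>e n\<close> and is
  inherited by \<open>x\<^sup>2 + e n\<close>. The starting value of interest is \<open>e n\<close>,
  since \<open>gam e (Suc n) 0 = gam e n (e n)\<close>.\<close>

lemma gam_monic:
  assumes "Polynomial.lead_coeff x = 1" "Polynomial.degree x \<ge> d"
  shows "Polynomial.lead_coeff (gam e n x) = 1 \<and> Polynomial.degree (gam e n x) = 2 ^ n * Polynomial.degree x"
  using assms
proof (induction n arbitrary: x)
  case (Suc n)
  have l2: "Polynomial.lead_coeff (x\<^sup>2) = 1" using Suc.prems by (simp add: Polynomial.lead_coeff_power)
  have d2: "Polynomial.degree (x\<^sup>2) = 2 * Polynomial.degree x"
    using Suc.prems by (intro degree_power_eq) auto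
  have lt: "Polynomial.degree (e n) < Polynomial.degree (x\<^sup>2)" using d2 d degree_e Suc.prems by simp
  have D: "Polynomial.degree (x\<^sup>2 + e n) = 2 * Polynomial.degree x"
    using degree_add_eq_left[OF lt] d2 by simp
  have L: "Polynomial.lead_coeff (x\<^sup>2 + e n) = 1"
    using l2 lt unfolding D by (simp add: d2 coeff_eq_0)
  have "Polynomial.lead_coeff (gam e n (x\<^sup>2 + e n)) = 1 \<and>
      Polynomial.degree (gam e n (x\<^sup>2 + e n)) = 2 ^ n * Polynomial.degree (x\<^sup>2 + e n)"
    by (rule Suc.IH[OF L]) (use D Suc.prems in simp)
  then show ?case by (metis D gam.simps(2) power_Suc2 mult.assoc)
qed simp

lemma gam_0_monic:
  "Polynomial.lead_coeff (gam e (Suc n) 0) = 1" "Polynomial.degree (gam e (Suc n) 0) = 2 ^ n * d"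
  using gam_monic[of "e n" n] lead_e degree_e by auto

lemma gam_0_nonzero: "gam e (Suc n) 0 \<noteq> 0"
  using gam_0_monic(1)[of n] by auto

lemma zero_notin_lev_int: "0 \<notin> lev cs (Suc n)"
  using gam_0_nonzero[of n] gam_ac[of e "Suc n" 0] unfolding lev_eq_gam cs_eq
  by (simp add: ac_simps ac_eq_0_iff del: gam.simps)

text \<open>
  Modulo 2 both \<open>\<gamma>\<^sub>m\<close> and the tail \<open>\<theta>\<^sub>k\<^sub>+\<^sub>2 \<circ> \<dots> \<circ> \<theta>\<^sub>k\<^sub>+\<^sub>1\<^sub>+\<^sub>m\<close> are of the form \<open>x ^ 2 ^ m + z\<close>. So if \<open>\<alpha>\<close> is
  a zero of \<open>\<gamma>\<^sub>m\<close>, then the tail takes a value \<open>h + 2b\<close> at \<open>\<alpha>\<close> with \<open>h \<in> \<int>[t]\<close>, and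
  \<open>\<gamma>\<^sub>k\<^sub>+\<^sub>1(h + 2b) = 0\<close> forces 4 to divide \<open>\<gamma>\<^sub>k\<^sub>+\<^sub>1(h) = y\<^sup>2 + c\<^sub>1\<close>. This contradicts \<open>c\<^sub>1\<close> being monic,
  because \<open>-1\<close> is not a square modulo 4.
\<close>

lemma lev_disjoint_aux:
  assumes m: "\<alpha> \<in> lev cs m" and n: "\<alpha> \<in> lev cs (Suc k + m)"
  shows False
proof -
  obtain M where M: "fin_ring M" "\<alpha> \<in> M" using fin_ring_lev m unfolding cs_eq by blast
  note cl = fin_ring_closed[OF M(1)]
  let ?k = "Suc k"
  let ?w = "gam (\<lambda>n. ac (e (?k + n))) m \<alpha>"
  obtain z b where zb: "b \<in> M" "gam (\<lambda>n. ac (e n)) m \<alpha> = \<alpha> ^ 2 ^ m + ac z + 2 * b"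
    using gam_mod_2[OF M] by blast
  obtain z' b' where zb': "b' \<in> M" "?w = \<alpha> ^ 2 ^ m + ac z' + 2 * b'"
    using gam_mod_2[OF M, of "\<lambda>n. e (?k + n)"] by blast
  have "\<alpha> ^ 2 ^ m = - ac z - 2 * b"
    using zb m unfolding lev_eq_gam cs_eq by (simp add: algebra_simps eq_neg_iff_add_eq_0)
  then have w: "?w = ac (z' - z) + 2 * (b' - b)"
    using zb'(2) ac_simps(1)[of z' "- z"] by (simp add: ac_simps algebra_simps)
  define h where "h = z' - z"
  define g where "g = b' - b"
  have g: "g \<in> M" unfolding g_def using zb zb' by (intro cl)
  \<comment> \<open>Squaring upgrades the congruence between \<open>?w\<close> and
    \<open>ac h\<close> modulo 2 to one modulo 4, which the remaining maps preserve.\<close>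
  have hw: "?w\<^sup>2 = ac (h\<^sup>2) + 4 * (ac h * g + g\<^sup>2)"
    unfolding w h_def[symmetric] g_def[symmetric] by (simp add: ac_simps algebra_simps power2_eq_square)
  have "gam (\<lambda>n. ac (e n)) (?k + m) \<alpha> = 0" using n unfolding lev_eq_gam cs_eq by blast
  then have "gam (\<lambda>n. ac (e n)) ?k ?w = 0" unfolding gam_add .
  then have "gam (\<lambda>n. ac (e n)) k ((ac (h\<^sup>2) + ac (e k)) + 4 * (ac h * g + g\<^sup>2)) = 0"
    unfolding gam.simps hw by (simp add: algebra_simps)
  moreover have "ac h * g + g\<^sup>2 \<in> M" "ac (h\<^sup>2) + ac (e k) \<in> M" using g by (simp_all add: cl)
  ultimately obtain r where r: "r \<in> M" "gam (\<lambda>n. ac (e n)) k (ac (h\<^sup>2) + ac (e k)) + 4 * r = 0"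
    using gam_cong_4[OF M(1)] by metis
  define q where "q = gam e ?k h"
  have "ac q = gam (\<lambda>n. ac (e n)) k (ac (h\<^sup>2) + ac (e k))"
    unfolding q_def gam_ac[symmetric] by (simp add: ac_simps)
  then have q4: "ac q = 4 * (- r)" using r(2) by (simp add: eq_neg_iff_add_eq_0)
  \<comment> \<open>Divisibility by 4 is obtained as two divisibilities by 2, the second after
    cancelling a factor 2.\<close>
  have "ac q = 2 * (2 * (- r))" unfolding q4 by simp
  moreover have "2 * (- r) \<in> M" using r by (intro cl)
  ultimately have "2 dvd q" using integrality_2[OF M(1)] by blast
  then obtain q' where q': "q = 2 * q'" by (elim dvdE)
  have "2 * ac q' = 2 * (2 * (- r))" using q4 unfolding q' ac_simps by simp
  then have "ac q' = 2 * (- r)" by simp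
  moreover have "- r \<in> M" using r by (intro cl)
  ultimately have "2 dvd q'" using integrality_2[OF M(1)] by blast
  then have "4 dvd q" unfolding q' by (auto elim!: dvdE)
  moreover have "q = (gam (\<lambda>i. e (Suc i)) k h)\<^sup>2 + e 0" unfolding q_def gam_Suc_left ..
  ultimately show False using four_not_dvd[of "e 0"] lead_e degree_e d by metis
qed

lemma lev_disjoint_int: "m \<noteq> n \<Longrightarrow> lev cs m \<inter> lev cs n = {}"
proof -
  have "False" if mn: "m < n" and l: "\<alpha> \<in> lev cs m" "\<alpha> \<in> lev cs n" for m n \<alpha>
  proof -
    obtain k where n: "n = Suc (m + k)" using less_imp_Suc_add[OF mn] by blast
    show False by (rule lev_disjoint_aux[OF l(1), of k]) (use l(2) in \<open>simp add: n add.commute del: lev.simps\<close>)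
  qed
  then show "m \<noteq> n \<Longrightarrow> lev cs m \<inter> lev cs n = {}" by (metis disjoint_iff linorder_neqE_nat)
qed

sublocale arboreal "\<lambda>n. ratf (e n)" "\<lambda>n. [:ratf (e n), 0, 1:]"
proof
  show "is_subfield (range (to_ac :: ratfun \<Rightarrow> _))" by (rule is_subfield_range_to_ac)
qed (use zero_notin_lev_int lev_disjoint_int in auto)

lemma crit_prod_int: "crit_prod n = ac (gam e (Suc n) 0) \<or> crit_prod n = ac (- gam e (Suc n) 0)"
proof -
  have "crit_prod n = (- 1) ^ card (lev cs n) * ac (gam e (Suc n) 0)"
    unfolding crit_prod_eq using gam_ac[of e "Suc n" 0] by (simp add: ac_simps cs_eq ac_def[symmetric] del: gam.simps)
  then show ?thesis by (cases "even (card (lev cs n))") (simp_all add: ac_simps del: gam.simps)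
qed

end

text \<open>At each prime the multiplicities of \<open>g\<close> and \<open>h\<close> have even sum,
  and that of \<open>g\<close> is at most 1. Where it is 1, that of \<open>h\<close> is odd and
  therefore positive.\<close>

lemma squarefree_dvd_cofactor:
  fixes g :: "int poly"
  assumes eq: "a\<^sup>2 = b\<^sup>2 * g * h" and a: "a \<noteq> 0" and g: "\<And>p. p * p dvd g \<Longrightarrow> is_unit p"
  shows "g dvd h"
proof -
  have nz: "b \<noteq> 0" "g \<noteq> 0" "h \<noteq> 0" using eq a by auto
  show ?thesis
  proof (rule multiplicity_le_imp_dvd)
    fix p :: "int poly" assume p: "prime p"
    then have pe: "prime_elem p" by simp
    have "2 * multiplicity p a = 2 * multiplicity p b + multiplicity p g + multiplicity p h"
      using arg_cong[OF eq, of "multiplicity p"] nz a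
      by (simp add: prime_elem_multiplicity_mult_distrib[OF pe] prime_elem_multiplicity_power_distrib[OF pe])
    moreover have "multiplicity p g < 2"
    proof (rule multiplicity_lessI)
      show "\<not> p ^ 2 dvd g" using g[of p] p by (auto simp: power2_eq_square)
    qed (use p nz in auto)
    ultimately show "multiplicity p g \<le> multiplicity p h" by presburger
  qed (use nz in simp)
qed

text \<open>Modulo 2 the polynomial \<open>p\<close> is invertible and so has degree 0. As a divisor
  of a monic polynomial it has a unit as leading coefficient, so no degree is lost by the reduction
  and \<open>p\<close> itself is constant.\<close>

lemma monic_divisor_unit:
  fixes p :: "int poly"
  assumes f: "p dvd f" "Polynomial.lead_coeff f = 1" and z: "p dvd 1 + 2 * z"
  shows "is_unit p"
proof -
  obtain q where "f = p * q" using f(1) by (elim dvdE)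
  then have "Polynomial.lead_coeff p * Polynomial.lead_coeff q = 1"
    using f(2) by (simp add: Polynomial.lead_coeff_mult)
  then have u: "is_unit (Polynomial.lead_coeff p)" by (metis dvd_triv_left)
  obtain v where v: "1 + 2 * z = p * v" using z by (elim dvdE)
  define v0 where "v0 = mod_two v"
  obtain w where w: "v = v0 + 2 * w" unfolding v0_def using mod_two by blast
  have e: "p * v0 - 1 = 2 * (z - p * w)" using v by (simp add: w algebra_simps)
  then have c: "2 dvd Polynomial.coeff (p * v0 - 1) i" for i by (intro two_dvd_coeff) simp
  have v0: "v0 \<noteq> 0" using c[of 0] by auto
  have p0: "p \<noteq> 0" using u by auto
  have "Polynomial.degree p = 0"
  proof (rule ccontr)
    assume n: "Polynomial.degree p \<noteq> 0"
    let ?D = "Polynomial.degree (p * v0)"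
    have D: "?D > 0" using n v0 p0 by (simp add: Polynomial.degree_mult_eq)
    have "Polynomial.coeff (p * v0) ?D = Polynomial.lead_coeff p"
      using lead_coeff_mod_two[of v] v0 by (simp add: Polynomial.lead_coeff_mult v0_def)
    then have "Polynomial.coeff (p * v0 - 1) ?D = Polynomial.lead_coeff p"
      using D by (simp add: coeff_eq_0)
    then have "2 dvd Polynomial.lead_coeff p" using c[of ?D] by simp
    then show False using u by (metis dvd_trans odd_one)
  qed
  then obtain a where "p = [:a:]" by (rule degree_eq_zeroE)
  then show ?thesis using u by (simp add: is_unit_const_poly_iff)
qed

context int_tower
begin

lemma gam_0_squarefree:
  assumes e0: "2 dvd pderiv (e 0) - 1" and p: "p * p dvd gam e (Suc n) 0"
  shows "is_unit p"
proof -
  let ?f = "gam e (Suc n) 0"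
  define y where "y = gam (\<lambda>i. e (Suc i)) n 0"
  have f: "?f = y\<^sup>2 + e 0" unfolding y_def by (rule gam_Suc_left)
  obtain t where t: "pderiv (e 0) - 1 = 2 * t" using e0 by (elim dvdE)
  have "pderiv ?f = 1 + 2 * (y * pderiv y + t)"
    unfolding f using t by (simp add: pderiv_add power2_eq_square pderiv_mult algebra_simps)
  moreover obtain w where w: "?f = p * p * w" using p by (elim dvdE)
  have "p dvd pderiv ?f" unfolding w by (simp add: pderiv_mult dvd_add)
  ultimately have "p dvd 1 + 2 * (y * pderiv y + t)" by simp
  moreover have "p dvd ?f" unfolding w by simp
  ultimately show ?thesis using monic_divisor_unit gam_0_monic(1) by blast
qed

lemma crit_prods_nonsquare:
  assumes e0: "2 dvd pderiv (e 0) - 1" and I: "finite I" "I \<noteq> {}" and y: "y \<in> range to_ac"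
  shows "y\<^sup>2 \<noteq> (\<Prod>i\<in>I. crit_prod i)"
proof
  assume eq: "y\<^sup>2 = (\<Prod>i\<in>I. crit_prod i)"
  let ?f = "\<lambda>i. gam e (Suc i) 0"
  \<comment> \<open>The signs left open by \<open>crit_prod_int\<close>; they do not affect degrees,
    and the sign of the top index is moved into \<open>h\<close>.\<close>
  obtain s where s: "\<And>i. s i = 1 \<or> s i = - 1" "\<And>i. crit_prod i = ac (s i * ?f i)"
  proof
    let ?s = "\<lambda>i. if crit_prod i = ac (?f i) then 1 else - 1"
    show "?s i = 1 \<or> ?s i = - 1" for i by simp
    show "crit_prod i = ac (?s i * ?f i)" for i using crit_prod_int[of i] by auto
  qed
  obtain r where r: "y = to_ac r" using y by blast
  obtain b a where ba: "b \<noteq> 0" "ratf b * r = ratf a" using clear_denominators by blast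
  define n where "n = Max I"
  define h where "h = s n * (\<Prod>i\<in>I - {n}. s i * ?f i)"
  have nI: "n \<in> I" using I by (simp add: n_def)
  have le: "i < n" if "i \<in> I - {n}" for i using that I by (simp add: n_def order_le_neq_trans)
  have "to_ac (r\<^sup>2) = to_ac (ratf (\<Prod>i\<in>I. s i * ?f i))"
    using eq unfolding r s(2) by (simp add: ac_def ratf_prod to_ac_prod del: gam.simps)
  then have r2: "r\<^sup>2 = ratf (\<Prod>i\<in>I. s i * ?f i)" unfolding to_ac_eq_iff .
  have "ratf (a\<^sup>2) = ratf (b\<^sup>2) * r\<^sup>2" using ba(2) by (simp add: ratf_power flip: ba(2)) (simp add: power_mult_distrib)
  then have "a\<^sup>2 = b\<^sup>2 * (\<Prod>i\<in>I. s i * ?f i)" unfolding r2 ratf_mult[symmetric] ratf_eq_iff .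
  also have "(\<Prod>i\<in>I. s i * ?f i) = (s n * ?f n) * (\<Prod>i\<in>I - {n}. s i * ?f i)"
    by (rule prod.remove[OF I(1) nI])
  finally have sq: "a\<^sup>2 = b\<^sup>2 * ?f n * h" by (simp add: h_def mult_ac del: gam.simps)
  have sn: "s i \<noteq> 0" "Polynomial.degree (s i) = 0" for i using s(1)[of i] by auto
  have h0: "h \<noteq> 0" unfolding h_def using I sn gam_0_nonzero by (simp add: prod_zero_iff del: gam.simps)
  then have "a\<^sup>2 \<noteq> 0" unfolding sq using ba(1) gam_0_nonzero by (simp del: gam.simps)
  then have "a \<noteq> 0" by simp
  then have "?f n dvd h" using squarefree_dvd_cofactor[OF sq] gam_0_squarefree[OF e0] by blast
  then have "Polynomial.degree (?f n) \<le> Polynomial.degree h" using h0 by (rule Polynomial.dvd_imp_degree_le)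
  also have "Polynomial.degree h = (\<Sum>i\<in>I - {n}. Polynomial.degree (s i * ?f i))"
    unfolding h_def using sn gam_0_nonzero I
    by (simp add: Polynomial.degree_mult_eq degree_prod_eq_sum_degree prod_zero_iff del: gam.simps)
  also have "\<dots> = (\<Sum>i\<in>I - {n}. 2 ^ i * d)"
    using sn gam_0_nonzero gam_0_monic(2) by (simp add: Polynomial.degree_mult_eq del: gam.simps)
  also have "\<dots> \<le> (\<Sum>i<n. 2 ^ i * d)"
    by (rule sum_mono2) (use le in auto)
  also have "\<dots> = (2 ^ n - 1) * d"
    by (simp add: sum_distrib_right[symmetric] mask_eq_sum_exp_nat lessThan_def)
  also have "\<dots> < 2 ^ n * d" using d by simp
  also have "\<dots> = Polynomial.degree (?f n)" by (rule gam_0_monic(2)[symmetric])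
  finally show False by simp
qed

end

section \<open>Measurability and positivity\<close>

text \<open>
  Since \<open>measure\<close> is 0 on non-measurable sets, \<open>SurArb\<close> has to be shown measurable. The independence
  criterion describes it by countably many conditions on finitely many coordinates each.
\<close>

definition seq_coeff :: "(nat \<Rightarrow> ratfun poly) \<Rightarrow> nat \<Rightarrow> ratfun alg_closure" where
  "seq_coeff \<theta> n = to_ac (Polynomial.coeff (\<theta> n) 0)"

text \<open>Stated for every \<theta>, with \<open>crit_prod\<close> unfolded, so that it makes
  sense outside the locales and visibly depends only on the first \<open>n\<close> entries.\<close>

definition nonsquare_upto :: "nat \<Rightarrow> (nat \<Rightarrow> ratfun poly) \<Rightarrow> bool" where
  "nonsquare_upto n \<theta> \<longleftrightarrow> (\<forall>I y. I \<subseteq> {..<n} \<longrightarrow> I \<noteq> {} \<longrightarrow> y \<in> range to_ac \<longrightarrow>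
     y\<^sup>2 \<noteq> (\<Prod>i\<in>I. \<Prod>\<alpha>\<in>lev (seq_coeff \<theta>) i. \<alpha> - seq_coeff \<theta> i))"

lemma lev_cong: "(\<And>i. i < n \<Longrightarrow> c i = c' i) \<Longrightarrow> lev c n = lev c' n"
  by (induction n) auto

lemma nonsquare_upto_cong:
  assumes "\<And>i. i < n \<Longrightarrow> \<theta> i = \<theta>' i"
  shows "nonsquare_upto n \<theta> = nonsquare_upto n \<theta>'"
proof -
  have "(\<Prod>\<alpha>\<in>lev (seq_coeff \<theta>) i. \<alpha> - seq_coeff \<theta> i) = (\<Prod>\<alpha>\<in>lev (seq_coeff \<theta>') i. \<alpha> - seq_coeff \<theta>' i)"
    if "i < n" for i
    using that assms lev_cong[of i "seq_coeff \<theta>" "seq_coeff \<theta>'"] by (simp add: seq_coeff_def)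
  then have "(\<Prod>i\<in>I. \<Prod>\<alpha>\<in>lev (seq_coeff \<theta>) i. \<alpha> - seq_coeff \<theta> i) =
      (\<Prod>i\<in>I. \<Prod>\<alpha>\<in>lev (seq_coeff \<theta>') i. \<alpha> - seq_coeff \<theta>' i)" if "I \<subseteq> {..<n}" for I
    by (rule prod.cong[OF refl]) (use that in auto)
  then show ?thesis unfolding nonsquare_upto_def by (metis (no_types, lifting))
qed

lemma seqs_quads:
  assumes "\<theta> \<in> seqs (quads C)"
  obtains e where "\<And>n. e n \<in> C" "\<theta> = (\<lambda>n. [:ratf (e n), 0, 1:])"
proof -
  have "\<forall>n. \<exists>e. e \<in> C \<and> \<theta> n = [:ratf e, 0, 1:]"
    using assms unfolding seqs_def quads_def by auto
  from choice[OF this] obtain e where "\<forall>n. e n \<in> C \<and> \<theta> n = [:ratf (e n), 0, 1:]" by blast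
  then show ?thesis using that[of e] by auto
qed

context
  fixes C :: "int poly set" and d B :: nat
  assumes C: "C \<subseteq> monic_polys d B" and d: "d > 0"
begin

lemma int_tower_C: "(\<And>n. e n \<in> C) \<Longrightarrow> int_tower e d"
  using C d unfolding monic_polys_def by unfold_locales blast+

lemma SurArb_iff:
  assumes e: "\<And>n. e n \<in> C" and \<theta>: "\<theta> = (\<lambda>n. [:ratf (e n), 0, 1:])"
  shows "\<theta> \<in> SurArb (quads C) \<longleftrightarrow> (\<forall>I y. finite I \<longrightarrow> I \<noteq> {} \<longrightarrow> y \<in> range to_ac \<longrightarrow>
     y\<^sup>2 \<noteq> (\<Prod>i\<in>I. \<Prod>\<alpha>\<in>lev (seq_coeff \<theta>) i. \<alpha> - seq_coeff \<theta> i))"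
proof -
  interpret int_tower e d by (rule int_tower_C[OF e])
  have "\<theta> \<in> seqs_sep (quads C)"
    unfolding seqs_sep_def seqs_def \<theta> quads_def using e separable_iter_comp by auto
  moreover have "seq_coeff \<theta> = cs" by (rule ext) (simp add: seq_coeff_def \<theta>)
  ultimately show ?thesis
    unfolding SurArb_def mem_Collect_eq using arboreal_surjective_iff
    by (simp add: crit_prod_def \<theta>)
qed

text \<open>Every finite \<open>I\<close> lies in some \<open>{..<n}\<close>, so the criterion
  becomes a countable conjunction. Equality matters: a measurable subset of positive measure would
  not make \<open>SurArb\<close> measurable.\<close>

lemma SurArb_eq: "SurArb (quads C) = {\<theta> \<in> seqs (quads C). \<forall>n. nonsquare_upto n \<theta>}"
proof (rule Set.set_eqI)
  fix \<theta>
  have sub: "(\<forall>n. nonsquare_upto n \<theta>) \<longleftrightarrow> (\<forall>I y. finite I \<longrightarrow> I \<noteq> {} \<longrightarrow> y \<in> range to_ac \<longrightarrow>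
     y\<^sup>2 \<noteq> (\<Prod>i\<in>I. \<Prod>\<alpha>\<in>lev (seq_coeff \<theta>) i. \<alpha> - seq_coeff \<theta> i))"
    unfolding nonsquare_upto_def
    by (meson finite_lessThan finite_nat_iff_bounded finite_subset)
  show "\<theta> \<in> SurArb (quads C) \<longleftrightarrow> \<theta> \<in> {\<theta> \<in> seqs (quads C). \<forall>n. nonsquare_upto n \<theta>}"
  proof (cases "\<theta> \<in> seqs (quads C)")
    case True
    then obtain e where "\<And>n. e n \<in> C" "\<theta> = (\<lambda>n. [:ratf (e n), 0, 1:])" by (rule seqs_quads) blast
    from SurArb_iff[OF this] True sub show ?thesis by simp
  next
    case False
    then show ?thesis unfolding SurArb_def seqs_sep_def by blast
  qed
qed

lemma SurArb_I:
  assumes "\<theta> \<in> seqs (quads C)" "\<theta> 0 = [:ratf c0, 0, 1:]" "2 dvd pderiv c0 - 1"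
  shows "\<theta> \<in> SurArb (quads C)"
proof -
  obtain e where e: "\<And>n. e n \<in> C" "\<theta> = (\<lambda>n. [:ratf (e n), 0, 1:])"
    using seqs_quads[OF assms(1)] by blast
  interpret int_tower e d by (rule int_tower_C[OF e(1)])
  have "e 0 = c0" using assms(2) unfolding e(2) by (simp add: ratf_eq_iff)
  then have "\<forall>I y. finite I \<longrightarrow> I \<noteq> {} \<longrightarrow> y \<in> range to_ac \<longrightarrow> y\<^sup>2 \<noteq> (\<Prod>i\<in>I. crit_prod i)"
    using crit_prods_nonsquare assms(3) by blast
  moreover have "seq_coeff \<theta> = cs" by (rule ext) (simp add: seq_coeff_def e(2))
  ultimately show ?thesis unfolding SurArb_iff[OF e] by (simp add: crit_prod_def)
qed

end

text \<open>A finite \<open>S\<close> leaves finitely many prefixes of length \<open>n\<close>, so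
  the event is a finite union of cylinders.\<close>

lemma sets_finitely_determined:
  fixes M :: "'a measure"
  assumes S: "finite S" "sets M = Pow S" and P: "\<And>\<theta> \<theta>'. (\<And>i. i < n \<Longrightarrow> \<theta> i = \<theta>' i) \<Longrightarrow> P \<theta> = P \<theta>'"
  shows "{\<theta> \<in> space (Pi\<^sub>M (UNIV :: nat set) (\<lambda>_. M)). P \<theta>} \<in> sets (Pi\<^sub>M UNIV (\<lambda>_. M))"
proof -
  let ?N = "Pi\<^sub>M (UNIV :: nat set) (\<lambda>_. M)"
  have sp: "space M = S" using S(2) by (metis Pow_top sets.sets_into_space sets.top subset_antisym PowD)
  let ?W = "{w \<in> PiE {..<n} (\<lambda>_. S). P w}"
  have "finite ?W" using S(1) by (simp add: finite_PiE)
  have "{\<theta> \<in> space ?N. P \<theta>} = (\<Union>w\<in>?W. {\<theta> \<in> space ?N. \<forall>i\<in>{..<n}. \<theta> i = w i})"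
  proof (intro Set.set_eqI iffI)
    fix \<theta> assume t: "\<theta> \<in> {\<theta> \<in> space ?N. P \<theta>}"
    let ?w = "restrict \<theta> {..<n}"
    have "P ?w = P \<theta>" by (rule P) simp
    then have "?w \<in> ?W" using t sp by (auto simp: space_PiM)
    moreover have "\<theta> \<in> {\<theta> \<in> space ?N. \<forall>i\<in>{..<n}. \<theta> i = ?w i}" using t by simp
    ultimately show "\<theta> \<in> (\<Union>w\<in>?W. {\<theta> \<in> space ?N. \<forall>i\<in>{..<n}. \<theta> i = w i})" by blast
  next
    fix \<theta> assume "\<theta> \<in> (\<Union>w\<in>?W. {\<theta> \<in> space ?N. \<forall>i\<in>{..<n}. \<theta> i = w i})"
    then obtain w where w: "w \<in> ?W" "\<theta> \<in> space ?N" "\<forall>i\<in>{..<n}. \<theta> i = w i" by blast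
    then have "P \<theta> = P w" by (intro P) simp
    then show "\<theta> \<in> {\<theta> \<in> space ?N. P \<theta>}" using w by simp
  qed
  moreover have "{\<theta> \<in> space ?N. \<forall>i\<in>{..<n}. \<theta> i = w i} \<in> sets ?N" if "w \<in> ?W" for w
  proof (rule sets.sets_Collect_finite_All)
    fix i assume "i \<in> {..<n}"
    then have "{w i} \<in> sets M" using that S(2) by auto
    then have "(\<lambda>\<theta>. \<theta> i) -` {w i} \<inter> space ?N \<in> sets ?N"
      by (intro measurable_sets[OF measurable_component_singleton]) auto
    also have "(\<lambda>\<theta>. \<theta> i) -` {w i} \<inter> space ?N = {\<theta> \<in> space ?N. \<theta> i = w i}" by blast
    finally show "{\<theta> \<in> space ?N. \<theta> i = w i} \<in> sets ?N" .
  qed simp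
  then have "(\<Union>w\<in>?W. {\<theta> \<in> space ?N. \<forall>i\<in>{..<n}. \<theta> i = w i}) \<in> sets ?N"
    by (rule sets.finite_UN[OF \<open>finite ?W\<close>])
  ultimately show ?thesis by simp
qed

theorem measure_SurArb_pos:
  assumes C: "C \<subseteq> monic_polys d B" "finite C" and d: "d > 0"
    and M: "strictly_positive_prob (quads C) M"
    and c0: "c0 \<in> C" "2 dvd pderiv c0 - 1"
  shows "measure (seq_measure M) (SurArb (quads C)) > 0"
proof -
  let ?S = "quads C" and ?N = "Pi\<^sub>M (UNIV :: nat set) (\<lambda>_. M)" and ?f = "[:ratf c0, 0, 1:]"
  have S: "finite ?S" "sets M = Pow ?S" and ps: "prob_space M" and pos: "\<And>x. x \<in> ?S \<Longrightarrow> measure M {x} > 0"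
    using C(2) M unfolding quads_def strictly_positive_prob_def by auto
  interpret M: prob_space M by (rule ps)
  interpret N: product_prob_space "\<lambda>_. M" "UNIV :: nat set" by unfold_locales
  have "prob_space ?N" by (rule prob_space_PiM) (rule ps)
  then have fin: "finite_measure ?N" by (rule prob_space.finite_measure)
  have "space M = ?S" using S(2) by (metis Pow_top sets.sets_into_space sets.top subset_antisym PowD)
  then have sp: "space ?N = seqs ?S" by (simp add: space_PiM seqs_def PiE_UNIV_domain)
  have "{\<theta> \<in> space ?N. \<forall>n. nonsquare_upto n \<theta>} \<in> sets ?N"
    by (intro sets.sets_Collect_countable_All sets_finitely_determined[OF S] nonsquare_upto_cong)
  then have meas: "SurArb ?S \<in> sets ?N" unfolding SurArb_eq[OF C(1) d] sp .
  have fS: "?f \<in> ?S" using c0(1) unfolding quads_def by blast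
  let ?A = "(\<lambda>\<theta>. \<theta> 0) -` {?f} \<inter> space ?N"
  have "?A \<subseteq> SurArb ?S"
    using SurArb_I[OF C(1) d _ _ c0(2)] unfolding sp by auto
  then have "measure ?N ?A \<le> measure ?N (SurArb ?S)"
    by (rule finite_measure.finite_measure_mono[OF fin _ meas])
  moreover have "measure ?N ?A = measure M {?f}"
  proof -
    have "measure M {?f} = measure (distr ?N M (\<lambda>\<theta>. \<theta> 0)) {?f}"
      by (subst N.PiM_component) simp_all
    also have "\<dots> = measure ?N ?A"
      by (rule measure_distr[OF measurable_component_singleton]) (use S fS in auto)
    finally show ?thesis by simp
  qed
  ultimately show ?thesis using pos[OF fS] unfolding seq_measure_def by simp
qed

section \<open>Counting\<close>

text \<open>Drawing without replacement: after \<open>s\<close> draws that stayed among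
  \<open>m\<close> of \<open>n\<close> elements, the chance of staying there is
  \<open>(m - s) / (n - s)\<close>, at most \<open>m / n\<close>. Denominators are cleared to remain
  in the naturals.\<close>

lemma binomial_ratio_le:
  assumes "m \<le> n"
  shows "(m choose s) * n ^ s \<le> (n choose s) * m ^ s"
proof (induction s)
  case (Suc s)
  have ab: "Suc s * (k choose Suc s) = (k choose s) * (k - s)" for k :: nat
    using binomial_absorb_comp[of k s] binomial_absorption[of s k] by (simp only: mult.commute)
  have *: "(m - s) * n \<le> (n - s) * m"
    unfolding diff_mult_distrib mult.commute[of n m] by (intro diff_le_mono2 mult_le_mono2 assms)
  have "Suc s * ((m choose Suc s) * n ^ Suc s) = ((m choose s) * n ^ s) * ((m - s) * n)"
    using ab[of m] by (metis (no_types, lifting) mult.assoc mult.commute mult.left_commute power_Suc)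
  also have "\<dots> \<le> ((n choose s) * m ^ s) * ((n - s) * m)"
    by (rule mult_le_mono[OF Suc *])
  also have "\<dots> = Suc s * ((n choose Suc s) * m ^ Suc s)"
    using ab[of n] by (metis (no_types, lifting) mult.assoc mult.commute mult.left_commute power_Suc)
  finally show ?case by (simp only: mult_le_cancel1)
qed simp

lemma card_parity_interval_ge: "card {x \<in> {- int B..int B}. even (x - r)} \<ge> B"
proof -
  \<comment> \<open>The first integer from \<open>- B\<close> on with the parity of
    \<open>r\<close>. The last of the \<open>B\<close> values \<open>?f k\<close> is at most
    \<open>- B + 1 + 2 * (B - 1) = B - 1\<close>.\<close>
  obtain a where a: "a = - int B \<or> a = - int B + 1" "even (a - r)"
    by (metis add.commute add_diff_eq even_plus_one_iff diff_add_eq)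
  let ?f = "\<lambda>k. a + 2 * int k"
  have "card (?f ` {..<B}) = B" by (subst card_image) (auto simp: inj_on_def)
  moreover have "?f ` {..<B} \<subseteq> {x \<in> {- int B..int B}. even (x - r)}"
    using a by auto
  moreover have "finite {x \<in> {- int B..int B}. even (x - r)}"
    by (rule finite_subset[of _ "{- int B..int B}"]) auto
  ultimately show ?thesis using card_mono by metis
qed

lemma monic_polys_finite_card:
  "finite (monic_polys d B)" "card (monic_polys d B) \<le> (2 * B + 1) ^ d"
proof -
  let ?P = "PiE {..<d} (\<lambda>_. {- int B..int B})"
  let ?g = "\<lambda>c. restrict (Polynomial.coeff c) {..<d}"
  have inj: "inj_on ?g (monic_polys d B)"
  proof (rule inj_onI)
    fix x y assume xy: "x \<in> monic_polys d B" "y \<in> monic_polys d B" and e: "?g x = ?g y"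
    have "Polynomial.coeff x i = Polynomial.coeff y i" for i
    proof (cases i d rule: linorder_cases)
      case less
      then show ?thesis using fun_cong[OF e, of i] by simp
    next
      case equal
      then show ?thesis using xy unfolding monic_polys_def by auto
    next
      case greater
      then show ?thesis using xy unfolding monic_polys_def by (auto simp: coeff_eq_0)
    qed
    then show "x = y" by (rule poly_eqI)
  qed
  have sub: "?g ` monic_polys d B \<subseteq> ?P"
  proof (rule image_subsetI)
    fix c assume "c \<in> monic_polys d B"
    then have "\<bar>Polynomial.coeff c i\<bar> \<le> int B" for i unfolding monic_polys_def by blast
    then show "?g c \<in> ?P" unfolding restrict_PiE_iff by (simp add: abs_le_iff minus_le_iff)
  qed
  have fin: "finite ?P" by (intro finite_PiE) auto
  show "finite (monic_polys d B)" using inj sub fin by (meson finite_imageD finite_subset)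
  have "card (monic_polys d B) = card (?g ` monic_polys d B)" by (simp add: card_image inj)
  also have "\<dots> \<le> card ?P" by (rule card_mono[OF fin sub])
  also have "\<dots> = (2 * B + 1) ^ d" by (simp add: card_PiE nat_add_distrib nat_mult_distrib)
  finally show "card (monic_polys d B) \<le> (2 * B + 1) ^ d" .
qed

definition deriv_one_polys :: "nat \<Rightarrow> nat \<Rightarrow> int poly set" where
  "deriv_one_polys d B = {c \<in> monic_polys d B. 2 dvd pderiv c - 1}"

text \<open>Differentiation multiplies coefficient \<open>i\<close> by \<open>i\<close>, so only odd
  \<open>i\<close> matter modulo 2: coefficient 1 must be odd and the other odd-indexed ones even.
  As \<open>d\<close> is even, the leading term drops out, leaving \<open>d div 2\<close>
  constrained and \<open>d div 2\<close> free positions.\<close>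

lemma card_deriv_one_polys_ge:
  assumes B: "B \<ge> 1" and d: "even d" "d > 0"
  shows "B ^ (d div 2) * (2 * B + 1) ^ (d div 2) \<le> card (deriv_one_polys d B)"
proof -
  define F where "F i = {x \<in> {- int B..int B}. odd i \<longrightarrow> even (x - (if i = 1 then 1 else 0))}" for i :: nat
  let ?p = "\<lambda>w. Polynomial.monom 1 d + (\<Sum>i<d. Polynomial.monom (w i) i) :: int poly"
  have co: "Polynomial.coeff (?p w) i = (if i = d then 1 else if i < d then w i else 0)" for w i
    by (simp add: coeff_sum)
  have fin: "finite (deriv_one_polys d B)"
    using monic_polys_finite_card(1) unfolding deriv_one_polys_def by simp
  have "card (PiE {..<d} F) = card (?p ` PiE {..<d} F)"
  proof (rule card_image[symmetric], rule inj_onI)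
    fix w w' assume w: "w \<in> PiE {..<d} F" "w' \<in> PiE {..<d} F" and e: "?p w = ?p w'"
    show "w = w'"
    proof (rule PiE_ext[OF w])
      fix i assume "i \<in> {..<d}"
      then show "w i = w' i" using co[of w i] co[of w' i] unfolding e by simp
    qed
  qed
  also have "\<dots> \<le> card (deriv_one_polys d B)"
  proof (rule card_mono[OF fin], rule image_subsetI)
    fix w assume w: "w \<in> PiE {..<d} F"
    have deg: "Polynomial.degree (?p w) = d"
    proof (rule order_antisym)
      show "Polynomial.degree (?p w) \<le> d"
        by (intro degree_le allI impI) (unfold co, simp)
      show "d \<le> Polynomial.degree (?p w)"
        by (intro le_degree) (unfold co, simp)
    qed
    have "\<bar>w i\<bar> \<le> int B" if "i < d" for i
    proof -
      have "w i \<in> F i" using w that by (auto simp: PiE_iff)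
      then show ?thesis unfolding F_def by auto
    qed
    then have "\<bar>Polynomial.coeff (?p w) i\<bar> \<le> int B" for i
      unfolding co using B by simp
    moreover have "Polynomial.lead_coeff (?p w) = 1" unfolding deg co by simp
    ultimately have m: "?p w \<in> monic_polys d B" unfolding monic_polys_def using deg by blast
    have "even (Polynomial.coeff (pderiv (?p w) - 1) i)" for i
    proof -
      have e: "Polynomial.coeff (pderiv (?p w) - 1) i = int (Suc i) * Polynomial.coeff (?p w) (Suc i) - (if i = 0 then 1 else 0)"
        by (simp add: coeff_pderiv del: of_nat_Suc)
      show ?thesis
      proof (cases "even (Suc i)")
        case True
        then have "i \<noteq> 0" by (cases i) auto
        then show ?thesis unfolding e using True by simp
      next
        case False
        then have "Suc i \<noteq> d" using d by blast
        show ?thesis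
        proof (cases "Suc i < d")
          case True
          then have "w (Suc i) \<in> F (Suc i)" using w by (auto simp: PiE_iff)
          then have "even (w (Suc i) - (if i = 0 then 1 else 0))" using False by (simp add: F_def)
          then show ?thesis unfolding e co using True False by (auto split: if_splits)
        next
          case False
          then have "i \<noteq> 0" using \<open>Suc i \<noteq> d\<close> d by auto
          then show ?thesis unfolding e co using False \<open>Suc i \<noteq> d\<close> by simp
        qed
      qed
    qed
    then have "2 dvd pderiv (?p w) - 1" unfolding two_eq_const const_poly_dvd_iff by blast
    then show "?p w \<in> deriv_one_polys d B" using m unfolding deriv_one_polys_def by blast
  qed
  finally have le: "card (PiE {..<d} F) \<le> card (deriv_one_polys d B)" .
  have "B ^ (d div 2) * (2 * B + 1) ^ (d div 2) = (\<Prod>i<d. if odd i then B else 2 * B + 1)"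
  proof -
    obtain k where k: "d = 2 * k" using d by (elim evenE)
    have "(\<Prod>i<2 * k. if odd i then B else 2 * B + 1) = B ^ k * (2 * B + 1) ^ k"
      by (induction k) (simp_all add: algebra_simps)
    then show ?thesis unfolding k by simp
  qed
  also have "\<dots> \<le> (\<Prod>i<d. card (F i))"
  proof (rule prod_mono)
    fix i assume "i \<in> {..<d}"
    show "0 \<le> (if odd i then B else 2 * B + 1) \<and> (if odd i then B else 2 * B + 1) \<le> card (F i)"
    proof (cases "odd i")
      case True
      then show ?thesis using card_parity_interval_ge[of B "if i = 1 then 1 else 0"] by (simp add: F_def)
    next
      case False
      then have "F i = {- int B..int B}" unfolding F_def by auto
      then show ?thesis using False by simp
    qed
  qed
  also have "\<dots> = card (PiE {..<d} F)" by (simp add: card_PiE)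
  finally show ?thesis using le by simp
qed

lemma card_subsets_meeting:
  assumes "finite U" "A \<subseteq> U"
  shows "real (card {C. C \<subseteq> U \<and> card C = s \<and> C \<inter> A \<noteq> {}}) = real (card U choose s) - real ((card U - card A) choose s)"
proof -
  have fA: "finite A" using assms finite_subset by blast
  let ?all = "{C. C \<subseteq> U \<and> card C = s}" and ?no = "{C. C \<subseteq> U - A \<and> card C = s}"
  have "{C. C \<subseteq> U \<and> card C = s \<and> C \<inter> A \<noteq> {}} = ?all - ?no" by blast
  moreover have fin: "finite ?all" using assms(1) by simp
  moreover have sub: "?no \<subseteq> ?all" by blast
  ultimately have "card {C. C \<subseteq> U \<and> card C = s \<and> C \<inter> A \<noteq> {}} = card ?all - card ?no"
    using finite_subset[OF sub fin] by (simp add: card_Diff_subset)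
  moreover have "card ?no \<le> card ?all" by (rule card_mono[OF fin sub])
  moreover have "card ?all = card U choose s" using assms(1) by (rule n_subsets)
  moreover have "card ?no = (card U - card A) choose s"
    using n_subsets[of "U - A" s] assms fA by (simp add: card_Diff_subset)
  ultimately show ?thesis by simp
qed

text \<open>A bound for each finite \<open>B\<close>, whose limit gives the theorem.
  \<open>B \<ge> s\<close> ensures that there are sets of size \<open>s\<close> to count;
  \<open>B \<ge> 1\<close> admits the leading coefficient 1.\<close>

lemma proportion_lower_bound:
  assumes d: "d > 0" "even d" and s: "s \<ge> 2" and B: "B \<ge> max 1 s"
    and \<nu>: "\<And>C. C \<in> S_Mon d s B \<Longrightarrow> strictly_positive_prob (quads C) (\<nu> C)"
  shows "1 - (1 - (real B / (2 * real B + 1)) ^ (d div 2)) ^ s \<le>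
    real (card {C \<in> S_Mon d s B. measure (seq_measure (\<nu> C)) (SurArb (quads C)) > 0}) / real (card (S_Mon d s B))"
proof -
  let ?U = "monic_polys d B" and ?A = "deriv_one_polys d B"
  define N where "N = card ?U"
  define a where "a = card ?A"
  define h where "h = d div 2"
  have h: "h > 0" "d = h + h" using d by (auto simp: h_def)
  have finU: "finite ?U" and NU: "N \<le> (2 * B + 1) ^ d" unfolding N_def by (rule monic_polys_finite_card)+
  have AU: "?A \<subseteq> ?U" unfolding deriv_one_polys_def by blast
  have aN: "a \<le> N" unfolding a_def N_def by (rule card_mono[OF finU AU])
  have B1: "B \<ge> 1" "B \<ge> s" using B by auto
  have ge: "B ^ h * (2 * B + 1) ^ h \<le> a"
    unfolding a_def h_def by (rule card_deriv_one_polys_ge[OF B1(1) d(2,1)])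
  have "B = B ^ 1 * 1" by simp
  also have "\<dots> \<le> B ^ h * (2 * B + 1) ^ h"
    using B1 h by (intro mult_le_mono power_increasing) auto
  finally have sN: "s \<le> N" using B1(2) ge aN by linarith
  have N0: "N > 0" using sN s by linarith
  have S: "S_Mon d s B = {C. C \<subseteq> ?U \<and> card C = s}" unfolding S_Mon_def ..
  have cS: "card (S_Mon d s B) = N choose s" unfolding S N_def by (rule n_subsets[OF finU])
  have pos: "N choose s > 0" using sN by simp
  have "{C. C \<subseteq> ?U \<and> card C = s \<and> C \<inter> ?A \<noteq> {}} \<subseteq>
      {C \<in> S_Mon d s B. measure (seq_measure (\<nu> C)) (SurArb (quads C)) > 0}"
  proof
    fix C assume "C \<in> {C. C \<subseteq> ?U \<and> card C = s \<and> C \<inter> ?A \<noteq> {}}"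
    then have C: "C \<subseteq> ?U" "C \<in> S_Mon d s B" "C \<inter> ?A \<noteq> {}" unfolding S by auto
    then obtain c0 where c0: "c0 \<in> C" "2 dvd pderiv c0 - 1" unfolding deriv_one_polys_def by blast
    have "measure (seq_measure (\<nu> C)) (SurArb (quads C)) > 0"
      by (rule measure_SurArb_pos[OF C(1) finite_subset[OF C(1) finU] d(1) \<nu>[OF C(2)] c0])
    then show "C \<in> {C \<in> S_Mon d s B. measure (seq_measure (\<nu> C)) (SurArb (quads C)) > 0}" using C(2) by blast
  qed
  moreover have "finite (S_Mon d s B)" unfolding S using finU by simp
  ultimately have "card {C. C \<subseteq> ?U \<and> card C = s \<and> C \<inter> ?A \<noteq> {}} \<le>
      card {C \<in> S_Mon d s B. measure (seq_measure (\<nu> C)) (SurArb (quads C)) > 0}" (is "_ \<le> ?G")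
    by (intro card_mono) auto
  then have G: "real (N choose s) - real ((N - a) choose s) \<le> real ?G"
    using card_subsets_meeting[OF finU AU, of s] unfolding N_def a_def by linarith
  have "real ((N - a) choose s) / real (N choose s) \<le> (real (N - a) / real N) ^ s"
  proof -
    have "((N - a) choose s) * N ^ s \<le> (N choose s) * (N - a) ^ s" by (rule binomial_ratio_le) simp
    then have "real ((N - a) choose s) * real N ^ s \<le> real (N choose s) * real (N - a) ^ s"
      by (metis of_nat_le_iff of_nat_mult of_nat_power)
    then show ?thesis using pos N0 by (simp add: field_simps)
  qed
  also have "\<dots> \<le> (1 - (real B / (2 * real B + 1)) ^ h) ^ s"
  proof (rule power_mono)
    have "real N \<le> real ((2 * B + 1) ^ d)" using NU by (rule of_nat_mono)
    also have "\<dots> = (2 * real B + 1) ^ d" by (simp add: add.commute)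
    finally have "real N \<le> (2 * real B + 1) ^ d" .
    then have N': "real N \<le> (2 * real B + 1) ^ h * (2 * real B + 1) ^ h" unfolding h(2) power_add .
    have "real (B ^ h * (2 * B + 1) ^ h) \<le> real a" using ge by (rule of_nat_mono)
    then have a': "real B ^ h * (2 * real B + 1) ^ h \<le> real a" by (simp add: add.commute)
    have p: "(2 * real B + 1) ^ h > 0" by simp
    \<comment> \<open>Expanding by the contribution of the free positions exhibits the ratio as the
      lower bound for \<open>a\<close> over the upper bound for \<open>N\<close>.\<close>
    have "(real B / (2 * real B + 1)) ^ h = (real B ^ h * (2 * real B + 1) ^ h) / ((2 * real B + 1) ^ h * (2 * real B + 1) ^ h)"
      using p by (simp add: power_divide)
    also have "\<dots> \<le> real a / real N"
      by (rule frac_le) (use a' N' N0 in auto)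
    finally show "real (N - a) / real N \<le> 1 - (real B / (2 * real B + 1)) ^ h"
      using aN N0 by (simp add: of_nat_diff diff_divide_distrib)
  qed simp
  finally have "1 - (1 - (real B / (2 * real B + 1)) ^ h) ^ s \<le> (real (N choose s) - real ((N - a) choose s)) / real (N choose s)"
    using pos by (simp add: diff_divide_distrib)
  also have "\<dots> \<le> real ?G / real (N choose s)" using G by (rule divide_right_mono) simp
  finally show ?thesis unfolding cS h_def .
qed

theorem theorem5p9:
  fixes d s :: nat and \<nu> :: "int poly set \<Rightarrow> ratfun poly measure"
  assumes "d > 0" and "even d" and "s \<ge> 2"
    and "\<And>B C. C \<in> S_Mon d s B \<Longrightarrow> strictly_positive_prob (quads C) (\<nu> C)"
  shows "liminf (\<lambda>B. ereal
           (real (card {C \<in> S_Mon d s B. measure (seq_measure (\<nu> C)) (SurArb (quads C)) > 0})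
             / real (card (S_Mon d s B))))
         \<ge> ereal (1 - (1 - (1 / 2) ^ (d div 2)) ^ s)"
proof -
  let ?g = "\<lambda>B. 1 - (1 - (real B / (2 * real B + 1)) ^ (d div 2)) ^ s"
  have t: "(\<lambda>B. real B / (2 * real B + 1)) \<longlonglongrightarrow> 1 / 2" by real_asymp
  have "?g \<longlonglongrightarrow> 1 - (1 - (1 / 2) ^ (d div 2)) ^ s"
    by (intro tendsto_diff tendsto_const tendsto_power t)
  then have "(\<lambda>B. ereal (?g B)) \<longlonglongrightarrow> ereal (1 - (1 - (1 / 2) ^ (d div 2)) ^ s)" by simp
  then have "ereal (1 - (1 - (1 / 2) ^ (d div 2)) ^ s) = liminf (\<lambda>B. ereal (?g B))"
    by (rule lim_imp_Liminf[OF sequentially_bot, symmetric])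
  also have "\<dots> \<le> liminf (\<lambda>B. ereal
           (real (card {C \<in> S_Mon d s B. measure (seq_measure (\<nu> C)) (SurArb (quads C)) > 0})
             / real (card (S_Mon d s B))))"
    using proportion_lower_bound[OF assms(1-3) _ assms(4)]
    by (intro Liminf_mono eventually_sequentiallyI[of "max 1 s"]) simp
  finally show ?thesis .
qed

end
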